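(* Let $G$ be a (finite) tree, let $n\geq 4$ be an integer, and let $J_n(G)$ be the $n$-path ideal of $G$ over a field $\Bbbk$. Then the following statements are equivalent: (1) $J_n(G)$ has linear quotients; (2) $J_n(G)$ has linear resolution; (3) either of the following holds: (i) $n=4$, and $G$ does not contain $P_4+P_4$ or $L_{5,3}$ as an induced subgraph; (ii) $n\geq 5$, and $G$ does not contain $P_n+P_n$ as an induced subgraph, and $G$ does not contain $L_{n,k}$ as an induced subgraph for any integer $k\in[3,(n+1)/2]$; (4) either $\operatorname{diam}(G)<n-1$ or $G$ satisfies the $(F_n)$ condition.
   Context: Graphs are finite and simple. "Contains $H$ as an induced subgraph" means up to isomorphism. $P_n$ is the path graph on $n$ vertices, and $G+H$ denotes the disjoint union of graphs. For a tree $G$, $\operatorname{diam}(G)$ is the length (number of edges) of a longest path in $G$. For a graph $G$ with $V(G)=\{x_1,\dots,x_m\}$ and a field $\Bbbk$, the $n$-path ideal $J_n(G)\subseteq \Bbbk[x_1,\dots,x_m]$ is the ideal generated by all monomials $x_{i_1}x_{i_2}\cdots x_{i_n}$ such that $x_{i_1},\dots,x_{i_n}$ are $n$ distinct vertices with $x_{i_j}x_{i_{j+1}}\in E(G)$ for $1\le j\le n-1$. For integers $n\geq 5$ and $k\in[3,n-2]$, $L_{n,k}$ is the graph with vertex set $\{x_1,\dots,x_n\}\cup\{y_1,\dots,y_{k-1}\}$ (all distinct) and edge set $\{x_ix_{i+1}: 1\le i\le n-1\}\cup\{y_iy_{i+1}: 1\le i\le k-2\}\cup\{y_{k-1}x_k\}$.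 Condition $(F_n)$ for a tree $G$: for $n=4$, $(F_4)$ means $\operatorname{diam}(G)\in[3,7]$ and $G$ does not contain $P_4+P_4$ or $L_{5,3}$ as an induced subgraph; for $n\geq 5$, $(F_n)$ means $\operatorname{diam}(G)\in[n-1,2n-1]$ and $G$ does not contain $P_n+P_n$, nor $L_{n,k}$ for any integer $k\in[3,n-2]$, as an induced subgraph. $\mathrm{Mingens}(I)$ is the unique minimal monomial generating set of a monomial ideal $I$. A monomial ideal $I$ generated in a single degree $d$ has linear resolution if its Castelnuovo–Mumford regularity $\operatorname{reg} I=\max\{j-i:\beta_{i,j}(I)\ne 0\}$ equals $d$. A monomial ideal $I$ has linear quotients if $\mathrm{Mingens}(I)$ can be ordered as $m_1,\dots,m_q$ so that for every $1\le k\le q-1$ the colon ideal $(m_1,\dots,m_k):(m_{k+1})$ is generated by a set of variables. The zero ideal is regarded as having linear quotients and linear resolution. *)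

theory Defs
  imports
    "HOL-Library.Poly_Mapping"
    "HOL-Library.Extended_Real"
    "Jordan_Normal_Form.Matrix"
begin

section \<open>Graphs\<close>

record 'a graph =
  verts :: "'a set"
  edges :: "'a set set"

definition simple_graph :: "'a graph \<Rightarrow> bool" where
  "simple_graph G \<longleftrightarrow> finite (verts G) \<and> (\<forall>e\<in>edges G. e \<subseteq> verts G \<and> card e = 2)"

abbreviation adj :: "'a graph \<Rightarrow> 'a \<Rightarrow> 'a \<Rightarrow> bool" where
  "adj G u v \<equiv> {u, v} \<in> edges G"

text \<open>Paths are nonempty lists of distinct vertices; a path \<^term>\<open>p\<close> has length (number of edges)
  \<^term>\<open>length p - 1\<close>.\<close>

definition is_path :: "'a graph \<Rightarrow> 'a list \<Rightarrow> bool" where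
  "is_path G p \<longleftrightarrow> p \<noteq> [] \<and> distinct p \<and> set p \<subseteq> verts G \<and> successively (adj G) p"

definition connected_graph :: "'a graph \<Rightarrow> bool" where
  "connected_graph G \<longleftrightarrow> verts G \<noteq> {} \<and>
     (\<forall>u\<in>verts G. \<forall>v\<in>verts G. \<exists>p. is_path G p \<and> hd p = u \<and> last p = v)"

definition is_cycle :: "'a graph \<Rightarrow> 'a list \<Rightarrow> bool" where
  "is_cycle G p \<longleftrightarrow> is_path G p \<and> 3 \<le> length p \<and> adj G (last p) (hd p)"

definition is_tree :: "'a graph \<Rightarrow> bool" where
  "is_tree G \<longleftrightarrow> simple_graph G \<and> connected_graph G \<and> \<not> (\<exists>p. is_cycle G p)"

definition diam :: "'a graph \<Rightarrow> nat" where
  "diam G = Max {length p - 1 | p. is_path G p}"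

definition induced_subgraph :: "'a graph \<Rightarrow> 'a set \<Rightarrow> 'a graph" where
  "induced_subgraph G W = \<lparr>verts = W, edges = {e \<in> edges G. e \<subseteq> W}\<rparr>"

definition graph_iso :: "'a graph \<Rightarrow> 'b graph \<Rightarrow> bool" where
  "graph_iso G H \<longleftrightarrow> (\<exists>f. bij_betw f (verts G) (verts H) \<and>
     (\<forall>u\<in>verts G. \<forall>v\<in>verts G. adj G u v \<longleftrightarrow> adj H (f u) (f v)))"

definition contains_induced :: "'a graph \<Rightarrow> 'b graph \<Rightarrow> bool" where
  "contains_induced G H \<longleftrightarrow> (\<exists>W\<subseteq>verts G. graph_iso (induced_subgraph G W) H)"

definition path_graph :: "nat \<Rightarrow> nat graph" where
  "path_graph n = \<lparr>verts = {1..n}, edges = {{i, i + 1} | i. 1 \<le> i \<and> i + 1 \<le> n}\<rparr>"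

definition disjoint_union :: "'a graph \<Rightarrow> 'b graph \<Rightarrow> ('a + 'b) graph" where
  "disjoint_union G H = \<lparr>verts = verts G <+> verts H,
     edges = (\<lambda>e. Inl ` e) ` edges G \<union> (\<lambda>e. Inr ` e) ` edges H\<rparr>"

text \<open>\<^term>\<open>Inl i\<close> stands for $x_i$ and \<^term>\<open>Inr i\<close> for $y_i$.\<close>

definition L_graph :: "nat \<Rightarrow> nat \<Rightarrow> (nat + nat) graph" where
  "L_graph n k = \<lparr>verts = Inl ` {1..n} \<union> Inr ` {1..k - 1},
     edges = {{Inl i, Inl (i + 1)} | i. 1 \<le> i \<and> i \<le> n - 1}
           \<union> {{Inr i, Inr (i + 1)} | i. 1 \<le> i \<and> i \<le> k - 2}
           \<union> {{Inr (k - 1), Inl k}}\<rparr>"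

definition F_condition :: "nat \<Rightarrow> 'a graph \<Rightarrow> bool" where
  "F_condition n G \<longleftrightarrow>
     (n = 4 \<and> diam G \<in> {3..7} \<and>
        \<not> contains_induced G (disjoint_union (path_graph 4) (path_graph 4)) \<and>
        \<not> contains_induced G (L_graph 5 3)) \<or>
     (5 \<le> n \<and> diam G \<in> {n - 1..2 * n - 1} \<and>
        \<not> contains_induced G (disjoint_union (path_graph n) (path_graph n)) \<and>
        (\<forall>k\<in>{3..n - 2}. \<not> contains_induced G (L_graph n k)))"

section \<open>Polynomials and monomial ideals\<close>

text \<open>Exponent vectors are finitely supported functions \<^typ>\<open>'v \<Rightarrow>\<^sub>0 nat\<close>; the elements of
  \<open>'v\<close> are the variables.\<close>

type_synonym ('v, 'k) mpoly = "('v \<Rightarrow>\<^sub>0 nat) \<Rightarrow>\<^sub>0 'k"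

definition monomial :: "('v \<Rightarrow>\<^sub>0 nat) \<Rightarrow> ('v, 'k::field) mpoly" where
  "monomial t = Poly_Mapping.single t 1"

definition var :: "'v \<Rightarrow> ('v, 'k::field) mpoly" where
  "var v = monomial (Poly_Mapping.single v 1)"

definition tdeg :: "('v \<Rightarrow>\<^sub>0 nat) \<Rightarrow> nat" where
  "tdeg t = (\<Sum>v\<in>Poly_Mapping.keys t. Poly_Mapping.lookup t v)"

definition ideal_gen :: "('v, 'k::field) mpoly set \<Rightarrow> ('v, 'k) mpoly set" where
  "ideal_gen B = Modules.module.span (*) B"

definition colon_ideal ::
    "('v, 'k::field) mpoly set \<Rightarrow> ('v, 'k) mpoly set \<Rightarrow> ('v, 'k) mpoly set" where
  "colon_ideal I J = {f. \<forall>g\<in>J. f * g \<in> I}"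

definition mingens :: "('v, 'k::field) mpoly set \<Rightarrow> ('v, 'k) mpoly set" where
  "mingens I = (THE B. B \<subseteq> range monomial \<and> ideal_gen B = I \<and>
     (\<forall>C. C \<subset> B \<longrightarrow> ideal_gen C \<noteq> I))"

text \<open>With zero-based lists, \<^term>\<open>take k ms\<close> is $m_1,\dots,m_k$ and \<^term>\<open>ms ! k\<close> is $m_{k+1}$.\<close>

definition has_linear_quotients :: "('v, 'k::field) mpoly set \<Rightarrow> bool" where
  "has_linear_quotients I \<longleftrightarrow> (\<exists>ms. distinct ms \<and> set ms = mingens I \<and>
     (\<forall>k. 1 \<le> k \<and> k < length ms \<longrightarrow>
        (\<exists>X. colon_ideal (ideal_gen (set (take k ms))) (ideal_gen {ms ! k}) = ideal_gen (var ` X))))"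

section \<open>Minimal graded free resolutions and regularity\<close>

text \<open>A graded complex of free modules of finite rank
  $\cdots \to F_1 \to F_0 \to S$ over the standard graded polynomial ring $S$, given by matrices:
  $F_i = \bigoplus_{b} S(-d_b)$, where $d$ is the list \<^term>\<open>shifts F i\<close>;
  \<^term>\<open>differential F i\<close> is the matrix of $F_{i+1} \to F_i$, and \<^term>\<open>augmentation F\<close> is the
  one-row matrix of $F_0 \to S$. Natural-number shifts suffice, since the generators occurring in a
  minimal graded free resolution of an ideal of $S$ have nonnegative degrees.\<close>

record 'p graded_complex =
  shifts :: "nat \<Rightarrow> nat list"
  augmentation :: "'p mat"
  differential :: "nat \<Rightarrow> 'p mat"

definition mat_ker :: "'p::semiring_0 mat \<Rightarrow> 'p vec set" where
  "mat_ker A = {v \<in> carrier_vec (dim_col A). A *\<^sub>v v = 0\<^sub>v (dim_row A)}"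

definition mat_im :: "'p::semiring_0 mat \<Rightarrow> 'p vec set" where
  "mat_im A = (\<lambda>v. A *\<^sub>v v) ` carrier_vec (dim_col A)"

text \<open>Degree-0 homogeneous maps $\bigoplus_b S(-e_b) \to \bigoplus_a S(-d_a)$: the $(a,b)$ entry is
  zero or homogeneous of degree $e_b - d_a$, so it is zero if this is negative.\<close>

definition homogeneous_mat :: "nat list \<Rightarrow> nat list \<Rightarrow> ('v, 'k::field) mpoly mat \<Rightarrow> bool" where
  "homogeneous_mat d e A \<longleftrightarrow> A \<in> carrier_mat (length d) (length e) \<and>
     (\<forall>a<length d. \<forall>b<length e. \<forall>t\<in>Poly_Mapping.keys (A $$ (a, b)). tdeg t + d ! a = e ! b)"

definition is_graded_resolution ::
    "('v, 'k::field) mpoly set \<Rightarrow> ('v, 'k) mpoly graded_complex \<Rightarrow> bool" where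
  "is_graded_resolution I F \<longleftrightarrow>
     homogeneous_mat [0] (shifts F 0) (augmentation F) \<and>
     (\<forall>i. homogeneous_mat (shifts F i) (shifts F (Suc i)) (differential F i)) \<and>
     (\<lambda>v. v $ 0) ` mat_im (augmentation F) = I \<and>
     mat_ker (augmentation F) = mat_im (differential F 0) \<and>
     (\<forall>i. mat_ker (differential F i) = mat_im (differential F (Suc i)))"

text \<open>Minimality: all matrix entries of the maps $F_{i+1} \to F_i$ lie in the ideal generated by
  the variables, i.e. have constant coefficient zero.\<close>

definition is_minimal_resolution ::
    "('v, 'k::field) mpoly set \<Rightarrow> ('v, 'k) mpoly graded_complex \<Rightarrow> bool" where
  "is_minimal_resolution I F \<longleftrightarrow> is_graded_resolution I F \<and>
     (\<forall>i. \<forall>p\<in>elements_mat (differential F i). Poly_Mapping.lookup p 0 = 0)"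

text \<open>The number of summands $S(-j)$ in $F_i$. The choice of the minimal graded free resolution is
  immaterial, because it is unique up to isomorphism; it exists for every homogeneous ideal in
  finitely many variables.\<close>

definition betti :: "('v, 'k::field) mpoly set \<Rightarrow> nat \<Rightarrow> nat \<Rightarrow> nat" where
  "betti I i j = count_list (shifts (SOME F. is_minimal_resolution I F) i) j"

text \<open>The supremum is a maximum for nonzero homogeneous ideals in finitely many variables.
  For the zero ideal it is \<^term>\<open>- \<infinity> :: ereal\<close>.\<close>

definition regularity :: "('v, 'k::field) mpoly set \<Rightarrow> ereal" where
  "regularity I = Sup {ereal (real j - real i) | i j. betti I i j \<noteq> 0}"

definition has_linear_resolution :: "('v, 'k::field) mpoly set \<Rightarrow> bool" where
  "has_linear_resolution I \<longleftrightarrow> I = {0} \<or>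
     (\<exists>d. (\<exists>T. mingens I = monomial ` T \<and> (\<forall>t\<in>T. tdeg t = d)) \<and> regularity I = ereal (real d))"

section \<open>Path ideals\<close>

definition path_ideal :: "nat \<Rightarrow> 'v graph \<Rightarrow> ('v, 'k::field) mpoly set" where
  "path_ideal n G = ideal_gen {(\<Prod>v\<leftarrow>p. var v) | p. is_path G p \<and> length p = n}"

end

theory Submission
  imports Defs "HOL-Library.Product_Lexorder"
begin

text \<open>
  A squarefree monomial ideal has a minimal free resolution which is multigraded by sets of
  variables, and Betti numbers do not depend on the resolution: the comparison maps between two
  resolutions are mutually inverse modulo the variables. If the generators have linear quotients,
  then so do their syzygies, one degree higher, so linear quotients propagate to a linear resolution.

  An induced $P_n + P_n$ or $L_{n,k}$ with $3 \le k \le n - 2$ contains two paths on $n$ vertices such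
  that no other path in it differs from the first one in a single vertex; the syzygy between the two
  is then not generated by linear ones. For $L_{5,3}$ and $n = 4$ the first nonlinear syzygies
  occur one step later: the six paths on four vertices form a hexagon of linear syzygies.

  Conversely, let $p$ be a longest path of the tree. Excluding the graphs $L_{n,k}$ with
  $k \le (n + 1)/2$ forces every path on $n$ vertices to run along $p$ except for its end points.
  Ordering these paths from left to right along $p$ gives linear quotients, as two paths that are
  far apart along $p$ would form an induced $P_n + P_n$.
\<close>

section \<open>Strands of squarefree modules\<close>

text \<open>Two facts keep the algebra elementary. In multidegree \<alpha> a stage depends only on
  the support of \<alpha>, so a polynomial resolution amounts to exact sequences of
  finite-dimensional spaces, one for each of the finitely many sets of variables. And
  \<open>is_graded_resolution\<close> allows an endless tail, so stages can be added one by one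
  without any bound on the length. As \<open>betti\<close> refers to an unspecified minimal
  resolution, some uniqueness is unavoidable; regularity only asks which Betti numbers vanish, so
  comparing sets of shifts suffices. The implications run (1) => (2) => (4) => (3) => (1): linearity
  rules out all k from 3 to n - 2, while the way back needs only k <= (n + 1)/2. The gap closes
  because a leg of r vertices on a longest path can be used with r or with n - 1 - r vertices,
  whichever is smaller. For n = 4 the range 3 <= k <= n - 2 is empty, so the graph
  \<open>L_graph 5 3\<close> needs an argument of its own.\<close>

text \<open>A stage of a squarefree multigraded resolution: the pair \<open>(s, c)\<close> is a generator of multidegree
  \<open>s\<close> in the free module on the generators \<open>e\<^sub>a\<close> of the previous stage, of multidegrees \<open>s\<^sub>a\<close>, namely
  the sum of the \<open>c a\<close> times $x^{s - s_a} e_a$. In multidegree \<open>s\<close> everything becomes linear algebra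
  over the field.\<close>

type_synonym ('v, 'k) gens = "('v set \<times> (nat \<Rightarrow> 'k)) list"

text \<open>The component of multidegree s of the free module on \<open>gs\<close>. A single
  monomial brings generator b to degree s, so one scalar per generator remains, and generators whose
  degree is not inside s contribute nothing. Coefficients beyond the list vanish, so that equality
  of vectors is equality of functions.\<close>

definition strand :: "('v, 'k::field) gens \<Rightarrow> 'v set \<Rightarrow> (nat \<Rightarrow> 'k) set" where
  "strand gs s = {y. \<forall>b. y b \<noteq> 0 \<longrightarrow> b < length gs \<and> fst (gs ! b) \<subseteq> s}"

definition lincomb :: "('v, 'k::field) gens \<Rightarrow> (nat \<Rightarrow> 'k) \<Rightarrow> nat \<Rightarrow> 'k" where
  "lincomb gs y = (\<lambda>a. \<Sum>b<length gs. y b * snd (gs ! b) a)"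

definition gen_span :: "('v, 'k::field) gens \<Rightarrow> 'v set \<Rightarrow> (nat \<Rightarrow> 'k) set" where
  "gen_span gs s = lincomb gs ` strand gs s"

definition syz :: "('v, 'k::field) gens \<Rightarrow> 'v set \<Rightarrow> (nat \<Rightarrow> 'k) set" where
  "syz gs s = {z \<in> strand gs s. lincomb gs z = (\<lambda>_. 0)}"

definition syz_gens :: "('v, 'k::field) gens \<Rightarrow> ('v, 'k) gens \<Rightarrow> bool" where
  "syz_gens gs gs' \<longleftrightarrow> (\<forall>s. gen_span gs' s = syz gs s)"

text \<open>Minimality without polynomials: in a relation of degree s the coefficient of generator a
  is \<open>z a\<close> times a monomial, and this monomial is 1 exactly when a has degree
  s.\<close>

definition irredundant :: "('v, 'k::field) gens \<Rightarrow> bool" where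
  "irredundant gs \<longleftrightarrow> (\<forall>s. \<forall>z\<in>syz gs s. \<forall>a. z a \<noteq> 0 \<longrightarrow> fst (gs ! a) \<noteq> s)"

section \<open>Subspace properties of strands, spans and syzygies\<close>

lemma strand_mono: "s \<subseteq> t \<Longrightarrow> strand gs s \<subseteq> strand gs t"
  unfolding strand_def by blast

lemma syz_mono: "s \<subseteq> t \<Longrightarrow> syz gs s \<subseteq> syz gs t"
  unfolding syz_def using strand_mono by blast

lemma strand_add_scaled:
  assumes "x \<in> strand gs s" "y \<in> strand gs s"
  shows "(\<lambda>a. x a + c * y a) \<in> strand gs s"
proof -
  have "x b \<noteq> 0 \<or> y b \<noteq> 0" if "x b + c * y b \<noteq> 0" for b using that by auto
  then show ?thesis using assms unfolding strand_def by blast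
qed

lemma lincomb_add_scaled:
  "lincomb gs (\<lambda>a. x a + c * y a) = (\<lambda>a. lincomb gs x a + c * lincomb gs y a)"
  unfolding lincomb_def by (simp add: algebra_simps sum.distrib sum_distrib_left)

lemma syz_add_scaled:
  assumes "x \<in> syz gs s" "y \<in> syz gs s"
  shows "(\<lambda>a. x a + c * y a) \<in> syz gs s"
  using assms strand_add_scaled[of x gs s y c] unfolding syz_def by (simp add: lincomb_add_scaled)

lemma zero_in_syz: "(\<lambda>_. 0) \<in> syz gs s"
  unfolding syz_def strand_def lincomb_def by simp

lemma gen_span_add_scaled:
  assumes "x \<in> gen_span gs s" "y \<in> gen_span gs s"
  shows "(\<lambda>a. x a + c * y a) \<in> gen_span gs s"
proof -
  from assms obtain u v where u: "u \<in> strand gs s" "x = lincomb gs u"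
    and v: "v \<in> strand gs s" "y = lincomb gs v" unfolding gen_span_def by blast
  have "(\<lambda>a. x a + c * y a) = lincomb gs (\<lambda>a. u a + c * v a)"
    using u v by (simp add: lincomb_add_scaled)
  then show ?thesis using strand_add_scaled[OF u(1) v(1)] unfolding gen_span_def by blast
qed

lemma syz_sum:
  assumes "finite A" "\<And>b. b \<in> A \<Longrightarrow> f b \<in> syz gs s"
  shows "(\<lambda>a. \<Sum>b\<in>A. y b * f b a) \<in> syz gs s"
  using assms
proof (induction rule: finite_induct)
  case empty
  then show ?case using zero_in_syz by simp
next
  case (insert b A)
  have "(\<lambda>a. (\<Sum>b\<in>A. y b * f b a) + y b * f b a) \<in> syz gs s"
    by (rule syz_add_scaled) (use insert in auto)
  then show ?case using insert by (simp add: add.commute)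
qed

section \<open>Irredundant generators of the syzygies\<close>

lemma finite_spanning_set:
  fixes V :: "(nat \<Rightarrow> 'k::field) set"
  assumes "\<And>x y c. x \<in> V \<Longrightarrow> y \<in> V \<Longrightarrow> (\<lambda>a. x a + c * y a) \<in> V"
    and "\<And>v a. v \<in> V \<Longrightarrow> m \<le> a \<Longrightarrow> v a = 0"
  shows "\<exists>B. finite B \<and> B \<subseteq> V \<and> (\<forall>v\<in>V. \<exists>y. v = (\<lambda>a. \<Sum>b\<in>B. y b * b a))"
  using assms
proof (induction m arbitrary: V)
  case 0
  have "v = (\<lambda>_. 0)" if "v \<in> V" for v using 0(2)[OF that] by auto
  then have "\<forall>v\<in>V. \<exists>y. v = (\<lambda>a. \<Sum>b\<in>{}. y b * b a)" unfolding sum.empty by blast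
  then show ?case by (metis empty_subsetI finite.emptyI)
next
  case (Suc m)
  let ?V = "{v \<in> V. v m = 0}"
  have "\<exists>B. finite B \<and> B \<subseteq> ?V \<and> (\<forall>v\<in>?V. \<exists>y. v = (\<lambda>a. \<Sum>b\<in>B. y b * b a))"
  proof (rule Suc.IH)
    fix v a assume "v \<in> ?V" "m \<le> a"
    then show "v a = 0" using Suc.prems(2)[of v a] by (cases "a = m") auto
  qed (use Suc.prems(1) in auto)
  then obtain B where B: "finite B" "B \<subseteq> ?V" "\<forall>v\<in>?V. \<exists>y. v = (\<lambda>a. \<Sum>b\<in>B. y b * b a)"
    by (elim exE conjE)
  show ?case
  proof (cases "V = ?V")
    case True
    then show ?thesis using B by (intro exI[of _ B]) auto
  next
    case False
    \<comment> \<open>Elimination: subtracting a multiple of w kills coordinate m, so w together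
      with the spanning set of the vectors with vanishing coordinate m spans V.\<close>
    then obtain w where w: "w \<in> V" "w m \<noteq> 0" by blast
    have wB: "w \<notin> B" using w B(2) by blast
    have "\<exists>y. v = (\<lambda>a. \<Sum>b\<in>insert w B. y b * b a)" if v: "v \<in> V" for v
    proof -
      have "(\<lambda>a. v a + (- (v m / w m)) * w a) \<in> ?V"
        using Suc.prems(1)[OF v w(1), of "- (v m / w m)"] w by simp
      from bspec[OF B(3) this] obtain y
        where y: "(\<lambda>a. v a + (- (v m / w m)) * w a) = (\<lambda>a. \<Sum>b\<in>B. y b * b a)" by blast
      let ?y = "y(w := v m / w m)"
      have "(\<Sum>b\<in>insert w B. ?y b * b a) = v a" for a
      proof -
        have "(\<Sum>b\<in>B. ?y b * b a) = (\<Sum>b\<in>B. y b * b a)"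
          by (rule sum.cong) (use wB in auto)
        then have "(\<Sum>b\<in>insert w B. ?y b * b a) = v m / w m * w a + (\<Sum>b\<in>B. y b * b a)"
          using B(1) wB by simp
        also have "\<dots> = v a" using fun_cong[OF y, of a] by (simp add: algebra_simps)
        finally show ?thesis .
      qed
      then show ?thesis by metis
    qed
    then show ?thesis using B w by (intro exI[of _ "insert w B"]) auto
  qed
qed

text \<open>Sets in place of lists make it easy to delete a generator and to compare cardinalities;
  \<open>gen_span_distinct\<close> translates back.\<close>

definition set_span :: "('v set \<times> (nat \<Rightarrow> 'k::field)) set \<Rightarrow> 'v set \<Rightarrow> (nat \<Rightarrow> 'k) set" where
  "set_span P s = {(\<lambda>a. \<Sum>p | p \<in> P \<and> fst p \<subseteq> s. y p * snd p a) | y. True}"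

lemma set_spanI: "x = (\<lambda>a. \<Sum>p | p \<in> P \<and> fst p \<subseteq> s. y p * snd p a) \<Longrightarrow> x \<in> set_span P s"
  unfolding set_span_def by (rule CollectI) (rule exI[of _ y], simp)

lemma sum_nth_distinct:
  assumes "distinct xs"
  shows "(\<Sum>i<length xs. f (xs ! i)) = sum f (set xs)"
  using sum.reindex_bij_betw[OF bij_betw_nth[OF assms refl refl]] by blast

lemma lincomb_distinct:
  assumes "distinct gs" "y \<in> strand gs s" "\<And>b. b < length gs \<Longrightarrow> y b = z (gs ! b)"
  shows "lincomb gs y a = (\<Sum>p | p \<in> set gs \<and> fst p \<subseteq> s. z p * snd p a)"
proof -
  have "lincomb gs y a = (\<Sum>b<length gs. z (gs ! b) * snd (gs ! b) a)"
    unfolding lincomb_def by (rule sum.cong) (use assms(3) in auto)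
  also have "\<dots> = (\<Sum>p\<in>set gs. z p * snd p a)"
    using sum_nth_distinct[OF assms(1), of "\<lambda>p. z p * snd p a"] .
  also have "\<dots> = (\<Sum>p | p \<in> set gs \<and> fst p \<subseteq> s. z p * snd p a)"
  proof (rule sum.mono_neutral_right)
    show "\<forall>p\<in>set gs - {p \<in> set gs. fst p \<subseteq> s}. z p * snd p a = 0"
    proof
      fix p assume "p \<in> set gs - {p \<in> set gs. fst p \<subseteq> s}"
      then obtain b where b: "b < length gs" "p = gs ! b" "\<not> fst p \<subseteq> s" by (auto simp: in_set_conv_nth)
      then have "y b = 0" using assms(2) unfolding strand_def by auto
      then show "z p * snd p a = 0" using assms(3) b by simp
    qed
  qed auto
  finally show ?thesis .
qed

lemma ex_nth_value:
  assumes "distinct xs"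
  shows "\<exists>z. \<forall>b<length xs. y b = z (xs ! b)"
  by (rule exI[of _ "\<lambda>p. y (THE b. b < length xs \<and> xs ! b = p)"])
    (use assms in \<open>auto intro!: arg_cong[of _ _ y] the_equality[symmetric] simp: nth_eq_iff_index_eq\<close>)

lemma gen_span_distinct:
  assumes "distinct gs"
  shows "gen_span gs s = set_span (set gs) s"
proof
  show "gen_span gs s \<subseteq> set_span (set gs) s"
  proof
    fix x assume "x \<in> gen_span gs s"
    then obtain y where y: "y \<in> strand gs s" "x = lincomb gs y" unfolding gen_span_def by blast
    obtain z where z: "\<forall>b<length gs. y b = z (gs ! b)" using ex_nth_value[OF assms] by metis
    show "x \<in> set_span (set gs) s"
      using lincomb_distinct[OF assms y(1)] z y unfolding set_span_def by blast
  qed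
  show "set_span (set gs) s \<subseteq> gen_span gs s"
  proof
    fix x assume "x \<in> set_span (set gs) s"
    then obtain z where z: "x = (\<lambda>a. \<Sum>p | p \<in> set gs \<and> fst p \<subseteq> s. z p * snd p a)"
      unfolding set_span_def by blast
    define z' where "z' = (\<lambda>p. if fst p \<subseteq> s then z p else 0)"
    define y where "y = (\<lambda>b. if b < length gs then z' (gs ! b) else 0)"
    have y: "y \<in> strand gs s" unfolding strand_def y_def z'_def by auto
    have "lincomb gs y a = x a" for a
      using lincomb_distinct[OF assms y, of z' a] unfolding z by (simp add: y_def z'_def)
    then have "x = lincomb gs y" by auto
    then show "x \<in> gen_span gs s" using y unfolding gen_span_def by blast
  qed
qed

definition set_syz_gens :: "('v, 'k::field) gens \<Rightarrow> ('v set \<times> (nat \<Rightarrow> 'k)) set \<Rightarrow> bool" where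
  "set_syz_gens gs P \<longleftrightarrow> finite P \<and> (\<forall>s. set_span P s = syz gs s)"

lemma set_syz_gensI:
  assumes "finite P" "\<And>p. p \<in> P \<Longrightarrow> snd p \<in> syz gs (fst p)" "\<And>s. syz gs s \<subseteq> set_span P s"
  shows "set_syz_gens gs P"
proof -
  have "(\<lambda>a. \<Sum>p | p \<in> P \<and> fst p \<subseteq> s. y p * snd p a) \<in> syz gs s" for y s
  proof (rule syz_sum)
    show "snd p \<in> syz gs s" if "p \<in> {p \<in> P. fst p \<subseteq> s}" for p
      using that assms(2)[of p] syz_mono[of "fst p" s gs] by blast
  qed (use assms(1) in simp)
  then show ?thesis using assms unfolding set_syz_gens_def set_span_def by blast
qed

lemma snd_in_set_span:
  assumes "finite P" "p \<in> P" shows "snd p \<in> set_span P (fst p)"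
proof -
  have "(\<Sum>q | q \<in> P \<and> fst q \<subseteq> fst p. (if q = p then 1 else 0) * snd q a) = snd p a" for a
  proof -
    have "(\<Sum>q | q \<in> P \<and> fst q \<subseteq> fst p. (if q = p then 1 else 0) * snd q a)
      = (\<Sum>q | q \<in> P \<and> fst q \<subseteq> fst p. (if q = p then snd q a else 0))"
      by (rule sum.cong) auto
    also have "\<dots> = snd p a" using assms by (subst sum.delta) auto
    finally show ?thesis .
  qed
  then show ?thesis by (intro set_spanI[where y = "\<lambda>q. if q = p then 1 else 0"]) auto
qed

text \<open>There are only finitely many sets of variables, so spanning sets of
  \<open>syz gs s\<close> for all degrees s can simply be collected. Minimality is obtained
  afterwards by counting.\<close>

lemma ex_set_syz_gens:
  fixes gs :: "('v::finite, 'k::field) gens"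
  shows "\<exists>P. set_syz_gens gs P"
proof -
  have "\<exists>B. finite B \<and> B \<subseteq> syz gs s \<and> (\<forall>v\<in>syz gs s. \<exists>y. v = (\<lambda>a. \<Sum>b\<in>B. y b * b a))" for s
  proof (rule finite_spanning_set[where m = "length gs"])
    show "v a = 0" if "v \<in> syz gs s" "length gs \<le> a" for v a
      using that unfolding syz_def strand_def by force
  qed (rule syz_add_scaled)
  then have "\<exists>B. \<forall>s. finite (B s) \<and> B s \<subseteq> syz gs s \<and> (\<forall>v\<in>syz gs s. \<exists>y. v = (\<lambda>a. \<Sum>b\<in>B s. y b * b a))"
    by (intro choice allI)
  then obtain B where B': "\<forall>s. finite (B s) \<and> B s \<subseteq> syz gs s \<and>
      (\<forall>v\<in>syz gs s. \<exists>y. v = (\<lambda>a. \<Sum>b\<in>B s. y b * b a))"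
    by (elim exE)
  note B = conjunct1[OF spec[OF B']] conjunct1[OF conjunct2[OF spec[OF B']]] conjunct2[OF conjunct2[OF spec[OF B']]]
  let ?P = "Sigma UNIV B"
  have "set_syz_gens gs ?P"
  proof (rule set_syz_gensI)
    show fin: "finite ?P" using B(1) by (intro finite_SigmaI) auto
    show "snd p \<in> syz gs (fst p)" if "p \<in> ?P" for p
    proof -
      have "snd p \<in> B (fst p)" using that by auto
      then show ?thesis using B(2) by blast
    qed
    show "syz gs s \<subseteq> set_span ?P s" for s
    proof
      fix z assume "z \<in> syz gs s"
      from bspec[OF B(3) this] obtain y where y: "z = (\<lambda>a. \<Sum>b\<in>B s. y b * b a)" by (elim exE)
      let ?y = "\<lambda>p. if fst p = s then y (snd p) else 0"
      have "(\<Sum>p | p \<in> ?P \<and> fst p \<subseteq> s. ?y p * snd p a) = z a" for a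
      proof -
        have "(\<Sum>p | p \<in> ?P \<and> fst p \<subseteq> s. ?y p * snd p a) = (\<Sum>p\<in>{s} \<times> B s. ?y p * snd p a)"
        proof (rule sum.mono_neutral_right)
          show "finite {p \<in> ?P. fst p \<subseteq> s}" using fin by simp
        qed auto
        also have "\<dots> = (\<Sum>b\<in>B s. y b * b a)"
          by (rule sum.reindex_bij_witness[of _ "\<lambda>b. (s, b)" snd]) auto
        finally show ?thesis unfolding y .
      qed
      then show "z \<in> set_span ?P s" by (intro set_spanI[where y = ?y]) auto
    qed
  qed
  then show ?thesis by blast
qed

text \<open>A generating set of least cardinality admits no relation with a unit coefficient.\<close>

lemma ex_irredundant_syz_gens:
  fixes gs :: "('v::finite, 'k::field) gens"
  shows "\<exists>gs'. syz_gens gs gs' \<and> irredundant gs'"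
proof -
  obtain P where P: "set_syz_gens gs P" "\<And>Q. set_syz_gens gs Q \<Longrightarrow> card P \<le> card Q"
    using ex_set_syz_gens[of gs] ex_has_least_nat[of "set_syz_gens gs" _ card] by blast
  then have finP: "finite P" and spanP: "\<And>s. set_span P s = syz gs s"
    unfolding set_syz_gens_def by auto
  obtain gs' where gs': "distinct gs'" "set gs' = P"
    using finite_distinct_list[OF finP] by blast
  have "syz_gens gs gs'" unfolding syz_gens_def using gen_span_distinct[OF gs'(1)] gs'(2) spanP by simp
  moreover have "irredundant gs'"
    unfolding irredundant_def
  proof (intro allI ballI impI notI)
    fix s z a assume z: "z \<in> syz gs' s" "z a \<noteq> 0" and s: "fst (gs' ! a) = s"
    have zs: "z \<in> strand gs' s" and z0: "lincomb gs' z = (\<lambda>_. 0)" using z unfolding syz_def by auto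
    define p where "p = gs' ! a"
    have a: "a < length gs'" using zs z(2) unfolding strand_def by blast
    obtain w where w: "\<forall>b<length gs'. z b = w (gs' ! b)" using ex_nth_value[OF gs'(1)] by metis
    have p: "p \<in> P" "fst p = s" "w p \<noteq> 0" using a gs' s w z(2) unfolding p_def by auto
    have w0: "(\<Sum>q | q \<in> P \<and> fst q \<subseteq> s. w q * snd q c) = 0" for c
      using lincomb_distinct[OF gs'(1) zs, of w c] w gs'(2) z0 by simp
    have "set_syz_gens gs (P - {p})"
    proof (rule set_syz_gensI)
      show "finite (P - {p})" using finP by simp
      show "snd q \<in> syz gs (fst q)" if "q \<in> P - {p}" for q
        using snd_in_set_span[OF finP, of q] spanP that by auto
      show "syz gs t \<subseteq> set_span (P - {p}) t" for t
      proof
        fix x assume "x \<in> syz gs t"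
        then obtain y where y: "x = (\<lambda>a. \<Sum>q | q \<in> P \<and> fst q \<subseteq> t. y q * snd q a)"
          using spanP unfolding set_span_def by blast
        show "x \<in> set_span (P - {p}) t"
        proof (cases "s \<subseteq> t")
          case False
          then have "{q \<in> P - {p}. fst q \<subseteq> t} = {q \<in> P. fst q \<subseteq> t}" using p(2) by auto
          then show ?thesis using y unfolding set_span_def by auto
        next
          case True
          \<comment> \<open>The relation divided by the coefficient of p and extended by zero
            outside degree s. It expresses p through the other generators in every degree containing
            s, and p occurs in no other degree.\<close>
          define v where "v = (\<lambda>q. if fst q \<subseteq> s then w q / w p else 0)"
          let ?A = "{q \<in> P. fst q \<subseteq> t}" and ?B = "{q \<in> P - {p}. fst q \<subseteq> t}"
          have AB: "?A = insert p ?B" "p \<notin> ?B" "finite ?B" using p True finP by auto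
          have v0: "(\<Sum>q\<in>?A. v q * snd q c) = 0" for c
          proof -
            have "(\<Sum>q\<in>?A. v q * snd q c) = (\<Sum>q | q \<in> P \<and> fst q \<subseteq> s. v q * snd q c)"
              by (rule sum.mono_neutral_right) (use finP True in \<open>auto simp: v_def\<close>)
            also have "\<dots> = (\<Sum>q | q \<in> P \<and> fst q \<subseteq> s. w q * snd q c) / w p"
              unfolding sum_divide_distrib by (rule sum.cong) (auto simp: v_def)
            finally show ?thesis using w0 by simp
          qed
          have "v p = 1" using p by (simp add: v_def)
          have "(\<Sum>q\<in>?B. (y q - y p * v q) * snd q c) = x c" for c
          proof -
            have "(\<Sum>q\<in>?B. (y q - y p * v q) * snd q c) = (\<Sum>q\<in>?A. (y q - y p * v q) * snd q c)"
              unfolding AB(1) using AB(2,3) \<open>v p = 1\<close> by simp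
            also have "\<dots> = (\<Sum>q\<in>?A. y q * snd q c) - y p * (\<Sum>q\<in>?A. v q * snd q c)"
              by (simp add: algebra_simps sum_subtractf sum_distrib_left)
            finally show ?thesis using v0 y by simp
          qed
          then show ?thesis by (intro set_spanI[where y = "\<lambda>q. y q - y p * v q"]) auto
        qed
      qed
    qed
    then have "card P \<le> card (P - {p})" using P(2) by blast
    then show False using p(1) finP card_Diff1_less[of P p] by simp
  qed
  ultimately show ?thesis by blast
qed

text \<open>The last premise describes a colon ideal degree by degree: in a degree t containing s,
  the new generator lies in the span of the earlier ones iff t contains one of the variables X. As X
  avoids s, the relation belonging to x in X has a degree of exactly d + 1 variables.\<close>

inductive linear_quotient_gens :: "nat \<Rightarrow> ('v, 'k::field) gens \<Rightarrow> bool" where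
  Nil: "linear_quotient_gens d []"
| snoc: "linear_quotient_gens d gs \<Longrightarrow> card s = d \<Longrightarrow> X \<inter> s = {} \<Longrightarrow>
    (\<forall>t. s \<subseteq> t \<longrightarrow> (c \<in> gen_span gs t \<longleftrightarrow> t \<inter> X \<noteq> {})) \<Longrightarrow> linear_quotient_gens d (gs @ [(s, c)])"

lemma linear_quotient_gens_card:
  "linear_quotient_gens d gs \<Longrightarrow> p \<in> set gs \<Longrightarrow> card (fst p) = d"
  by (induction rule: linear_quotient_gens.induct) auto

lemma strand_snoc:
  "y \<in> strand (gs @ [(s, c)]) t \<longleftrightarrow>
    (\<forall>b>length gs. y b = 0) \<and> (y (length gs) \<noteq> 0 \<longrightarrow> s \<subseteq> t) \<and> y(length gs := 0) \<in> strand gs t"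
  (is "?L \<longleftrightarrow> ?R")
proof -
  have "(y b \<noteq> 0 \<longrightarrow> b < length (gs @ [(s, c)]) \<and> fst ((gs @ [(s, c)]) ! b) \<subseteq> t) \<longleftrightarrow>
      (b > length gs \<longrightarrow> y b = 0) \<and> (b = length gs \<longrightarrow> y b \<noteq> 0 \<longrightarrow> s \<subseteq> t) \<and>
      ((y(length gs := 0)) b \<noteq> 0 \<longrightarrow> b < length gs \<and> fst (gs ! b) \<subseteq> t)" for b
    by (cases b "length gs" rule: linorder_cases) (simp_all add: nth_append)
  then have "?L \<longleftrightarrow> (\<forall>b. (b > length gs \<longrightarrow> y b = 0) \<and> (b = length gs \<longrightarrow> y b \<noteq> 0 \<longrightarrow> s \<subseteq> t) \<and>
      ((y(length gs := 0)) b \<noteq> 0 \<longrightarrow> b < length gs \<and> fst (gs ! b) \<subseteq> t))"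
    unfolding strand_def mem_Collect_eq by presburger
  also have "\<dots> \<longleftrightarrow> ?R" unfolding strand_def mem_Collect_eq by (simp only: all_conj_distrib simp_thms)
  finally show ?thesis .
qed

lemma lincomb_snoc:
  "lincomb (gs @ [(s, c)]) y = (\<lambda>a. lincomb gs y a + y (length gs) * c a)"
  unfolding lincomb_def by (simp add: nth_append)

lemma lincomb_upd: "lincomb gs (y(length gs := v)) = lincomb gs y"
  unfolding lincomb_def by (intro ext sum.cong) auto

lemma strand_length: "y \<in> strand gs t \<Longrightarrow> y (length gs) = 0"
  unfolding strand_def by blast

lemma gen_span_snoc:
  "x \<in> gen_span (gs @ [(s, c)]) t \<longleftrightarrow>
    x \<in> gen_span gs t \<or> (s \<subseteq> t \<and> (\<exists>v. \<exists>x'\<in>gen_span gs t. x = (\<lambda>a. x' a + v * c a)))"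
  (is "?L \<longleftrightarrow> ?R")
proof
  assume ?L
  then obtain y where y: "y \<in> strand (gs @ [(s, c)]) t" "x = lincomb (gs @ [(s, c)]) y"
    unfolding gen_span_def by blast
  let ?y = "y(length gs := 0)"
  have "lincomb gs ?y \<in> gen_span gs t" using y(1) unfolding gen_span_def strand_snoc by blast
  moreover have "x = (\<lambda>a. lincomb gs ?y a + y (length gs) * c a)"
    using y(2) by (simp add: lincomb_snoc lincomb_upd)
  ultimately show ?R using y(1) unfolding strand_snoc by (cases "y (length gs) = 0") auto
next
  assume ?R
  then obtain v x' where v: "x' \<in> gen_span gs t" "x = (\<lambda>a. x' a + v * c a)" "v \<noteq> 0 \<longrightarrow> s \<subseteq> t"
  proof
    assume "x \<in> gen_span gs t" then show ?thesis by (intro that[of x 0]) auto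
  qed blast
  then obtain y where y: "y \<in> strand gs t" "x' = lincomb gs y" unfolding gen_span_def by blast
  let ?y = "y(length gs := v)"
  have "?y(length gs := 0) = y" using strand_length[OF y(1)] by auto
  moreover have "y b = 0" if "b > length gs" for b using y(1) that unfolding strand_def by auto
  ultimately have "?y \<in> strand (gs @ [(s, c)]) t" unfolding strand_snoc using v(3) y(1) by auto
  moreover have "x = lincomb (gs @ [(s, c)]) ?y" using v y by (simp add: lincomb_snoc lincomb_upd)
  ultimately show ?L unfolding gen_span_def by blast
qed

lemma syz_snoc_zero:
  "z (length gs) = 0 \<Longrightarrow> z \<in> syz (gs @ [(s, c)]) t \<longleftrightarrow> z \<in> syz gs t"
proof -
  assume z: "z (length gs) = 0"
  then have "z(length gs := 0) = z" by auto
  moreover have "\<forall>b>length gs. z b = 0" if "z \<in> strand gs t" using that unfolding strand_def by auto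
  ultimately show ?thesis unfolding syz_def using z by (auto simp: strand_snoc lincomb_snoc)
qed

lemma lincomb_indicator:
  assumes "b < length gs"
  shows "lincomb gs (\<lambda>c. if c = b then 1 else 0) = snd (gs ! b)"
proof
  fix a
  have "lincomb gs (\<lambda>c. if c = b then 1 else 0) a = (\<Sum>c<length gs. if c = b then snd (gs ! c) a else 0)"
    unfolding lincomb_def by (rule sum.cong) auto
  then show "lincomb gs (\<lambda>c. if c = b then 1 else 0) a = snd (gs ! b) a" using assms by simp
qed

lemma syz_gens_nth:
  assumes "syz_gens gs gs'" "b < length gs'"
  shows "snd (gs' ! b) \<in> syz gs (fst (gs' ! b))"
proof -
  have "(\<lambda>c. if c = b then 1 else 0) \<in> strand gs' (fst (gs' ! b))" using assms(2) unfolding strand_def by auto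
  then have "snd (gs' ! b) \<in> gen_span gs' (fst (gs' ! b))"
    unfolding gen_span_def lincomb_indicator[OF assms(2), symmetric] by blast
  then show ?thesis using assms(1) unfolding syz_gens_def by blast
qed

lemma lincomb_nonzero:
  assumes "lincomb gs y a \<noteq> 0"
  obtains b where "b < length gs" "y b \<noteq> 0" "snd (gs ! b) a \<noteq> 0"
proof -
  obtain b where "b \<in> {..<length gs}" "y b * snd (gs ! b) a \<noteq> 0"
    using assms unfolding lincomb_def by (rule sum.not_neutral_contains_not_neutral)
  then show ?thesis using that[of b] by auto
qed

text \<open>If the colon of \<open>g\<^sub>j\<close> by the earlier generators is generated by the variables \<open>X\<^sub>j\<close>, the
  syzygies are generated by relations with leading terms \<open>x e\<^sub>j\<close>, \<open>x \<in> X\<^sub>j\<close>, and these again have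
  linear quotients.\<close>

lemma linear_quotient_syz_gens:
  fixes gs :: "('v::finite, 'k::field) gens"
  assumes "linear_quotient_gens d gs"
  shows "\<exists>gs'. syz_gens gs gs' \<and> linear_quotient_gens (Suc d) gs'"
  using assms
proof (induction rule: linear_quotient_gens.induct)
  case (Nil d)
  have "syz_gens [] []"
    unfolding syz_gens_def gen_span_def syz_def strand_def lincomb_def by auto
  then show ?case using linear_quotient_gens.Nil by blast
next
  case (snoc d gs s X c)
  let ?gs = "gs @ [(s, c)]" and ?m = "length gs"
  obtain gs' where gs': "syz_gens gs gs'" "linear_quotient_gens (Suc d) gs'" using snoc.IH by blast
  \<comment> \<open>The smallest degree in which x takes effect is \<open>insert x s\<close>. There
    c is a combination of the earlier generators, which gives a linear relation with leading term x
    times the last generator.\<close>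
  have "\<exists>y. y \<in> strand gs (insert x s) \<and> c = lincomb gs y" if "x \<in> X" for x
    using snoc.hyps(4) that unfolding gen_span_def by blast
  then obtain y where y: "\<And>x. x \<in> X \<Longrightarrow> y x \<in> strand gs (insert x s)"
    "\<And>x. x \<in> X \<Longrightarrow> c = lincomb gs (y x)" by metis
  define r where "r x = (\<lambda>b. if b = ?m then 1 else - y x b)" for x
  have r: "r x \<in> syz ?gs (insert x s)" and r1: "r x ?m = 1" if "x \<in> X" for x
  proof -
    have y': "y x b = 0" if "b \<ge> ?m" for b using y(1)[OF \<open>x \<in> X\<close>] that unfolding strand_def by force
    have "(\<lambda>a. 0 + (-1) * y x a) \<in> strand gs (insert x s)"
      by (rule strand_add_scaled) (use y(1)[OF that] in \<open>auto simp: strand_def\<close>)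
    moreover have "(r x)(?m := 0) = (\<lambda>a. 0 + (-1) * y x a)" using y' by (auto simp: r_def)
    ultimately have 1: "r x \<in> strand ?gs (insert x s)" unfolding strand_snoc using y' by (auto simp: r_def)
    have "lincomb gs (r x) = lincomb gs (\<lambda>a. 0 + (-1) * y x a)"
      unfolding lincomb_def by (intro ext sum.cong) (auto simp: r_def)
    also have "\<dots> = (\<lambda>a. lincomb gs (\<lambda>_. 0) a - lincomb gs (y x) a)"
      by (subst lincomb_add_scaled) simp
    also have "\<dots> = (\<lambda>a. - c a)" using y(2)[OF that] by (simp add: lincomb_def)
    finally have "lincomb ?gs (r x) = (\<lambda>_. 0)" unfolding lincomb_snoc by (simp add: r_def)
    then show "r x \<in> syz ?gs (insert x s)" using 1 unfolding syz_def by blast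
    show "r x ?m = 1" by (simp add: r_def)
  qed
  define rel where "rel x = (insert x s, r x)" for x
  have fst_rel: "fst (rel x) = insert x s" for x by (simp add: rel_def)
  \<comment> \<open>One invariant serves two purposes. With all of X in \<open>ys\<close> it shows
    that the relations generate; for an initial part it gives the colon ideal of the next relation,
    since \<open>r x\<close> has last coefficient 1.\<close>
  have span: "gen_span (gs' @ map rel ys) t = {z \<in> syz ?gs t. z ?m \<noteq> 0 \<longrightarrow> t \<inter> set ys \<noteq> {}}"
    if "set ys \<subseteq> X" for ys t
    using that
  proof (induction ys rule: rev_induct)
    case Nil
    have "z ?m = 0" if "z \<in> syz gs t" for z using that strand_length unfolding syz_def by auto
    then show ?case using gs'(1) syz_snoc_zero[of _ gs s c t] unfolding syz_gens_def by auto
  next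
    case (snoc x ys)
    then have xX: "x \<in> X" and IH: "gen_span (gs' @ map rel ys) t = {z \<in> syz ?gs t. z ?m \<noteq> 0 \<longrightarrow> t \<inter> set ys \<noteq> {}}"
      by simp_all
    show ?case
    proof (rule subset_antisym; rule subsetI)
      fix z assume "z \<in> gen_span (gs' @ map rel (ys @ [x])) t"
      then have "z \<in> gen_span ((gs' @ map rel ys) @ [(insert x s, r x)]) t" by (simp add: rel_def)
      then consider "z \<in> gen_span (gs' @ map rel ys) t"
        | v x' where "insert x s \<subseteq> t" "x' \<in> gen_span (gs' @ map rel ys) t" "z = (\<lambda>a. x' a + v * r x a)"
        unfolding gen_span_snoc by blast
      then show "z \<in> {z \<in> syz ?gs t. z ?m \<noteq> 0 \<longrightarrow> t \<inter> set (ys @ [x]) \<noteq> {}}"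
      proof cases
        case 1 then show ?thesis using IH by auto
      next
        case 2
        have "r x \<in> syz ?gs t" using r[OF xX] syz_mono[OF 2(1)] by blast
        then show ?thesis using 2 IH syz_add_scaled[of x' ?gs t "r x" v] by auto
      qed
    next
      fix z assume z: "z \<in> {z \<in> syz ?gs t. z ?m \<noteq> 0 \<longrightarrow> t \<inter> set (ys @ [x]) \<noteq> {}}"
      have "z \<in> gen_span ((gs' @ map rel ys) @ [(insert x s, r x)]) t"
      proof (cases "z ?m \<noteq> 0 \<and> t \<inter> set ys = {}")
        case False
        then show ?thesis using z IH unfolding gen_span_snoc by auto
      next
        case True
        then have "x \<in> t" "s \<subseteq> t" using z unfolding syz_def strand_snoc by auto
        then have xt: "insert x s \<subseteq> t" by simp
        let ?z = "\<lambda>a. z a + (- z ?m) * r x a"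
        have "?z \<in> syz ?gs t" using z r[OF xX] syz_mono[OF xt] by (intro syz_add_scaled) auto
        then have "?z \<in> gen_span (gs' @ map rel ys) t" using IH r1[OF xX] by auto
        then have "\<exists>x'\<in>gen_span (gs' @ map rel ys) t. z = (\<lambda>a. x' a + z ?m * r x a)"
          by (rule bexI[rotated]) auto
        then show ?thesis using xt unfolding gen_span_snoc by metis
      qed
      then show "z \<in> gen_span (gs' @ map rel (ys @ [x])) t" by (simp add: rel_def)
    qed
  qed
  obtain xs where xs: "distinct xs" "set xs = X" using finite_distinct_list[of X] by auto
  have "linear_quotient_gens (Suc d) (gs' @ map rel ys)" if "distinct ys" "set ys \<subseteq> X" for ys
    using that
  proof (induction ys rule: rev_induct)
    case Nil
    then show ?case using gs'(2) by simp
  next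
    case (snoc x ys)
    then have xX: "x \<in> X" and ys: "set ys \<subseteq> X" "x \<notin> set ys" by auto
    have "linear_quotient_gens (Suc d) ((gs' @ map rel ys) @ [(insert x s, r x)])"
    proof (rule linear_quotient_gens.snoc)
      show "card (insert x s) = Suc d" using \<open>card s = d\<close> \<open>X \<inter> s = {}\<close> xX by (subst card_insert_disjoint) auto
      show "set ys \<inter> insert x s = {}" using ys \<open>X \<inter> s = {}\<close> by auto
      show "\<forall>t. insert x s \<subseteq> t \<longrightarrow>
          (r x \<in> gen_span (gs' @ map rel ys) t \<longleftrightarrow> t \<inter> set ys \<noteq> {})"
      proof (intro allI impI)
        fix t assume "insert x s \<subseteq> t"
        then have "r x \<in> syz ?gs t" using r[OF xX] syz_mono by blast
        then show "r x \<in> gen_span (gs' @ map rel ys) t \<longleftrightarrow> t \<inter> set ys \<noteq> {}"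
          unfolding span[OF ys(1)] using r1[OF xX] by simp
      qed
    qed (use snoc in auto)
    moreover have "(gs' @ map rel ys) @ [(insert x s, r x)] = gs' @ map rel (ys @ [x])"
      by (simp add: rel_def[of x])
    ultimately show ?case by simp
  qed
  from this[of xs] have "linear_quotient_gens (Suc d) (gs' @ map rel xs)" using xs by simp
  moreover have "syz_gens ?gs (gs' @ map rel xs)"
    unfolding syz_gens_def
  proof
    fix t
    \<comment> \<open>Solving a relation with nonzero last coefficient for c puts c into the span of
      the earlier generators, so t meets X. Hence the side condition in \<open>span\<close> holds
      for every syzygy once all of X has been added.\<close>
    have "t \<inter> X \<noteq> {}" if z: "z \<in> syz ?gs t" "z ?m \<noteq> 0" for z
    proof -
      have st: "s \<subseteq> t" and zt: "z(?m := 0) \<in> strand gs t" using z unfolding syz_def strand_snoc by auto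
      have 0: "lincomb gs z a + z ?m * c a = 0" for a
        using z(1) unfolding syz_def lincomb_snoc by (auto dest: fun_cong)
      have c: "c = (\<lambda>a. 0 + (- (1 / z ?m)) * lincomb gs (z(?m := 0)) a)"
      proof
        fix a show "c a = 0 + (- (1 / z ?m)) * lincomb gs (z(?m := 0)) a"
          using 0[of a] z(2) unfolding lincomb_upd by (simp add: field_simps eq_neg_iff_add_eq_0)
      qed
      have "lincomb gs (z(?m := 0)) \<in> gen_span gs t" using zt unfolding gen_span_def by blast
      moreover have "(\<lambda>_. 0) \<in> gen_span gs t"
        unfolding gen_span_def by (rule image_eqI[of _ _ "\<lambda>_. 0"]) (auto simp: lincomb_def strand_def)
      ultimately have "c \<in> gen_span gs t" 
        using gen_span_add_scaled[of "\<lambda>_. 0" gs t "lincomb gs (z(?m := 0))" "- (1 / z ?m)"] c by metis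
      then show ?thesis using snoc.hyps(4) st by blast
    qed
    then show "gen_span (gs' @ map rel xs) t = syz ?gs t" using span[of xs t] xs by auto
  qed
  ultimately show ?case by blast
qed

section \<open>Resolutions of squarefree monomial ideals\<close>

definition mdvd :: "('v \<Rightarrow>\<^sub>0 nat) \<Rightarrow> ('v \<Rightarrow>\<^sub>0 nat) \<Rightarrow> bool" where
  "mdvd s t \<longleftrightarrow> (\<forall>v. Poly_Mapping.lookup s v \<le> Poly_Mapping.lookup t v)"

definition expo :: "'v::finite set \<Rightarrow> ('v \<Rightarrow>\<^sub>0 nat)" where
  "expo s = Abs_poly_mapping (\<lambda>v. if v \<in> s then 1 else 0)"

lemma lookup_expo [simp]: "Poly_Mapping.lookup (expo s) v = (if v \<in> s then 1 else 0)"
  unfolding expo_def by (subst lookup_Abs_poly_mapping) auto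

lemma keys_expo [simp]: "Poly_Mapping.keys (expo s) = s"
  by (auto simp: in_keys_iff split: if_splits)

lemma expo_inject [simp]: "expo s = expo t \<longleftrightarrow> s = t"
  by (metis keys_expo)

lemma expo_empty [simp]: "expo {} = 0"
  by (rule poly_mapping_eqI) simp

lemma tdeg_expo [simp]: "tdeg (expo s) = card s"
  unfolding tdeg_def by simp

lemma mdvd_expo_left: "mdvd (expo s) t \<longleftrightarrow> s \<subseteq> Poly_Mapping.keys t"
  unfolding mdvd_def by (auto simp: in_keys_iff Suc_le_eq)

lemma mdvd_expo [simp]: "mdvd (expo s) (expo t) \<longleftrightarrow> s \<subseteq> t"
  by (simp add: mdvd_expo_left)

lemma mdvd_add_right: "mdvd t (t + u)" "mdvd t (u + t)"
  unfolding mdvd_def by (simp_all add: lookup_add)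

lemma mdvd_refl [simp]: "mdvd t t" unfolding mdvd_def by simp

lemma mdvd_trans: "mdvd s t \<Longrightarrow> mdvd t u \<Longrightarrow> mdvd s u"
  unfolding mdvd_def using le_trans by blast

lemma mdvd_antisym: "mdvd s t \<Longrightarrow> mdvd t s \<Longrightarrow> s = t"
  unfolding mdvd_def by (intro poly_mapping_eqI) (simp add: le_antisym)

lemma mdvd_minus_add: "mdvd t a \<Longrightarrow> (a - t) + t = a"
  unfolding mdvd_def by (intro poly_mapping_eqI) (simp add: lookup_add lookup_minus)

lemma tdeg_UNIV: "tdeg (t :: 'v::finite \<Rightarrow>\<^sub>0 nat) = (\<Sum>v\<in>UNIV. Poly_Mapping.lookup t v)"
  unfolding tdeg_def by (rule sum.mono_neutral_left) (auto simp: in_keys_iff)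

lemma tdeg_add: "tdeg (s + t :: 'v::finite \<Rightarrow>\<^sub>0 nat) = tdeg s + tdeg t"
  unfolding tdeg_UNIV by (simp add: lookup_add sum.distrib)

lemma tdeg_eq_0 [simp]: "tdeg (t :: 'v::finite \<Rightarrow>\<^sub>0 nat) = 0 \<longleftrightarrow> t = 0"
proof
  assume "tdeg t = 0"
  then have "Poly_Mapping.lookup t v = 0" for v unfolding tdeg_UNIV by simp
  then show "t = 0" by (intro poly_mapping_eqI) simp
qed (simp add: tdeg_UNIV)

lemma mdvd_tdeg_eq:
  assumes "mdvd s t" "tdeg s = tdeg (t :: 'v::finite \<Rightarrow>\<^sub>0 nat)" shows "s = t"
proof -
  have "tdeg (t - s) + tdeg s = tdeg t" using mdvd_minus_add[OF assms(1)] by (metis tdeg_add)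
  then have "t - s = 0" using assms(2) by simp
  then show ?thesis using mdvd_minus_add[OF assms(1)] by simp
qed

section \<open>Monomial ideals and their minimal generators\<close>

lemma lookup_single_mult:
  fixes f :: "('v \<Rightarrow>\<^sub>0 nat) \<Rightarrow>\<^sub>0 'k::field"
  shows "Poly_Mapping.lookup (Poly_Mapping.single t c * f) a =
    (if mdvd t a then c * Poly_Mapping.lookup f (a - t) else 0)"
proof -
  have eq: "(a = t + q) \<longleftrightarrow> (mdvd t a \<and> q = a - t)" for q
    using mdvd_minus_add[of t a] mdvd_add_right(1)[of t q] by (auto simp: add.commute)
  have "Poly_Mapping.lookup (Poly_Mapping.single t c * f) a =
    (\<Sum>l. (c when t = l) * (\<Sum>q. Poly_Mapping.lookup f q when a = l + q))"
    by (simp add: lookup_mult lookup_single)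
  also have "\<dots> = (\<Sum>l. c * (\<Sum>q. Poly_Mapping.lookup f q when a = l + q) when l = t)"
    by (rule Sum_any.cong) (auto simp: when_def)
  also have "\<dots> = c * (\<Sum>q. Poly_Mapping.lookup f q when a = t + q)" by simp
  also have "\<dots> = c * (\<Sum>q. (if mdvd t a then Poly_Mapping.lookup f q else 0) when q = a - t)"
    unfolding eq by (intro arg_cong[of _ _ "(*) c"] Sum_any.cong) (auto simp: when_def)
  also have "\<dots> = (if mdvd t a then c * Poly_Mapping.lookup f (a - t) else 0)" by simp
  finally show ?thesis .
qed

lemma module_mult: "Modules.module ((*) :: ('v, 'k::field) mpoly \<Rightarrow> _)"
  by unfold_locales (auto simp: algebra_simps)

interpretation poly_module: Modules.module "(*) :: ('v, 'k::field) mpoly \<Rightarrow> _"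
  by (rule module_mult)

lemma poly_mapping_sum_single:
  "(\<Sum>a\<in>Poly_Mapping.keys f. Poly_Mapping.single a (Poly_Mapping.lookup f a)) = f"
proof (rule poly_mapping_eqI)
  fix k
  have "(\<Sum>a\<in>Poly_Mapping.keys f. (Poly_Mapping.lookup f a when a = k)) = Poly_Mapping.lookup f k"
    by (simp add: when_def in_keys_iff)
  then show "Poly_Mapping.lookup (\<Sum>a\<in>Poly_Mapping.keys f. Poly_Mapping.single a (Poly_Mapping.lookup f a)) k
     = Poly_Mapping.lookup f k"
    by (simp add: lookup_sum lookup_single)
qed

lemma ideal_gen_monomials:
  "ideal_gen (monomial ` T :: ('v, 'k::field) mpoly set) =
    {f. \<forall>a\<in>Poly_Mapping.keys f. \<exists>t\<in>T. mdvd t a}" (is "_ = ?R")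
proof
  have 1: "monomial ` T \<subseteq> ?R" unfolding monomial_def by (auto intro: mdvd_refl)
  have "poly_module.subspace ?R"
  proof (rule poly_module.subspaceI)
    show "x + y \<in> ?R" if "x \<in> ?R" "y \<in> ?R" for x y
      using that keys_add[of x y] by blast
    show "c * x \<in> ?R" if x: "x \<in> ?R" for c x
    proof
      show "\<forall>a\<in>Poly_Mapping.keys (c * x). \<exists>t\<in>T. mdvd t a"
      proof
        fix a assume "a \<in> Poly_Mapping.keys (c * x)"
        then obtain b d where "a = b + d" "d \<in> Poly_Mapping.keys x" using keys_mult[of c x] by blast
        then show "\<exists>t\<in>T. mdvd t a" using x mdvd_trans mdvd_add_right(2) by blast
      qed
    qed
  qed simp
  then show "ideal_gen (monomial ` T) \<subseteq> ?R" unfolding ideal_gen_def using 1 by (rule poly_module.span_minimal[rotated])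
  show "?R \<subseteq> ideal_gen (monomial ` T)"
  proof
    fix f :: "('v, 'k) mpoly" assume f: "f \<in> ?R"
    have "Poly_Mapping.single a (Poly_Mapping.lookup f a) \<in> ideal_gen (monomial ` T)"
      if a: "a \<in> Poly_Mapping.keys f" for a
    proof -
      obtain t where t: "t \<in> T" "mdvd t a" using f a by blast
      have "Poly_Mapping.single a (Poly_Mapping.lookup f a) =
          Poly_Mapping.single (a - t) (Poly_Mapping.lookup f a) * monomial t"
        unfolding monomial_def mult_single mdvd_minus_add[OF t(2)] by simp
      moreover have "monomial t \<in> poly_module.span (monomial ` T :: ('v, 'k) mpoly set)"
        using t(1) by (intro poly_module.span_base) auto
      ultimately show ?thesis unfolding ideal_gen_def using poly_module.span_scale by metis
    qed
    then have "(\<Sum>a\<in>Poly_Mapping.keys f. Poly_Mapping.single a (Poly_Mapping.lookup f a)) \<in> ideal_gen (monomial ` T)"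
      unfolding ideal_gen_def by (rule poly_module.span_sum)
    then show "f \<in> ideal_gen (monomial ` T)" by (simp add: poly_mapping_sum_single)
  qed
qed

lemma keys_monomial [simp]: "Poly_Mapping.keys (monomial t :: ('v, 'k::field) mpoly) = {t}"
  unfolding monomial_def by simp

lemma monomial_inject [simp]: "(monomial s :: ('v, 'k::field) mpoly) = monomial t \<longleftrightarrow> s = t"
  by (metis keys_monomial singleton_inject)

lemma monomial_in_ideal_gen:
  "(monomial s :: ('v, 'k::field) mpoly) \<in> ideal_gen (monomial ` T) \<longleftrightarrow> (\<exists>t\<in>T. mdvd t s)"
  unfolding ideal_gen_monomials by simp

lemma mingens_equigenerated:
  fixes T :: "('v::finite \<Rightarrow>\<^sub>0 nat) set"
  assumes "\<And>t. t \<in> T \<Longrightarrow> tdeg t = d"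
  shows "mingens (ideal_gen (monomial ` T) :: ('v, 'k::field) mpoly set) = monomial ` T"
  unfolding mingens_def
proof (rule the_equality)
  let ?I = "ideal_gen (monomial ` T) :: ('v, 'k) mpoly set"
  have anti: "s = t" if "s \<in> T" "t \<in> T" "mdvd s t" for s t
    using mdvd_tdeg_eq that assms by metis
  have "ideal_gen C \<noteq> ?I" if C: "C \<subset> monomial ` T" for C :: "('v, 'k) mpoly set"
  proof
    assume eq: "ideal_gen C = ?I"
    obtain U where U: "C = monomial ` U" "U \<subseteq> T" using C by (metis psubset_imp_subset subset_imageE)
    then obtain t where t: "t \<in> T" "t \<notin> U" using C by blast
    then have "(monomial t :: ('v, 'k) mpoly) \<in> ideal_gen (monomial ` U)"
      using eq U monomial_in_ideal_gen[of t T] mdvd_refl by blast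
    then show False using t U anti unfolding monomial_in_ideal_gen by blast
  qed
  then show "monomial ` T \<subseteq> range monomial \<and> ideal_gen (monomial ` T) = ?I \<and>
      (\<forall>C. C \<subset> monomial ` T \<longrightarrow> ideal_gen C \<noteq> ?I)"
    by blast
  fix B :: "('v, 'k) mpoly set"
  assume B: "B \<subseteq> range monomial \<and> ideal_gen B = ?I \<and> (\<forall>C. C \<subset> B \<longrightarrow> ideal_gen C \<noteq> ?I)"
  then obtain U where U: "B = monomial ` U" by (elim conjE subset_imageE)
  have eq: "(\<exists>t\<in>T. mdvd t s) \<longleftrightarrow> (\<exists>t\<in>U. mdvd t s)" for s
    using B U monomial_in_ideal_gen[where 'k='k, of s T] monomial_in_ideal_gen[where 'k='k, of s U] by simp
  have "T \<subseteq> U"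
  proof
    fix t assume t: "t \<in> T"
    then obtain u where u: "u \<in> U" "mdvd u t" using eq[of t] mdvd_refl by blast
    then obtain t' where t': "t' \<in> T" "mdvd t' u" using eq[of u] mdvd_refl by blast
    then have "t' = t" using u t anti mdvd_trans by blast
    then show "t \<in> U" using u t' mdvd_antisym by blast
  qed
  moreover have "\<not> monomial ` T \<subset> B" using B by blast
  ultimately show "B = monomial ` T" using U by blast
qed

section \<open>Polynomial matrices and their multigraded components\<close>

definition polymat :: "('v::finite, 'k::field) gens \<Rightarrow> ('v, 'k) gens \<Rightarrow> ('v, 'k) mpoly mat" where
  "polymat gs gs' = mat (length gs) (length gs')
    (\<lambda>(a, b). Poly_Mapping.single (expo (fst (gs' ! b) - fst (gs ! a))) (snd (gs' ! b) a))"

text \<open>Where \<open>polymat gs gs'\<close> has a nonzero entry, the degree of the row generator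
  is then contained in that of the column generator, so the set difference in \<open>polymat\<close>
  is a true quotient of monomials.\<close>

definition refines :: "('v, 'k::field) gens \<Rightarrow> ('v, 'k) gens \<Rightarrow> bool" where
  "refines gs gs' \<longleftrightarrow> (\<forall>b<length gs'. snd (gs' ! b) \<in> strand gs (fst (gs' ! b)))"

text \<open>The component of multidegree \<alpha> of a polynomial vector. The exponents in \<alpha>
  may exceed 1, yet the component lives in the strand of the support of \<alpha>; this is the
  reduction of all multidegrees to squarefree ones.\<close>

definition strand_of :: "('v::finite, 'k::field) gens \<Rightarrow> ('v \<Rightarrow>\<^sub>0 nat) \<Rightarrow> ('v, 'k) mpoly vec \<Rightarrow> nat \<Rightarrow> 'k" where
  "strand_of gs \<alpha> v = (\<lambda>b. if b < length gs \<and> fst (gs ! b) \<subseteq> Poly_Mapping.keys \<alpha>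
     then Poly_Mapping.lookup (v $ b) (\<alpha> - expo (fst (gs ! b))) else 0)"

lemma strand_of_in_strand: "strand_of gs \<alpha> v \<in> strand gs (Poly_Mapping.keys \<alpha>)"
  unfolding strand_of_def strand_def by auto

lemma polymat_carrier [simp]: "polymat gs gs' \<in> carrier_mat (length gs) (length gs')"
  and dim_row_polymat [simp]: "dim_row (polymat gs gs') = length gs"
  and dim_col_polymat [simp]: "dim_col (polymat gs gs') = length gs'"
  unfolding polymat_def by auto

text \<open>The bridge from polynomials to linear algebra. Multiplying by the monomial entry (a, b)
  moves the coefficient at \<alpha> minus the degree of b to \<alpha> minus the degree of a, so in
  each multidegree the matrix acts as \<open>lincomb\<close>.\<close>

lemma strand_of_mult:
  assumes "refines gs gs'" "w \<in> carrier_vec (length gs')"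
  shows "strand_of gs \<alpha> (polymat gs gs' *\<^sub>v w) = lincomb gs' (strand_of gs' \<alpha> w)"
proof
  fix a
  have ref: "a < length gs \<and> fst (gs ! a) \<subseteq> fst (gs' ! b)" if "b < length gs'" "snd (gs' ! b) a \<noteq> 0" for b
    using assms(1) that unfolding refines_def strand_def by blast
  let ?R = "\<Sum>b<length gs'. strand_of gs' \<alpha> w b * snd (gs' ! b) a"
  show "strand_of gs \<alpha> (polymat gs gs' *\<^sub>v w) a = lincomb gs' (strand_of gs' \<alpha> w) a"
  proof (cases "a < length gs \<and> fst (gs ! a) \<subseteq> Poly_Mapping.keys \<alpha>")
    case False
    have "?R = 0"
    proof (rule sum.neutral, rule ballI)
      fix b assume "b \<in> {..<length gs'}"
      then show "strand_of gs' \<alpha> w b * snd (gs' ! b) a = 0"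
        using ref[of b] False unfolding strand_of_def by auto
    qed
    then show ?thesis using False unfolding lincomb_def strand_of_def by auto
  next
    case True
    then have a: "a < length gs" and s: "fst (gs ! a) \<subseteq> Poly_Mapping.keys \<alpha>" by auto
    let ?\<beta> = "\<alpha> - expo (fst (gs ! a))"
    have "(polymat gs gs' *\<^sub>v w) $ a = (\<Sum>b<length gs'. polymat gs gs' $$ (a, b) * w $ b)"
      using a assms(2) by (simp add: scalar_prod_def atLeast0LessThan)
    also have "Poly_Mapping.lookup \<dots> ?\<beta> = (\<Sum>b<length gs'. Poly_Mapping.lookup (polymat gs gs' $$ (a, b) * w $ b) ?\<beta>)"
      by (simp add: lookup_sum)
    also have "\<dots> = ?R"
    proof (rule sum.cong[OF refl])
      fix b assume "b \<in> {..<length gs'}"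
      then have b: "b < length gs'" by simp
      have pm: "polymat gs gs' $$ (a, b) = Poly_Mapping.single (expo (fst (gs' ! b) - fst (gs ! a))) (snd (gs' ! b) a)"
        using a b unfolding polymat_def by simp
      show "Poly_Mapping.lookup (polymat gs gs' $$ (a, b) * w $ b) ?\<beta> = strand_of gs' \<alpha> w b * snd (gs' ! b) a"
      proof (cases "snd (gs' ! b) a = 0")
        case True
        then show ?thesis unfolding pm by simp
      next
        case False
        then have sub: "fst (gs ! a) \<subseteq> fst (gs' ! b)" using ref b by blast
        have "mdvd (expo (fst (gs' ! b) - fst (gs ! a))) ?\<beta> \<longleftrightarrow> fst (gs' ! b) \<subseteq> Poly_Mapping.keys \<alpha>"
          unfolding mdvd_expo_left using s by (auto simp: in_keys_iff lookup_minus)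
        moreover have "?\<beta> - expo (fst (gs' ! b) - fst (gs ! a)) = \<alpha> - expo (fst (gs' ! b))"
          using sub by (intro poly_mapping_eqI) (auto simp: lookup_minus)
        ultimately show ?thesis unfolding pm lookup_single_mult strand_of_def using b by simp
      qed
    qed
    finally show ?thesis using True unfolding strand_of_def[of gs] lincomb_def by simp
  qed
qed

lemma strand_of_eqI:
  assumes "v \<in> carrier_vec (length gs)" "w \<in> carrier_vec (length gs)"
    and "\<And>\<alpha>. strand_of gs \<alpha> v = strand_of gs \<alpha> w"
  shows "v = w"
proof (rule eq_vecI)
  fix b assume "b < dim_vec w"
  then have b: "b < length gs" using assms(2) by auto
  show "v $ b = w $ b"
  proof (rule poly_mapping_eqI)
    fix \<beta>
    have "fst (gs ! b) \<subseteq> Poly_Mapping.keys (\<beta> + expo (fst (gs ! b)))" by (auto simp: in_keys_iff lookup_add)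
    then show "Poly_Mapping.lookup (v $ b) \<beta> = Poly_Mapping.lookup (w $ b) \<beta>"
      using fun_cong[OF assms(3)[of "\<beta> + expo (fst (gs ! b))"], of b] b unfolding strand_of_def by simp
  qed
qed (use assms in auto)

lemma finite_strand_of:
  assumes "v \<in> carrier_vec (length gs)"
  shows "finite {\<alpha>. strand_of gs \<alpha> v \<noteq> (\<lambda>_. 0)}"
proof (rule finite_subset)
  let ?A = "\<Union>b\<in>{..<length gs}. (\<lambda>\<beta>. \<beta> + expo (fst (gs ! b))) ` Poly_Mapping.keys (v $ b)"
  show "finite ?A" by auto
  show "{\<alpha>. strand_of gs \<alpha> v \<noteq> (\<lambda>_. 0)} \<subseteq> ?A"
  proof
    fix \<alpha> assume "\<alpha> \<in> {\<alpha>. strand_of gs \<alpha> v \<noteq> (\<lambda>_. 0)}"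
    then obtain b where "strand_of gs \<alpha> v b \<noteq> 0" by auto
    then have b: "b < length gs" "fst (gs ! b) \<subseteq> Poly_Mapping.keys \<alpha>"
      "\<alpha> - expo (fst (gs ! b)) \<in> Poly_Mapping.keys (v $ b)"
      unfolding strand_of_def by (auto simp: in_keys_iff split: if_splits)
    then have "\<alpha> = (\<alpha> - expo (fst (gs ! b))) + expo (fst (gs ! b))"
      using mdvd_minus_add[of "expo (fst (gs ! b))" \<alpha>] mdvd_expo_left by metis
    then show "\<alpha> \<in> ?A" using b by blast
  qed
qed

text \<open>Components prescribed in each multidegree glue to a polynomial vector: the coefficient
  of entry b at \<beta> is read off in multidegree \<beta> plus the degree of b, and finiteness of
  the support makes the entries polynomials.\<close>

lemma ex_strand_of:
  fixes gs :: "('v::finite, 'k::field) gens"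
  assumes "\<And>\<alpha>. y \<alpha> \<in> strand gs (Poly_Mapping.keys \<alpha>)" "finite {\<alpha>. y \<alpha> \<noteq> (\<lambda>_. 0)}"
  shows "\<exists>w\<in>carrier_vec (length gs). \<forall>\<alpha>. strand_of gs \<alpha> w = y \<alpha>"
proof -
  define w where "w = vec (length gs) (\<lambda>b. Abs_poly_mapping (\<lambda>\<beta>. y (\<beta> + expo (fst (gs ! b))) b))"
  have fin: "finite {\<beta>. y (\<beta> + expo (fst (gs ! b))) b \<noteq> 0}" for b
  proof (rule finite_imageD)
    show "finite ((\<lambda>\<beta>. \<beta> + expo (fst (gs ! b))) ` {\<beta>. y (\<beta> + expo (fst (gs ! b))) b \<noteq> 0})"
      by (rule finite_subset[OF _ assms(2)]) force
  qed (auto intro!: inj_onI)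
  have "strand_of gs \<alpha> w b = y \<alpha> b" for \<alpha> b
  proof (cases "b < length gs \<and> fst (gs ! b) \<subseteq> Poly_Mapping.keys \<alpha>")
    case True
    then have "(\<alpha> - expo (fst (gs ! b))) + expo (fst (gs ! b)) = \<alpha>"
      using mdvd_minus_add mdvd_expo_left by metis
    then show ?thesis using True fin unfolding strand_of_def w_def by (simp add: lookup_Abs_poly_mapping)
  next
    case False
    then have "y \<alpha> b = 0" using assms(1)[of \<alpha>] unfolding strand_def by blast
    then show ?thesis using False unfolding strand_of_def by auto
  qed
  then have "\<forall>\<alpha>. strand_of gs \<alpha> w = y \<alpha>" by blast
  moreover have "w \<in> carrier_vec (length gs)" unfolding w_def by simp
  ultimately show ?thesis by blast
qed

lemma mat_ker_polymat:
  assumes "refines gs gs'"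
  shows "mat_ker (polymat gs gs') =
    {v \<in> carrier_vec (length gs'). \<forall>\<alpha>. strand_of gs' \<alpha> v \<in> syz gs' (Poly_Mapping.keys \<alpha>)}"
proof -
  have "polymat gs gs' *\<^sub>v v = 0\<^sub>v (length gs) \<longleftrightarrow> (\<forall>\<alpha>. lincomb gs' (strand_of gs' \<alpha> v) = (\<lambda>_. 0))"
    if v: "v \<in> carrier_vec (length gs')" for v
  proof
    assume "polymat gs gs' *\<^sub>v v = 0\<^sub>v (length gs)"
    then show "\<forall>\<alpha>. lincomb gs' (strand_of gs' \<alpha> v) = (\<lambda>_. 0)"
      unfolding strand_of_mult[OF assms v, symmetric] by (auto simp: strand_of_def)
  next
    assume "\<forall>\<alpha>. lincomb gs' (strand_of gs' \<alpha> v) = (\<lambda>_. 0)"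
    then have "strand_of gs \<alpha> (polymat gs gs' *\<^sub>v v) = strand_of gs \<alpha> (0\<^sub>v (length gs))" for \<alpha>
      unfolding strand_of_mult[OF assms v] by (auto simp: strand_of_def)
    then show "polymat gs gs' *\<^sub>v v = 0\<^sub>v (length gs)"
      by (rule strand_of_eqI[rotated 2]) (auto intro!: mult_mat_vec_carrier v)
  qed
  then show ?thesis unfolding mat_ker_def syz_def using strand_of_in_strand by auto
qed

lemma mat_im_polymat:
  fixes gs :: "('v::finite, 'k::field) gens"
  assumes "refines gs gs'"
  shows "mat_im (polymat gs gs') =
    {v \<in> carrier_vec (length gs). \<forall>\<alpha>. strand_of gs \<alpha> v \<in> gen_span gs' (Poly_Mapping.keys \<alpha>)}"
    (is "_ = ?R")
proof
  show "mat_im (polymat gs gs') \<subseteq> ?R"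
  proof
    fix v assume "v \<in> mat_im (polymat gs gs')"
    then obtain w where w: "w \<in> carrier_vec (length gs')" "v = polymat gs gs' *\<^sub>v w"
      unfolding mat_im_def by auto
    have "strand_of gs \<alpha> v \<in> gen_span gs' (Poly_Mapping.keys \<alpha>)" for \<alpha>
      unfolding w(2) strand_of_mult[OF assms w(1)] gen_span_def using strand_of_in_strand by blast
    then show "v \<in> ?R" using w mult_mat_vec_carrier[OF polymat_carrier w(1), of gs] by simp
  qed
  show "?R \<subseteq> mat_im (polymat gs gs')"
  proof
    fix v assume v: "v \<in> ?R"
    \<comment> \<open>Preimages are chosen independently in each multidegree. Choosing zero wherever
      v vanishes leaves finitely many nonzero components, as gluing requires.\<close>
    have "\<exists>y. y \<in> strand gs' (Poly_Mapping.keys \<alpha>) \<and> strand_of gs \<alpha> v = lincomb gs' y \<and>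
        (strand_of gs \<alpha> v = (\<lambda>_. 0) \<longrightarrow> y = (\<lambda>_. 0))" for \<alpha>
    proof (cases "strand_of gs \<alpha> v = (\<lambda>_. 0)")
      case True
      then show ?thesis by (intro exI[of _ "\<lambda>_. 0"]) (auto simp: strand_def lincomb_def)
    next
      case False
      then show ?thesis using v unfolding gen_span_def by blast
    qed
    then obtain y where y: "\<And>\<alpha>. y \<alpha> \<in> strand gs' (Poly_Mapping.keys \<alpha>)"
      "\<And>\<alpha>. strand_of gs \<alpha> v = lincomb gs' (y \<alpha>)"
      "\<And>\<alpha>. strand_of gs \<alpha> v = (\<lambda>_. 0) \<Longrightarrow> y \<alpha> = (\<lambda>_. 0)" by metis
    have "{\<alpha>. y \<alpha> \<noteq> (\<lambda>_. 0)} \<subseteq> {\<alpha>. strand_of gs \<alpha> v \<noteq> (\<lambda>_. 0)}" using y(3) by auto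
    then have "finite {\<alpha>. y \<alpha> \<noteq> (\<lambda>_. 0)}"
      using finite_strand_of[of v gs] v finite_subset by blast
    then obtain w where w: "w \<in> carrier_vec (length gs')" "\<And>\<alpha>. strand_of gs' \<alpha> w = y \<alpha>"
      using ex_strand_of[of y gs'] y(1) by blast
    have "v = polymat gs gs' *\<^sub>v w"
    proof (rule strand_of_eqI)
      show "strand_of gs \<alpha> v = strand_of gs \<alpha> (polymat gs gs' *\<^sub>v w)" for \<alpha>
        unfolding strand_of_mult[OF assms w(1)] w(2) using y(2) by simp
    qed (use v in \<open>auto intro!: mult_mat_vec_carrier w\<close>)
    then show "v \<in> mat_im (polymat gs gs')" unfolding mat_im_def using w(1) by auto
  qed
qed

section \<open>The complex assembled from the stages\<close>

lemma syz_gens_refines: "syz_gens gs gs' \<Longrightarrow> refines gs gs'"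
  using syz_gens_nth unfolding refines_def syz_def by blast

text \<open>The polynomial ring as a stage with the single generator 1 of multidegree
  \<open>{}\<close>, so that the augmentation is one more \<open>polymat\<close>; coordinate 0 in
  \<open>monomial_gens\<close> refers to this generator.\<close>

definition root_gens :: "('v, 'k::field) gens" where
  "root_gens = [({}, \<lambda>_. 0)]"

definition monomial_gens :: "'v set list \<Rightarrow> ('v, 'k::field) gens" where
  "monomial_gens us = map (\<lambda>u. (u, \<lambda>a. if a = 0 then 1 else 0)) us"

lemma length_monomial_gens [simp]: "length (monomial_gens us) = length us"
  and nth_monomial_gens [simp]: "b < length us \<Longrightarrow> monomial_gens us ! b = (us ! b, \<lambda>a. if a = 0 then 1 else 0)"
  unfolding monomial_gens_def by auto

lemma lincomb_monomial_gens:
  "lincomb (monomial_gens us) y = (\<lambda>a. if a = 0 then \<Sum>b<length us. y b else 0)"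
  unfolding lincomb_def by (auto intro!: sum.cong)

lemma gen_span_monomial_gens:
  fixes x :: "nat \<Rightarrow> 'k::field" and us :: "'v set list"
  shows "x \<in> gen_span (monomial_gens us) s \<longleftrightarrow> (\<forall>a>0. x a = 0) \<and> (x 0 \<noteq> 0 \<longrightarrow> (\<exists>u\<in>set us. u \<subseteq> s))"
proof
  assume "x \<in> gen_span (monomial_gens us) s"
  then obtain y where y: "y \<in> strand (monomial_gens us) s" "x = lincomb (monomial_gens us) y"
    unfolding gen_span_def by blast
  have "\<exists>u\<in>set us. u \<subseteq> s" if "x 0 \<noteq> 0"
  proof -
    have "(\<Sum>b<length us. y b) \<noteq> 0" using that unfolding y(2) lincomb_monomial_gens by simp
    then obtain b where b: "b < length us" "y b \<noteq> 0"
      by (rule sum.not_neutral_contains_not_neutral) simp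
    have "fst (monomial_gens us ! b :: 'v set \<times> (nat \<Rightarrow> 'k)) \<subseteq> s"
      using y(1) b(2) unfolding strand_def by blast
    then show ?thesis using b(1) nth_mem[OF b(1)] by auto
  qed
  then show "(\<forall>a>0. x a = 0) \<and> (x 0 \<noteq> 0 \<longrightarrow> (\<exists>u\<in>set us. u \<subseteq> s))"
    using y(2) unfolding lincomb_monomial_gens by auto
next
  assume x: "(\<forall>a>0. x a = 0) \<and> (x 0 \<noteq> 0 \<longrightarrow> (\<exists>u\<in>set us. u \<subseteq> s))"
  show "x \<in> gen_span (monomial_gens us) s"
  proof (cases "x 0 = 0")
    case True
    then have "x = lincomb (monomial_gens us) (\<lambda>_. 0)" using x unfolding lincomb_monomial_gens
      by (intro ext) (metis gr0I sum.neutral_const)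
    then show ?thesis unfolding gen_span_def strand_def by auto
  next
    case False
    then obtain b where b: "b < length us" "us ! b \<subseteq> s" using x by (metis in_set_conv_nth)
    let ?y = "\<lambda>c. if c = b then x 0 else 0"
    have "x = lincomb (monomial_gens us) ?y" using x b unfolding lincomb_monomial_gens by auto
    moreover have "?y \<in> strand (monomial_gens us) s" using b unfolding strand_def by auto
    ultimately show ?thesis unfolding gen_span_def by blast
  qed
qed

lemma refines_root: "refines root_gens (monomial_gens us)"
  unfolding refines_def strand_def root_gens_def by auto

lemma augmentation_image:
  "(\<lambda>v. v $ 0) ` mat_im (polymat root_gens (monomial_gens us)) =
    (ideal_gen (monomial ` expo ` set us) :: ('v::finite, 'k::field) mpoly set)"
proof -
  let ?gs = "monomial_gens us :: ('v, 'k) gens" and ?I = "ideal_gen (monomial ` expo ` set us) :: ('v, 'k) mpoly set"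
  have st: "strand_of root_gens \<alpha> v = (\<lambda>b. if b = 0 then Poly_Mapping.lookup (v $ 0) \<alpha> else 0)"
    for \<alpha> and v :: "('v, 'k) mpoly vec"
    unfolding strand_of_def root_gens_def by auto
  have im: "mat_im (polymat root_gens ?gs) =
    {v \<in> carrier_vec 1. \<forall>\<alpha>. Poly_Mapping.lookup (v $ 0) \<alpha> \<noteq> 0 \<longrightarrow> (\<exists>u\<in>set us. u \<subseteq> Poly_Mapping.keys \<alpha>)}"
    unfolding mat_im_polymat[OF refines_root] gen_span_monomial_gens st
    by (rule Collect_cong) (simp add: root_gens_def)
  have id: "?I =
    {f. \<forall>\<alpha>. Poly_Mapping.lookup f \<alpha> \<noteq> 0 \<longrightarrow> (\<exists>u\<in>set us. u \<subseteq> Poly_Mapping.keys \<alpha>)}"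
    unfolding ideal_gen_monomials by (rule Collect_cong) (simp add: mdvd_expo_left in_keys_iff Ball_def)
  have "f \<in> (\<lambda>v. v $ 0) ` mat_im (polymat root_gens ?gs)" if "f \<in> ?I" for f
  proof (rule image_eqI)
    show "vec 1 (\<lambda>_. f) \<in> mat_im (polymat root_gens ?gs)" using that unfolding im id by simp
  qed simp
  moreover have "(\<lambda>v. v $ 0) ` mat_im (polymat root_gens ?gs) \<subseteq> ?I"
    unfolding im id by (rule image_subsetI) simp
  ultimately show ?thesis by blast
qed

definition strand_complex :: "(nat \<Rightarrow> ('v::finite, 'k::field) gens) \<Rightarrow> ('v, 'k) mpoly graded_complex" where
  "strand_complex gs = \<lparr>shifts = (\<lambda>i. map (card \<circ> fst) (gs i)),
     augmentation = polymat root_gens (gs 0), differential = (\<lambda>i. polymat (gs i) (gs (Suc i)))\<rparr>"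

lemma homogeneous_polymat:
  assumes "refines gs gs'"
  shows "homogeneous_mat (map (card \<circ> fst) gs) (map (card \<circ> fst) gs') (polymat gs gs')"
  unfolding homogeneous_mat_def
proof (intro conjI allI impI ballI)
  fix a b t
  assume "a < length (map (card \<circ> fst) gs)" "b < length (map (card \<circ> fst) gs')"
    and t: "t \<in> Poly_Mapping.keys (polymat gs gs' $$ (a, b))"
  then have a: "a < length gs" and b: "b < length gs'" by auto
  then have t': "t = expo (fst (gs' ! b) - fst (gs ! a))" "snd (gs' ! b) a \<noteq> 0"
    using t unfolding polymat_def by (auto split: if_splits)
  then have "fst (gs ! a) \<subseteq> fst (gs' ! b)" using assms b unfolding refines_def strand_def by blast
  then show "tdeg t + map (card \<circ> fst) gs ! a = map (card \<circ> fst) gs' ! b"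
    using a b t' by (simp add: card_Diff_subset card_mono)
qed auto

text \<open>Exactness in all squarefree degrees is exactness of the matrices, by the descriptions of
  kernel and image. An entry with a constant term would join generators of equal degree; its column
  is a syzygy in that very degree with nonzero coefficient there, contrary to
  \<open>irredundant\<close>.\<close>

lemma strand_complex_minimal_resolution:
  fixes gs :: "nat \<Rightarrow> ('v::finite, 'k::field) gens"
  assumes "gs 0 = monomial_gens us" "\<And>i. syz_gens (gs i) (gs (Suc i))" "\<And>i. irredundant (gs i)"
  shows "is_minimal_resolution (ideal_gen (monomial ` expo ` set us)) (strand_complex gs)"
proof -
  have ref: "refines (gs i) (gs (Suc i))" for i using assms(2) syz_gens_refines by blast
  have ref0: "refines root_gens (gs 0)" using assms(1) refines_root by metis
  have ex: "mat_ker (polymat hs (gs i)) = mat_im (polymat (gs i) (gs (Suc i)))" if "refines hs (gs i)" for hs i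
    unfolding mat_ker_polymat[OF that] mat_im_polymat[OF ref] using assms(2) unfolding syz_gens_def by simp
  have "is_graded_resolution (ideal_gen (monomial ` expo ` set us)) (strand_complex gs)"
    unfolding is_graded_resolution_def strand_complex_def
    using homogeneous_polymat[OF ref0] homogeneous_polymat[OF ref] ex[OF ref0] ex[OF ref]
      augmentation_image[of us] assms(1)
    by (simp add: root_gens_def)
  moreover have "Poly_Mapping.lookup p 0 = 0" if "p \<in> elements_mat (polymat (gs i) (gs (Suc i)))" for i p
  proof (rule ccontr)
    assume p0: "Poly_Mapping.lookup p 0 \<noteq> 0"
    obtain a b where ab: "a < length (gs i)" "b < length (gs (Suc i))" "p = polymat (gs i) (gs (Suc i)) $$ (a, b)"
      using elements_matD[OF \<open>p \<in> _\<close>] by auto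
    let ?z = "snd (gs (Suc i) ! b)" and ?s = "fst (gs (Suc i) ! b)"
    have p: "p = Poly_Mapping.single (expo (?s - fst (gs i ! a))) (?z a)"
      using ab unfolding polymat_def by simp
    have e: "expo (?s - fst (gs i ! a)) = 0" and z: "?z a \<noteq> 0"
      using p0 unfolding p lookup_single by (auto simp: when_def split: if_splits)
    have "?s - fst (gs i ! a) = {}" using arg_cong[OF e, of Poly_Mapping.keys] by simp
    moreover have "fst (gs i ! a) \<subseteq> ?s" using ref[of i] ab(2) z unfolding refines_def strand_def by blast
    ultimately have eq: "fst (gs i ! a) = ?s" by blast
    have "?z \<in> syz (gs i) ?s" by (rule syz_gens_nth[OF assms(2) ab(2)])
    then show False using assms(3)[of i] z eq unfolding irredundant_def by blast
  qed
  ultimately show ?thesis unfolding is_minimal_resolution_def strand_complex_def by auto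
qed

section \<open>Comparison of graded resolutions\<close>

lemma lookup_mult_keys:
  fixes f g :: "('v, 'k::field) mpoly"
  shows "Poly_Mapping.lookup (g * f) a =
    (\<Sum>t\<in>Poly_Mapping.keys g. if mdvd t a then Poly_Mapping.lookup g t * Poly_Mapping.lookup f (a - t) else 0)"
proof -
  have "g * f = (\<Sum>t\<in>Poly_Mapping.keys g. Poly_Mapping.single t (Poly_Mapping.lookup g t)) * f"
    by (simp only: poly_mapping_sum_single)
  also have "\<dots> = (\<Sum>t\<in>Poly_Mapping.keys g. Poly_Mapping.single t (Poly_Mapping.lookup g t) * f)"
    by (rule sum_distrib_right)
  finally show ?thesis by (simp add: lookup_sum lookup_single_mult)
qed

lemma lookup_mult_0:
  fixes f g :: "('v::finite, 'k::field) mpoly"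
  shows "Poly_Mapping.lookup (g * f) 0 = Poly_Mapping.lookup g 0 * Poly_Mapping.lookup f 0"
proof -
  have "mdvd t 0 \<longleftrightarrow> t = 0" for t :: "'v \<Rightarrow>\<^sub>0 nat"
    unfolding mdvd_def by (auto intro: poly_mapping_eqI)
  then have "Poly_Mapping.lookup (g * f) 0 =
    (\<Sum>t\<in>Poly_Mapping.keys g. if t = 0 then Poly_Mapping.lookup g 0 * Poly_Mapping.lookup f 0 else 0)"
    unfolding lookup_mult_keys by (intro sum.cong) auto
  also have "\<dots> = Poly_Mapping.lookup g 0 * Poly_Mapping.lookup f 0"
    by (simp add: in_keys_iff)
  finally show ?thesis .
qed

definition restrict_poly :: "(('v \<Rightarrow>\<^sub>0 nat) \<Rightarrow> bool) \<Rightarrow> ('v, 'k::field) mpoly \<Rightarrow> ('v, 'k) mpoly" where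
  "restrict_poly P f = Abs_poly_mapping (\<lambda>t. if P t then Poly_Mapping.lookup f t else 0)"

lemma lookup_restrict_poly [simp]:
  "Poly_Mapping.lookup (restrict_poly P f) t = (if P t then Poly_Mapping.lookup f t else 0)"
proof -
  have "finite {t. (if P t then Poly_Mapping.lookup f t else 0) \<noteq> 0}"
    by (rule finite_subset[of _ "Poly_Mapping.keys f"]) (auto simp: in_keys_iff)
  then show ?thesis unfolding restrict_poly_def by (simp add: lookup_Abs_poly_mapping)
qed

lemma homogeneous_matD:
  "homogeneous_mat d e A \<Longrightarrow> A \<in> carrier_mat (length d) (length e)"
  unfolding homogeneous_mat_def by blast

text \<open>A homogeneous column in the image of a homogeneous matrix has a homogeneous preimage: discard
  the components of the wrong degrees.\<close>

lemma homogeneous_preimage: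
  fixes A M :: "('v::finite, 'k::field) mpoly mat"
  assumes A: "homogeneous_mat d d' A" and M: "homogeneous_mat d e M"
    and im: "\<And>b. b < length e \<Longrightarrow> col M b \<in> mat_im A"
  shows "\<exists>X. homogeneous_mat d' e X \<and> A * X = M"
proof -
  have cA: "A \<in> carrier_mat (length d) (length d')" and cM: "M \<in> carrier_mat (length d) (length e)"
    using A M homogeneous_matD by auto
  have "\<forall>b. \<exists>v. b < length e \<longrightarrow> v \<in> carrier_vec (length d') \<and> col M b = A *\<^sub>v v"
    using im cA unfolding mat_im_def by auto
  then obtain v where v: "\<And>b. b < length e \<Longrightarrow> v b \<in> carrier_vec (length d')"
    "\<And>b. b < length e \<Longrightarrow> col M b = A *\<^sub>v v b" by metis
  define X where "X = mat (length d') (length e) (\<lambda>(j, b). restrict_poly (\<lambda>t. tdeg t + d' ! j = e ! b) (v b $ j))"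
  have cX: "X \<in> carrier_mat (length d') (length e)" unfolding X_def by simp
  have "homogeneous_mat d' e X"
    unfolding homogeneous_mat_def using cX by (auto simp: X_def in_keys_iff split: if_splits)
  moreover have "A * X = M"
  proof (rule eq_matI)
    fix a b assume "a < dim_row M" "b < dim_col M"
    then have a: "a < length d" and b: "b < length e" using cM by auto
    have AX: "(A * X) $$ (a, b) = (\<Sum>j<length d'. A $$ (a, j) * X $$ (j, b))"
      using a b cA cX by (simp add: scalar_prod_def atLeast0LessThan)
    have "M $$ (a, b) = (A *\<^sub>v v b) $ a"
      using v(2)[OF b, symmetric] a b cM by simp
    then have Mab: "M $$ (a, b) = (\<Sum>j<length d'. A $$ (a, j) * v b $ j)"
      using a v(1)[OF b] cA by (simp add: scalar_prod_def atLeast0LessThan)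
    show "(A * X) $$ (a, b) = M $$ (a, b)"
    proof (rule poly_mapping_eqI)
      fix \<alpha>
      have tm: "Poly_Mapping.lookup (A $$ (a, j) * X $$ (j, b)) \<alpha> =
          (if tdeg \<alpha> + d ! a = e ! b then Poly_Mapping.lookup (A $$ (a, j) * v b $ j) \<alpha> else 0)"
        if j: "j < length d'" for j
      proof -
        have deg: "tdeg (\<alpha> - t) + d' ! j = e ! b \<longleftrightarrow> tdeg \<alpha> + d ! a = e ! b"
          if "t \<in> Poly_Mapping.keys (A $$ (a, j))" "mdvd t \<alpha>" for t
        proof -
          have "tdeg t + d ! a = d' ! j" using A a j that(1) unfolding homogeneous_mat_def by blast
          moreover have "tdeg (\<alpha> - t) + tdeg t = tdeg \<alpha>"
            using mdvd_minus_add[OF that(2)] by (metis tdeg_add)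
          ultimately show ?thesis by linarith
        qed
        have Xjb: "X $$ (j, b) = restrict_poly (\<lambda>t. tdeg t + d' ! j = e ! b) (v b $ j)"
          using j b by (simp add: X_def)
        show ?thesis
        proof (cases "tdeg \<alpha> + d ! a = e ! b")
          case True
          then show ?thesis unfolding lookup_mult_keys Xjb using deg by (auto intro!: sum.cong)
        next
          case False
          then show ?thesis unfolding lookup_mult_keys Xjb using deg by (auto intro!: sum.neutral)
        qed
      qed
      have "Poly_Mapping.lookup ((A * X) $$ (a, b)) \<alpha> =
          (if tdeg \<alpha> + d ! a = e ! b then Poly_Mapping.lookup (M $$ (a, b)) \<alpha> else 0)"
        unfolding AX Mab by (simp add: lookup_sum tm)
      moreover have "Poly_Mapping.lookup (M $$ (a, b)) \<alpha> = 0" if "tdeg \<alpha> + d ! a \<noteq> e ! b"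
        using M a b that unfolding homogeneous_mat_def by (metis in_keys_iff)
      ultimately show "Poly_Mapping.lookup ((A * X) $$ (a, b)) \<alpha> = Poly_Mapping.lookup (M $$ (a, b)) \<alpha>"
        by auto
    qed
  qed (use cA cX cM in auto)
  ultimately show ?thesis by blast
qed

text \<open>The ungraded counterpart of \<open>homogeneous_preimage\<close>. It supplies the
  homotopy, whose degrees do not enter the comparison of shifts.\<close>

lemma mat_preimage:
  fixes A :: "'p::semiring_0 mat"
  assumes "A \<in> carrier_mat n n'" "M \<in> carrier_mat n m" "\<And>b. b < m \<Longrightarrow> col M b \<in> mat_im A"
  shows "\<exists>X\<in>carrier_mat n' m. A * X = M"
proof -
  have "\<forall>b. \<exists>v. b < m \<longrightarrow> v \<in> carrier_vec n' \<and> col M b = A *\<^sub>v v"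
    using assms unfolding mat_im_def by auto
  then obtain v where v: "\<And>b. b < m \<Longrightarrow> v b \<in> carrier_vec n'"
    "\<And>b. b < m \<Longrightarrow> col M b = A *\<^sub>v v b" by metis
  define X where "X = mat n' m (\<lambda>(j, b). v b $ j)"
  have cX: "X \<in> carrier_mat n' m" unfolding X_def by simp
  have colX: "col X b = v b" if "b < m" for b
    using v(1)[OF that] that unfolding X_def by (intro eq_vecI) auto
  have "A * X = M"
  proof (rule mat_col_eqI)
    fix b assume "b < dim_col M"
    then have b: "b < m" using assms(2) by simp
    show "col (A * X) b = col M b" using col_mult2[OF assms(1) cX b] colX[OF b] v(2)[OF b] by simp
  qed (use assms cX in auto)
  then show ?thesis using cX by blast
qed

lemma col_in_mat_im:
  fixes A :: "'p::comm_semiring_1 mat"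
  assumes "A \<in> carrier_mat n m" "b < m"
  shows "col A b \<in> mat_im A"
proof -
  have "col A b = A *\<^sub>v unit_vec m b"
    using assms by (intro eq_vecI) (auto simp: scalar_prod_right_unit)
  then show ?thesis unfolding mat_im_def using assms by auto
qed

lemma col_in_mat_ker:
  fixes A :: "'p::comm_semiring_1 mat"
  assumes "A \<in> carrier_mat n m" "B \<in> carrier_mat m k" "A * B = 0\<^sub>m n k" "b < k"
  shows "col B b \<in> mat_ker A"
proof -
  have "A *\<^sub>v col B b = 0\<^sub>v n" using col_mult2[OF assms(1,2,4)] assms(3,4) by simp
  then show ?thesis unfolding mat_ker_def using assms by auto
qed

text \<open>Indices move up by one: the ring itself takes position 0 and the augmentation becomes an
  ordinary differential. The inductions for chain maps and homotopies can then start at the identity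
  of the ring.\<close>

definition aug_shifts :: "('v, 'k::field) mpoly graded_complex \<Rightarrow> nat \<Rightarrow> nat list" where
  "aug_shifts F i = (case i of 0 \<Rightarrow> [0] | Suc j \<Rightarrow> shifts F j)"

definition aug_diff :: "('v, 'k::field) mpoly graded_complex \<Rightarrow> nat \<Rightarrow> ('v, 'k) mpoly mat" where
  "aug_diff F i = (case i of 0 \<Rightarrow> augmentation F | Suc j \<Rightarrow> differential F j)"

lemma resolution_homogeneous:
  "is_graded_resolution I F \<Longrightarrow> homogeneous_mat (aug_shifts F i) (aug_shifts F (Suc i)) (aug_diff F i)"
  unfolding is_graded_resolution_def aug_shifts_def aug_diff_def by (cases i) auto

lemma resolution_exact:
  "is_graded_resolution I F \<Longrightarrow> mat_ker (aug_diff F i) = mat_im (aug_diff F (Suc i))"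
  unfolding is_graded_resolution_def aug_diff_def by (cases i) auto

lemma resolution_carrier:
  "is_graded_resolution I F \<Longrightarrow>
    aug_diff F i \<in> carrier_mat (length (aug_shifts F i)) (length (aug_shifts F (Suc i)))"
  using resolution_homogeneous homogeneous_matD by blast

lemma resolution_im_0:
  assumes "is_graded_resolution I F" "is_graded_resolution I F'"
  shows "mat_im (aug_diff F 0) \<subseteq> mat_im (aug_diff F' 0)"
proof
  fix v assume v: "v \<in> mat_im (aug_diff F 0)"
  have dim: "u \<in> carrier_vec 1" if "is_graded_resolution I H" "u \<in> mat_im (aug_diff H 0)" for H :: "('a, 'b) mpoly graded_complex" and u
    using that resolution_carrier[OF that(1), of 0] mult_mat_vec_carrier
    unfolding mat_im_def by (auto simp: aug_shifts_def)
  have "v $ 0 \<in> I" using assms(1) v unfolding is_graded_resolution_def aug_diff_def by auto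
  then obtain w where w: "w \<in> mat_im (aug_diff F' 0)" "v $ 0 = w $ 0"
    using assms(2) unfolding is_graded_resolution_def aug_diff_def by auto
  have "v = w" using dim[OF assms(1) v] dim[OF assms(2) w(1)] w(2) by (intro eq_vecI) auto
  then show "v \<in> mat_im (aug_diff F' 0)" using w by simp
qed

lemma resolution_comp_zero:
  fixes F :: "('v, 'k::field) mpoly graded_complex"
  assumes "is_graded_resolution I F"
  shows "aug_diff F i * aug_diff F (Suc i) = 0\<^sub>m (length (aug_shifts F i)) (length (aug_shifts F (Suc (Suc i))))"
proof (rule mat_col_eqI)
  note c = resolution_carrier[OF assms]
  fix b assume "b < dim_col (0\<^sub>m (length (aug_shifts F i)) (length (aug_shifts F (Suc (Suc i)))) :: ('v, 'k) mpoly mat)"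
  then have b: "b < length (aug_shifts F (Suc (Suc i)))" by simp
  have "col (aug_diff F (Suc i)) b \<in> mat_ker (aug_diff F i)"
    unfolding resolution_exact[OF assms] using col_in_mat_im[OF c b] .
  then have "aug_diff F i *\<^sub>v col (aug_diff F (Suc i)) b = 0\<^sub>v (length (aug_shifts F i))"
    unfolding mat_ker_def using c[of i] by auto
  then show "col (aug_diff F i * aug_diff F (Suc i)) b =
      col (0\<^sub>m (length (aug_shifts F i)) (length (aug_shifts F (Suc (Suc i))))) b"
    using col_mult2[OF c c b] b by simp
qed (use resolution_carrier[OF assms] in auto)

section \<open>Chain maps, homotopies and uniqueness of the shifts\<close>

lemma homogeneous_mult:
  fixes A B :: "('v::finite, 'k::field) mpoly mat"
  assumes A: "homogeneous_mat d e A" and B: "homogeneous_mat e f B"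
  shows "homogeneous_mat d f (A * B)"
  unfolding homogeneous_mat_def
proof (intro conjI allI impI ballI)
  have cA: "A \<in> carrier_mat (length d) (length e)" and cB: "B \<in> carrier_mat (length e) (length f)"
    using A B homogeneous_matD by auto
  show "A * B \<in> carrier_mat (length d) (length f)" using cA cB by simp
  fix a b t assume a: "a < length d" and b: "b < length f" and t: "t \<in> Poly_Mapping.keys ((A * B) $$ (a, b))"
  have "(A * B) $$ (a, b) = (\<Sum>j<length e. A $$ (a, j) * B $$ (j, b))"
    using a b cA cB by (simp add: scalar_prod_def atLeast0LessThan)
  then have "(\<Sum>j<length e. Poly_Mapping.lookup (A $$ (a, j) * B $$ (j, b)) t) \<noteq> 0"
    using t by (simp add: in_keys_iff lookup_sum)
  then obtain j where j: "j < length e" "Poly_Mapping.lookup (A $$ (a, j) * B $$ (j, b)) t \<noteq> 0"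
    by (rule sum.not_neutral_contains_not_neutral) simp
  then have "t \<in> Poly_Mapping.keys (A $$ (a, j) * B $$ (j, b))" by (simp add: in_keys_iff)
  then obtain r s where rs: "t = r + s" "r \<in> Poly_Mapping.keys (A $$ (a, j))" "s \<in> Poly_Mapping.keys (B $$ (j, b))"
    using keys_mult[of "A $$ (a, j)" "B $$ (j, b)"] by blast
  then have "tdeg r + d ! a = e ! j" "tdeg s + e ! j = f ! b"
    using A B a b j(1) unfolding homogeneous_mat_def by blast+
  then show "tdeg t + d ! a = f ! b" using rs(1) by (simp add: tdeg_add)
qed

lemma homogeneous_one: "homogeneous_mat d d (1\<^sub>m (length d) :: ('v, 'k::field) mpoly mat)"
  unfolding homogeneous_mat_def by (auto simp: tdeg_def split: if_splits)

text \<open>The identity of the ring in position 0 is lifted through F' by exactness, one position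
  at a time. Homogeneous preimages keep the maps homogeneous, which is what later compares
  degrees.\<close>

lemma ex_chain_map:
  fixes F F' :: "('v::finite, 'k::field) mpoly graded_complex"
  assumes F: "is_graded_resolution I F" and F': "is_graded_resolution I F'"
  shows "\<exists>\<Phi>. \<Phi> 0 = 1\<^sub>m 1 \<and> (\<forall>i. homogeneous_mat (aug_shifts F' i) (aug_shifts F i) (\<Phi> i)) \<and>
    (\<forall>i. aug_diff F' i * \<Phi> (Suc i) = \<Phi> i * aug_diff F i)"
proof -
  let ?d = "aug_diff F" and ?d' = "aug_diff F'" and ?n = "\<lambda>i. length (aug_shifts F i)" and ?n' = "\<lambda>i. length (aug_shifts F' i)"
  note c = resolution_carrier[OF F] and c' = resolution_carrier[OF F']
  \<comment> \<open>The last conjunct is what permits the next lift. It persists because d' Y d = X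
    d d = 0 places the columns of Y d in the kernel of d'.\<close>
  define P where "P i X \<longleftrightarrow> (i = 0 \<longrightarrow> X = 1\<^sub>m 1) \<and> homogeneous_mat (aug_shifts F' i) (aug_shifts F i) X \<and>
    (\<forall>b<?n (Suc i). col (X * ?d i) b \<in> mat_im (?d' i))" for i X
  have P0: "P 0 (1\<^sub>m 1)"
  proof -
    have "?d 0 \<in> carrier_mat 1 (?n 1)" using c[of 0] by (simp add: aug_shifts_def)
    then have "1\<^sub>m 1 * ?d 0 = ?d 0" by simp
    moreover have "col (?d 0) b \<in> mat_im (?d' 0)" if "b < ?n 1" for b
      using resolution_im_0[OF F F'] col_in_mat_im[OF c, of b 0] that by auto
    moreover have "homogeneous_mat (aug_shifts F' 0) (aug_shifts F 0) (1\<^sub>m 1 :: ('v, 'k) mpoly mat)"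
      using homogeneous_one[of "[0]"] by (simp add: aug_shifts_def)
    ultimately show ?thesis unfolding P_def by simp
  qed
  have step: "\<exists>Y. P (Suc i) Y \<and> ?d' i * Y = X * ?d i" if X: "P i X" for i X
  proof -
    have hX: "homogeneous_mat (aug_shifts F' i) (aug_shifts F i) X" using X unfolding P_def by blast
    obtain Y where Y: "homogeneous_mat (aug_shifts F' (Suc i)) (aug_shifts F (Suc i)) Y" "?d' i * Y = X * ?d i"
      using homogeneous_preimage[OF resolution_homogeneous[OF F']
          homogeneous_mult[OF hX resolution_homogeneous[OF F]]] X unfolding P_def by blast
    note cX = homogeneous_matD[OF hX] and cY = homogeneous_matD[OF Y(1)]
    have "?d' i * (Y * ?d (Suc i)) = (?d' i * Y) * ?d (Suc i)"
      using assoc_mult_mat[OF c' cY c] by simp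
    also have "\<dots> = X * (?d i * ?d (Suc i))" unfolding Y(2) using assoc_mult_mat[OF cX c c] .
    also have "\<dots> = 0\<^sub>m (?n' i) (?n (Suc (Suc i)))"
      unfolding resolution_comp_zero[OF F] by (rule right_mult_zero_mat[OF cX])
    finally have "col (Y * ?d (Suc i)) b \<in> mat_ker (?d' i)" if "b < ?n (Suc (Suc i))" for b
      using col_in_mat_ker[OF c' mult_carrier_mat[OF cY c]] that by blast
    then have "P (Suc i) Y" unfolding P_def resolution_exact[OF F', symmetric] using Y by simp
    then show ?thesis using Y(2) by blast
  qed
  obtain \<Phi> where "\<forall>i. P i (\<Phi> i)" "\<forall>i. ?d' i * \<Phi> (Suc i) = \<Phi> i * ?d i"
    using dependent_nat_choice[of P "\<lambda>i X Y. ?d' i * Y = X * ?d i"] P0 step by blast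
  then show ?thesis unfolding P_def by blast
qed

text \<open>A chain endomorphism over the identity of the ring is homotopic to the identity, with a
  homotopy that vanishes on the ring. It is applied to the composite of two comparison maps.\<close>

lemma ex_homotopy:
  fixes F :: "('v::finite, 'k::field) mpoly graded_complex"
  assumes F: "is_graded_resolution I F" and T0: "\<Theta> 0 = 1\<^sub>m 1"
    and cT: "\<And>i. \<Theta> i \<in> carrier_mat (length (aug_shifts F i)) (length (aug_shifts F i))"
    and T: "\<And>i. aug_diff F i * \<Theta> (Suc i) = \<Theta> i * aug_diff F i"
  shows "\<exists>h. h 0 = 0\<^sub>m (length (aug_shifts F 1)) 1 \<and>
    (\<forall>i. h i \<in> carrier_mat (length (aug_shifts F (Suc i))) (length (aug_shifts F i))) \<and>
    (\<forall>i. aug_diff F (Suc i) * h (Suc i) = 1\<^sub>m (length (aug_shifts F (Suc i))) - \<Theta> (Suc i) - h i * aug_diff F i)"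
proof -
  let ?d = "aug_diff F" and ?n = "\<lambda>i. length (aug_shifts F i)"
  note c = resolution_carrier[OF F]
  have n0: "?n 0 = 1" by (simp add: aug_shifts_def)
  let ?R = "\<lambda>i X. 1\<^sub>m (?n (Suc i)) - \<Theta> (Suc i) - X * ?d i"
  have expand: "?d i * ?R i X = ?d i - \<Theta> i * ?d i - ?d i * X * ?d i"
    if X: "X \<in> carrier_mat (?n (Suc i)) (?n i)" for i X
  proof -
    have XD: "X * ?d i \<in> carrier_mat (?n (Suc i)) (?n (Suc i))" using X c by (rule mult_carrier_mat)
    have "?d i * ?R i X = ?d i * (1\<^sub>m (?n (Suc i)) - \<Theta> (Suc i)) - ?d i * (X * ?d i)"
      by (rule mult_minus_distrib_mat[OF c minus_carrier_mat[OF cT] XD])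
    also have "?d i * (1\<^sub>m (?n (Suc i)) - \<Theta> (Suc i)) = ?d i * 1\<^sub>m (?n (Suc i)) - ?d i * \<Theta> (Suc i)"
      by (rule mult_minus_distrib_mat[OF c one_carrier_mat cT])
    also have "?d i * 1\<^sub>m (?n (Suc i)) = ?d i" by (rule right_mult_one_mat[OF c])
    also have "?d i * (X * ?d i) = ?d i * X * ?d i" using assoc_mult_mat[OF c X c] by simp
    finally show ?thesis unfolding T .
  qed
  \<comment> \<open>The remainder \<open>?R i X\<close> has to be a boundary for the next component
    of the homotopy to exist; by exactness it suffices that d annihilates it, which is the last
    conjunct.\<close>
  define P where "P i X \<longleftrightarrow> (i = 0 \<longrightarrow> X = 0\<^sub>m (?n 1) 1) \<and> X \<in> carrier_mat (?n (Suc i)) (?n i) \<and>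
    ?d i * ?R i X = 0\<^sub>m (?n i) (?n (Suc i))" for i X
  have P0: "P 0 (0\<^sub>m (?n 1) 1)"
  proof -
    let ?X = "0\<^sub>m (?n 1) 1 :: ('v, 'k) mpoly mat"
    have X: "?X \<in> carrier_mat (?n (Suc 0)) (?n 0)" using n0 by simp
    have "?d 0 * ?X = 0\<^sub>m 1 1" using c[of 0] n0 by simp
    moreover have c0: "?d 0 \<in> carrier_mat 1 (?n (Suc 0))" using c[of 0] n0 by simp
    ultimately have "?d 0 * ?R 0 ?X = ?d 0 - ?d 0 - 0\<^sub>m 1 (?n (Suc 0))"
      unfolding expand[OF X] T0 by simp
    also have "\<dots> = 0\<^sub>m (?n 0) (?n (Suc 0))" using c0 n0 by (intro eq_matI) auto
    finally show ?thesis unfolding P_def using X by simp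
  qed
  have step: "\<exists>Y. P (Suc i) Y \<and> ?d (Suc i) * Y = ?R i X" if X: "P i X" for i X
  proof -
    have cX: "X \<in> carrier_mat (?n (Suc i)) (?n i)" and X0: "?d i * ?R i X = 0\<^sub>m (?n i) (?n (Suc i))"
      using X unfolding P_def by auto
    have XD: "X * ?d i \<in> carrier_mat (?n (Suc i)) (?n (Suc i))" using cX c by (rule mult_carrier_mat)
    have cR: "?R i X \<in> carrier_mat (?n (Suc i)) (?n (Suc i))" by (rule minus_carrier_mat[OF XD])
    have "col (?R i X) b \<in> mat_im (?d (Suc i))" if "b < ?n (Suc i)" for b
      unfolding resolution_exact[OF F, symmetric] by (rule col_in_mat_ker[OF c cR X0 that])
    then obtain Y where Y: "Y \<in> carrier_mat (?n (Suc (Suc i))) (?n (Suc i))" "?d (Suc i) * Y = ?R i X"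
      using mat_preimage[OF c cR] by blast
    have "?d i * X * ?d i * ?d (Suc i) = ?d i * X * (?d i * ?d (Suc i))"
      by (rule assoc_mult_mat[OF mult_carrier_mat[OF c cX] c c])
    have "?d (Suc i) * Y * ?d (Suc i) =
        (1\<^sub>m (?n (Suc i)) - \<Theta> (Suc i)) * ?d (Suc i) - X * ?d i * ?d (Suc i)"
      unfolding Y(2) by (rule minus_mult_distrib_mat[OF minus_carrier_mat[OF cT] XD c])
    also have "(1\<^sub>m (?n (Suc i)) - \<Theta> (Suc i)) * ?d (Suc i) =
        1\<^sub>m (?n (Suc i)) * ?d (Suc i) - \<Theta> (Suc i) * ?d (Suc i)"
      by (rule minus_mult_distrib_mat[OF one_carrier_mat cT c])
    also have "1\<^sub>m (?n (Suc i)) * ?d (Suc i) = ?d (Suc i)" by (rule left_mult_one_mat[OF c])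
    also have "X * ?d i * ?d (Suc i) = X * (?d i * ?d (Suc i))" by (rule assoc_mult_mat[OF cX c c])
    also have "\<dots> = 0\<^sub>m (?n (Suc i)) (?n (Suc (Suc i)))"
      unfolding resolution_comp_zero[OF F] by (rule right_mult_zero_mat[OF cX])
    finally have eq: "?d (Suc i) * Y * ?d (Suc i) =
      ?d (Suc i) - \<Theta> (Suc i) * ?d (Suc i) - 0\<^sub>m (?n (Suc i)) (?n (Suc (Suc i)))" .
    have "\<Theta> (Suc i) * ?d (Suc i) \<in> carrier_mat (?n (Suc i)) (?n (Suc (Suc i)))"
      using cT c by (rule mult_carrier_mat)
    then have "?d (Suc i) * ?R (Suc i) Y = 0\<^sub>m (?n (Suc i)) (?n (Suc (Suc i)))"
      unfolding expand[OF Y(1)] eq using c[of "Suc i"] by (intro eq_matI) auto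
    then have "P (Suc i) Y" unfolding P_def using Y by simp
    then show ?thesis using Y(2) by blast
  qed
  obtain h where "\<forall>i. P i (h i)" "\<forall>i. ?d (Suc i) * h (Suc i) = ?R i (h i)"
    using dependent_nat_choice[of P "\<lambda>i X Y. ?d (Suc i) * Y = ?R i X"] P0 step by blast
  then show ?thesis unfolding P_def by blast
qed

lemma lookup_mult_mat_0:
  fixes A B :: "('v::finite, 'k::field) mpoly mat"
  assumes "A \<in> carrier_mat n m" "B \<in> carrier_mat m k" "a < n" "b < k"
  shows "Poly_Mapping.lookup ((A * B) $$ (a, b)) 0 =
    (\<Sum>j<m. Poly_Mapping.lookup (A $$ (a, j)) 0 * Poly_Mapping.lookup (B $$ (j, b)) 0)"
  using assms by (simp add: scalar_prod_def atLeast0LessThan lookup_sum lookup_mult_0)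

text \<open>Modulo the variables, the composite of the comparison maps \<open>F \<rightarrow> F' \<rightarrow> F\<close> is the identity,
  since it is homotopic to it and the differentials of \<open>F\<close> vanish.\<close>

lemma minimal_resolution_shifts:
  fixes F F' :: "('v::finite, 'k::field) mpoly graded_complex"
  assumes "is_minimal_resolution I F" "is_graded_resolution I F'"
  shows "set (shifts F i) \<subseteq> set (shifts F' i)"
proof
  let ?d = "aug_diff F" and ?n = "\<lambda>i. length (aug_shifts F i)" and ?n' = "\<lambda>i. length (aug_shifts F' i)"
  have F: "is_graded_resolution I F"
    and min: "\<And>i p. p \<in> elements_mat (differential F i) \<Longrightarrow> Poly_Mapping.lookup p 0 = 0"
    using assms(1) unfolding is_minimal_resolution_def by auto
  note F' = assms(2) and c = resolution_carrier[OF F]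
  obtain \<Phi> where Phi: "\<Phi> 0 = 1\<^sub>m 1" "\<And>i. homogeneous_mat (aug_shifts F' i) (aug_shifts F i) (\<Phi> i)"
    "\<And>i. aug_diff F' i * \<Phi> (Suc i) = \<Phi> i * ?d i" using ex_chain_map[OF F F'] by blast
  obtain \<Psi> where Psi: "\<Psi> 0 = 1\<^sub>m 1" "\<And>i. homogeneous_mat (aug_shifts F i) (aug_shifts F' i) (\<Psi> i)"
    "\<And>i. ?d i * \<Psi> (Suc i) = \<Psi> i * aug_diff F' i" using ex_chain_map[OF F' F] by blast
  note cPhi = homogeneous_matD[OF Phi(2)] and cPsi = homogeneous_matD[OF Psi(2)]
  let ?T = "\<lambda>i. \<Psi> i * \<Phi> i"
  have cT: "?T i \<in> carrier_mat (?n i) (?n i)" for i using cPsi cPhi by (rule mult_carrier_mat)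
  have "?d i * ?T (Suc i) = ?T i * ?d i" for i
  proof -
    have "?d i * ?T (Suc i) = ?d i * \<Psi> (Suc i) * \<Phi> (Suc i)" using assoc_mult_mat[OF c cPsi cPhi] by simp
    also have "\<dots> = \<Psi> i * (aug_diff F' i * \<Phi> (Suc i))"
      unfolding Psi(3) by (rule assoc_mult_mat[OF cPsi resolution_carrier[OF F'] cPhi])
    also have "\<dots> = ?T i * ?d i" unfolding Phi(3) using assoc_mult_mat[OF cPsi cPhi c] by simp
    finally show ?thesis .
  qed
  moreover have "?T 0 = 1\<^sub>m 1" unfolding Phi(1) Psi(1) by simp
  ultimately obtain h where h0: "h 0 = 0\<^sub>m (?n 1) 1"
    and ch: "\<And>i. h i \<in> carrier_mat (?n (Suc i)) (?n i)"
    and h: "\<And>i. ?d (Suc i) * h (Suc i) = 1\<^sub>m (?n (Suc i)) - ?T (Suc i) - h i * ?d i"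
    using ex_homotopy[OF F, of ?T] cT by blast
  have d0: "Poly_Mapping.lookup (?d (Suc i) $$ (a, b)) 0 = 0" if "a < ?n (Suc i)" "b < ?n (Suc (Suc i))" for i a b
    using min[OF elements_matI[OF c that refl, unfolded aug_diff_def nat.case]] by (simp add: aug_diff_def)
  fix j assume "j \<in> set (shifts F i)"
  then obtain b where b: "b < ?n (Suc i)" "aug_shifts F (Suc i) ! b = j"
    by (auto simp: in_set_conv_nth aug_shifts_def)
  have "Poly_Mapping.lookup ((?d (Suc i) * h (Suc i)) $$ (b, b)) 0 = 0"
    unfolding lookup_mult_mat_0[OF c ch b(1) b(1)] using d0[OF b(1)] by (simp add: sum.neutral)
  moreover have "Poly_Mapping.lookup ((h i * ?d i) $$ (b, b)) 0 = 0"
  proof (cases i)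
    case 0
    \<comment> \<open>Minimality says nothing about the augmentation, whose entries may have
      constant terms. This product vanishes because the homotopy was started at zero.\<close>
    have "h 0 * ?d 0 = 0\<^sub>m (?n 1) (?n 1)"
      unfolding h0 using c[of 0] left_mult_zero_mat by (simp add: aug_shifts_def)
    then show ?thesis using b(1) 0 by simp
  next
    case (Suc k)
    then show ?thesis unfolding lookup_mult_mat_0[OF ch c b(1) b(1)] using d0[of _ k b] b(1)
      by (intro sum.neutral) auto
  qed
  moreover have "(1\<^sub>m (?n (Suc i)) - ?T (Suc i) - h i * ?d i) $$ (b, b) =
      1 - ?T (Suc i) $$ (b, b) - (h i * ?d i) $$ (b, b)"
    using b(1) cT[of "Suc i"] mult_carrier_mat[OF ch[of i] c[of i]] by (simp del: index_mult_mat)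
  ultimately have "Poly_Mapping.lookup (?T (Suc i) $$ (b, b)) 0 = 1"
    unfolding h by (simp add: lookup_minus lookup_one)
  then have "(\<Sum>a<?n' (Suc i). Poly_Mapping.lookup (\<Psi> (Suc i) $$ (b, a)) 0 *
      Poly_Mapping.lookup (\<Phi> (Suc i) $$ (a, b)) 0) \<noteq> 0"
    unfolding lookup_mult_mat_0[OF cPsi cPhi b(1) b(1)] by simp
  \<comment> \<open>The composite has constant term 1 at (b, b), so some entry (a, b) of the
    homogeneous comparison map has a nonzero constant term, which forces equal shifts.\<close>
  then obtain a where a: "a < ?n' (Suc i)" "Poly_Mapping.lookup (\<Phi> (Suc i) $$ (a, b)) 0 \<noteq> 0"
    by (rule sum.not_neutral_contains_not_neutral) simp
  then have "0 \<in> Poly_Mapping.keys (\<Phi> (Suc i) $$ (a, b))" by (simp add: in_keys_iff)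
  then have "tdeg (0 :: 'v \<Rightarrow>\<^sub>0 nat) + aug_shifts F' (Suc i) ! a = aug_shifts F (Suc i) ! b"
    using Phi(2)[of "Suc i"] a(1) b(1) unfolding homogeneous_mat_def by blast
  then have "aug_shifts F' (Suc i) ! a = j" using b(2) by (simp add: tdeg_def)
  then show "j \<in> set (shifts F' i)" using a(1) nth_mem by (auto simp: aug_shifts_def)
qed

section \<open>Linear quotients and linear resolutions\<close>

lemma syz_monomial_gens:
  "z \<in> syz (monomial_gens us) s \<longleftrightarrow> z \<in> strand (monomial_gens us) s \<and> (\<Sum>b<length us. z b) = 0"
  unfolding syz_def lincomb_monomial_gens by (auto simp: fun_eq_iff)

text \<open>The colon of the earlier monomials by \<open>us ! k\<close> is generated by the
  monomials of the differences \<open>us ! l - us ! k\<close>. Each of them must be divisible by a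
  variable x that is itself such a difference.\<close>

definition lq_list :: "'v set list \<Rightarrow> bool" where
  "lq_list us \<longleftrightarrow> (\<forall>k<length us. \<forall>l<k. \<exists>m<k. \<exists>x\<in>us ! l. us ! m - us ! k = {x})"

lemma linear_quotient_monomial_gens:
  fixes us :: "'v::finite set list"
  assumes "lq_list us" "\<And>u. u \<in> set us \<Longrightarrow> card u = d"
  shows "linear_quotient_gens d (monomial_gens us :: ('v, 'k::field) gens)"
  using assms
proof (induction us rule: rev_induct)
  case Nil
  then show ?case unfolding monomial_gens_def by (simp add: linear_quotient_gens.Nil)
next
  case (snoc u us)
  have lq: "\<exists>m<k. \<exists>x\<in>(us @ [u]) ! l. (us @ [u]) ! m - (us @ [u]) ! k = {x}" if "k < length (us @ [u])" "l < k" for k l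
    using snoc.prems(1) that unfolding lq_list_def by blast
  have "lq_list us"
    unfolding lq_list_def
  proof (intro allI impI)
    fix k l assume k: "k < length us" and l: "l < k"
    obtain m x where m: "m < k" "x \<in> (us @ [u]) ! l" "(us @ [u]) ! m - (us @ [u]) ! k = {x}"
      using lq[of k l] k l by auto
    then have "x \<in> us ! l" "us ! m - us ! k = {x}" using k l by (simp_all add: nth_append)
    then show "\<exists>m<k. \<exists>x\<in>us ! l. us ! m - us ! k = {x}" using m(1) by blast
  qed
  then have IH: "linear_quotient_gens d (monomial_gens us :: ('v, 'k) gens)" using snoc by simp
  have last: "\<exists>v\<in>set us. \<exists>x\<in>w. v - u = {x}" if w: "w \<in> set us" for w
  proof -
    obtain l where l: "l < length us" "us ! l = w" using w by (auto simp: in_set_conv_nth)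
    obtain m x where "m < length us" "x \<in> (us @ [u]) ! l" "(us @ [u]) ! m - (us @ [u]) ! length us = {x}"
      using lq[of "length us" l] l by auto
    then show ?thesis using l by (intro bexI[of _ "us ! m"] bexI[of _ x]) (auto simp: nth_append)
  qed
  let ?X = "{x. \<exists>v\<in>set us. v - u = {x}}"
  let ?c = "\<lambda>a. if a = 0 then 1 else (0::'k)"
  have "linear_quotient_gens d (monomial_gens us @ [(u, ?c)])"
  proof (rule linear_quotient_gens.snoc[OF IH])
    show "card u = d" using snoc.prems(2) by simp
    show "?X \<inter> u = {}" by blast
    show "\<forall>t. u \<subseteq> t \<longrightarrow> (?c \<in> gen_span (monomial_gens us) t \<longleftrightarrow> t \<inter> ?X \<noteq> {})"
    proof (intro allI impI)
      fix t assume t: "u \<subseteq> t"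
      have "(\<exists>w\<in>set us. w \<subseteq> t) \<longleftrightarrow> t \<inter> ?X \<noteq> {}"
      proof
        assume "\<exists>w\<in>set us. w \<subseteq> t"
        then obtain w where w: "w \<in> set us" "w \<subseteq> t" by blast
        then obtain v x where "v \<in> set us" "x \<in> w" "v - u = {x}" using last by blast
        then have "x \<in> t \<inter> ?X" using w by auto
        then show "t \<inter> ?X \<noteq> {}" by blast
      next
        assume "t \<inter> ?X \<noteq> {}"
        then obtain x v where "x \<in> t" "v \<in> set us" "v - u = {x}" by auto
        moreover from this have "v \<subseteq> t" using t by auto
        ultimately show "\<exists>w\<in>set us. w \<subseteq> t" by blast
      qed
      then show "?c \<in> gen_span (monomial_gens us) t \<longleftrightarrow> t \<inter> ?X \<noteq> {}"
        unfolding gen_span_monomial_gens by simp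
    qed
  qed
  then show ?case unfolding monomial_gens_def by simp
qed

lemma times_monomial_in_ideal:
  fixes f :: "('v::finite, 'k::field) mpoly"
  shows "f * monomial s \<in> ideal_gen (monomial ` T) \<longleftrightarrow>
    (\<forall>a\<in>Poly_Mapping.keys f. \<exists>t\<in>T. mdvd t (a + s))"
proof -
  have lk: "Poly_Mapping.lookup (f * monomial s) b = (if mdvd s b then Poly_Mapping.lookup f (b - s) else 0)" for b
    using lookup_single_mult[of s 1 f b] by (simp add: monomial_def mult.commute)
  have "Poly_Mapping.keys (f * monomial s) = (\<lambda>a. a + s) ` Poly_Mapping.keys f"
  proof (rule subset_antisym; rule subsetI)
    fix b assume "b \<in> Poly_Mapping.keys (f * monomial s)"
    then have "mdvd s b" "b - s \<in> Poly_Mapping.keys f" by (auto simp: in_keys_iff lk split: if_splits)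
    then show "b \<in> (\<lambda>a. a + s) ` Poly_Mapping.keys f" using mdvd_minus_add[of s b] by force
  next
    fix b assume "b \<in> (\<lambda>a. a + s) ` Poly_Mapping.keys f"
    then show "b \<in> Poly_Mapping.keys (f * monomial s)" by (auto simp: in_keys_iff lk mdvd_add_right)
  qed
  then show ?thesis unfolding ideal_gen_monomials by simp
qed

lemma colon_ideal_principal:
  fixes B :: "('v, 'k::field) mpoly set"
  shows "colon_ideal (ideal_gen B) (ideal_gen {g}) = {f. f * g \<in> ideal_gen B}"
proof -
  have "f * h \<in> ideal_gen B" if fg: "f * g \<in> ideal_gen B" and h: "h \<in> ideal_gen {g}" for f h
  proof -
    obtain c where "h = c * g" using h unfolding ideal_gen_def poly_module.span_singleton by blast
    then have "f * h = c * (f * g)" by (simp only: mult.left_commute)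
    then show ?thesis using fg unfolding ideal_gen_def by (simp only: poly_module.span_scale)
  qed
  moreover have "g \<in> ideal_gen {g}" unfolding ideal_gen_def by (rule poly_module.span_base) simp
  ultimately show ?thesis unfolding colon_ideal_def by blast
qed

lemma mdvd_single_1: "mdvd (Poly_Mapping.single x 1) t \<longleftrightarrow> x \<in> Poly_Mapping.keys t"
  unfolding mdvd_def by (auto simp: lookup_single when_def in_keys_iff Suc_le_eq)

lemma ideal_gen_vars:
  "(ideal_gen (var ` X) :: ('v, 'k::field) mpoly set) =
    {f. \<forall>a\<in>Poly_Mapping.keys f. X \<inter> Poly_Mapping.keys a \<noteq> {}}"
proof -
  have "var ` X = (monomial ` (\<lambda>x. Poly_Mapping.single x 1) ` X :: ('v, 'k) mpoly set)"
    unfolding var_def image_image ..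
  then have "ideal_gen (var ` X) = {f :: ('v, 'k) mpoly. \<forall>a\<in>Poly_Mapping.keys f.
      \<exists>t\<in>(\<lambda>x. Poly_Mapping.single x 1) ` X. mdvd t a}"
    by (simp only: ideal_gen_monomials)
  also have "\<dots> = {f. \<forall>a\<in>Poly_Mapping.keys f. X \<inter> Poly_Mapping.keys a \<noteq> {}}"
    unfolding bex_simps mdvd_single_1 by (rule Collect_cong) blast
  finally show ?thesis .
qed

lemma colon_squarefree:
  fixes us :: "'v::finite set list"
  shows "colon_ideal (ideal_gen (monomial ` expo ` set us)) (ideal_gen {monomial (expo u)}) =
    {f :: ('v, 'k::field) mpoly. \<forall>a\<in>Poly_Mapping.keys f. \<exists>w\<in>set us. w \<subseteq> Poly_Mapping.keys a \<union> u}"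
proof -
  have "Poly_Mapping.keys (a + expo u) = Poly_Mapping.keys a \<union> u" for a :: "'v \<Rightarrow>\<^sub>0 nat"
    by (auto simp: in_keys_iff lookup_add split: if_splits)
  then show ?thesis unfolding colon_ideal_principal times_monomial_in_ideal by (simp add: mdvd_expo_left)
qed

lemma Diff_singleton_of_subset_insert:
  assumes "finite u" "card v = card u" "v \<noteq> u" "v \<subseteq> insert x u" "finite v"
  shows "v - u = {x}"
proof -
  have "v - u \<noteq> {}" using assms card_seteq[of u v] by auto
  then show ?thesis using assms(4) by blast
qed

lemma has_linear_quotients_squarefree:
  fixes T :: "'v::finite set set"
  assumes card: "\<And>u. u \<in> T \<Longrightarrow> card u = d"
  shows "has_linear_quotients (ideal_gen (monomial ` expo ` T) :: ('v, 'k::field) mpoly set) \<longleftrightarrow>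
    (\<exists>us. distinct us \<and> set us = T \<and> lq_list us)"
proof -
  let ?J = "ideal_gen (monomial ` expo ` T) :: ('v, 'k) mpoly set"
  let ?m = "\<lambda>u. monomial (expo u) :: ('v, 'k) mpoly"
  have mg: "mingens ?J = ?m ` T"
  proof -
    have "tdeg t = d" if "t \<in> expo ` T" for t using that card by auto
    then have "mingens ?J = monomial ` expo ` T" by (rule mingens_equigenerated)
    then show ?thesis by (simp only: image_image)
  qed
  have inj: "inj ?m" by (rule injI) simp
  have colon: "colon_ideal (ideal_gen (set (take k (map ?m us)))) (ideal_gen {map ?m us ! k}) =
    {f. \<forall>a\<in>Poly_Mapping.keys f. \<exists>w\<in>set (take k us). w \<subseteq> Poly_Mapping.keys a \<union> us ! k}"
    if "k < length us" for k us
    using colon_squarefree[where 'k='k, of "take k us" "us ! k"] that by (simp add: take_map image_image)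
  show ?thesis
  proof
    assume "has_linear_quotients ?J"
    then obtain ms where ms: "distinct ms" "set ms = ?m ` T"
      "\<And>k. 1 \<le> k \<Longrightarrow> k < length ms \<Longrightarrow>
        \<exists>X. colon_ideal (ideal_gen (set (take k ms))) (ideal_gen {ms ! k}) = ideal_gen (var ` X)"
      unfolding has_linear_quotients_def mg by blast
    have "\<exists>us. ms = map ?m us" unfolding ex_map_conv ms(2) by auto
    then obtain us where us: "ms = map ?m us" ..
    have dus: "distinct us" using ms(1) us by (simp add: distinct_map)
    have sus: "set us = T" using ms(2) us inj_image_eq_iff[OF inj] by auto
    have "lq_list us"
      unfolding lq_list_def
    proof (intro allI impI)
      fix k l assume k: "k < length us" and l: "l < k"
      obtain X where X: "{f. \<forall>a\<in>Poly_Mapping.keys f. \<exists>w\<in>set (take k us). w \<subseteq> Poly_Mapping.keys a \<union> us ! k}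
          = (ideal_gen (var ` X) :: ('v, 'k) mpoly set)"
        using ms(3)[of k] k l colon[OF k] us by auto
      \<comment> \<open>Both ideals are tested on the monomial of a set s: first s =
        \<open>us ! l - us ! k\<close>, which yields a variable x in X, then s = \<open>{x}\<close>,
        which yields the generator \<open>us ! m\<close>.\<close>
      have iff: "(\<exists>w\<in>set (take k us). w \<subseteq> s \<union> us ! k) \<longleftrightarrow> X \<inter> s \<noteq> {}" for s
      proof -
        have "?m s \<in> {f. \<forall>a\<in>Poly_Mapping.keys f. \<exists>w\<in>set (take k us). w \<subseteq> Poly_Mapping.keys a \<union> us ! k}
          \<longleftrightarrow> ?m s \<in> ideal_gen (var ` X)" unfolding X ..
        then show ?thesis unfolding ideal_gen_vars by simp
      qed
      have "us ! l \<in> set (take k us)" using k l by (auto simp: in_set_conv_nth)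
      then obtain x where x: "x \<in> X" "x \<in> us ! l - us ! k" using iff[of "us ! l - us ! k"] by blast
      then obtain w where w: "w \<in> set (take k us)" "w \<subseteq> {x} \<union> us ! k" using iff[of "{x}"] by blast
      obtain m where m: "m < k" "w = us ! m" using w(1) k by (auto simp: in_set_conv_nth)
      have "us ! m \<noteq> us ! k" using dus m k by (simp add: nth_eq_iff_index_eq)
      moreover have "card (us ! m) = card (us ! k)" using card sus k m nth_mem by (metis less_trans)
      ultimately have "us ! m - us ! k = {x}"
        using Diff_singleton_of_subset_insert[of "us ! k" "us ! m" x] w m by simp
      then show "\<exists>m<k. \<exists>x\<in>us ! l. us ! m - us ! k = {x}" using m(1) x(2) by blast
    qed
    then show "\<exists>us. distinct us \<and> set us = T \<and> lq_list us" using dus sus by blast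
  next
    assume "\<exists>us. distinct us \<and> set us = T \<and> lq_list us"
    then obtain us where us: "distinct us" "set us = T" "lq_list us" by blast
    have "\<exists>X. colon_ideal (ideal_gen (set (take k (map ?m us)))) (ideal_gen {map ?m us ! k}) = ideal_gen (var ` X)"
      if k: "k < length us" for k
    proof -
      let ?X = "{x. \<exists>m<k. us ! m - us ! k = {x}}"
      have "(\<exists>w\<in>set (take k us). w \<subseteq> s \<union> us ! k) \<longleftrightarrow> ?X \<inter> s \<noteq> {}" for s
      proof
        assume "\<exists>w\<in>set (take k us). w \<subseteq> s \<union> us ! k"
        then obtain l where l: "l < k" "us ! l \<subseteq> s \<union> us ! k" using k by (auto simp: in_set_conv_nth)
        then obtain m x where "m < k" "x \<in> us ! l" "us ! m - us ! k = {x}"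
          using us(3) k unfolding lq_list_def by blast
        then have "x \<in> s" "x \<in> ?X" using l(2) by auto
        then show "?X \<inter> s \<noteq> {}" by blast
      next
        assume "?X \<inter> s \<noteq> {}"
        then obtain x m where x: "x \<in> s" "m < k" "us ! m - us ! k = {x}" by auto
        then have "us ! m \<in> set (take k us)" using k by (auto simp: in_set_conv_nth)
        moreover have "us ! m \<subseteq> s \<union> us ! k" using x by auto
        ultimately show "\<exists>w\<in>set (take k us). w \<subseteq> s \<union> us ! k" by blast
      qed
      then have "colon_ideal (ideal_gen (set (take k (map ?m us)))) (ideal_gen {map ?m us ! k}) = ideal_gen (var ` ?X)"
        unfolding colon[OF k] ideal_gen_vars by simp
      then show ?thesis by (rule exI)
    qed
    moreover have "distinct (map ?m us)" using us(1) inj by (simp add: distinct_map inj_on_def)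
    moreover have "set (map ?m us) = mingens ?J" unfolding mg using us(2) by simp
    ultimately show "has_linear_quotients ?J" unfolding has_linear_quotients_def
      by (intro exI[of _ "map ?m us"]) simp
  qed
qed

section \<open>Betti numbers read off from the stages\<close>

lemma betti_nonzero: "betti I i j \<noteq> 0 \<longleftrightarrow> j \<in> set (shifts (SOME F. is_minimal_resolution I F) i)"
  unfolding betti_def by (simp add: count_list_0_iff)

lemma some_minimal_resolution:
  "is_minimal_resolution I F \<Longrightarrow> is_minimal_resolution I (SOME F. is_minimal_resolution I F)"
  by (rule someI)

text \<open>The comparison of shifts in both directions, between F and the resolution chosen in
  \<open>betti\<close>.\<close>

lemma betti_nonzero_shifts:
  fixes F :: "('v::finite, 'k::field) mpoly graded_complex"
  assumes "is_minimal_resolution I F"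
  shows "betti I i j \<noteq> 0 \<longleftrightarrow> j \<in> set (shifts F i)"
  using minimal_resolution_shifts[OF some_minimal_resolution[OF assms], of F i]
    minimal_resolution_shifts[OF assms, of "SOME F. is_minimal_resolution I F" i]
    assms some_minimal_resolution[OF assms]
  unfolding betti_nonzero is_minimal_resolution_def by blast

text \<open>Stage i is generated in degree d + i exactly. This also makes it irredundant: every
  nonzero relation involves a generator of stage i + 1, so its degree has at least d + i + 1
  variables, more than any generator of stage i.\<close>

lemma lq_list_linear_resolution:
  fixes us :: "'v::finite set list"
  assumes "lq_list us" "\<And>u. u \<in> set us \<Longrightarrow> card u = d"
  shows "has_linear_resolution (ideal_gen (monomial ` expo ` set us) :: ('v, 'k::field) mpoly set)"
proof -
  let ?J = "ideal_gen (monomial ` expo ` set us) :: ('v, 'k) mpoly set"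
  have "\<exists>gs :: nat \<Rightarrow> ('v, 'k) gens. \<forall>i. (linear_quotient_gens (d + i) (gs i) \<and> (i = 0 \<longrightarrow> gs i = monomial_gens us))
      \<and> syz_gens (gs i) (gs (Suc i))"
    by (rule dependent_nat_choice)
      (use linear_quotient_monomial_gens[OF assms] linear_quotient_syz_gens in fastforce)+
  then obtain gs :: "nat \<Rightarrow> ('v, 'k) gens" where gs: "gs 0 = monomial_gens us"
    "\<And>i. linear_quotient_gens (d + i) (gs i)" "\<And>i. syz_gens (gs i) (gs (Suc i))" by blast
  have card: "card (fst (gs i ! b)) = d + i" if "b < length (gs i)" for i b
    using linear_quotient_gens_card[OF gs(2) nth_mem[OF that]] .
  have "irredundant (gs i)" for i
    unfolding irredundant_def
  proof (intro allI ballI impI)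
    fix s z a assume z: "z \<in> syz (gs i) s" "z a \<noteq> 0"
    then have a: "a < length (gs i)" unfolding syz_def strand_def by blast
    obtain y where y: "y \<in> strand (gs (Suc i)) s" "z = lincomb (gs (Suc i)) y"
      using z(1) gs(3)[of i] unfolding syz_gens_def gen_span_def by blast
    obtain b where b: "b < length (gs (Suc i))" "y b \<noteq> 0"
      using lincomb_nonzero z(2) unfolding y(2) by blast
    then have "card (fst (gs (Suc i) ! b)) \<le> card s"
      using y(1) unfolding strand_def by (intro card_mono) auto
    then show "fst (gs i ! a) \<noteq> s" using card[OF a] card[OF b(1)] by auto
  qed
  then have min: "is_minimal_resolution ?J (strand_complex gs)"
    using strand_complex_minimal_resolution[OF gs(1,3)] by blast
  have shifts: "set (shifts (strand_complex gs) i) \<subseteq> {d + i}" for i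
    unfolding strand_complex_def using linear_quotient_gens_card[OF gs(2)] by auto
  show ?thesis
  proof (cases "us = []")
    case True
    then show ?thesis unfolding has_linear_resolution_def ideal_gen_def by simp
  next
    case False
    then obtain u where u: "u \<in> set us" by (cases us) auto
    then have "d \<in> set (shifts (strand_complex gs) 0)"
      unfolding strand_complex_def using assms(2)[OF u] u by (auto simp: gs(1) monomial_gens_def image_image)
    then have "{ereal (real j - real i) | i j. betti ?J i j \<noteq> 0} = {ereal (real d)}"
      unfolding betti_nonzero_shifts[OF min] using shifts by force
    then have "regularity ?J = ereal (real d)" unfolding regularity_def by simp
    moreover have "mingens ?J = monomial ` expo ` set us"
      by (rule mingens_equigenerated) (use assms(2) in auto)
    ultimately show ?thesis unfolding has_linear_resolution_def using assms(2)
      by (intro disjI2 exI[of _ d] conjI exI[of _ "expo ` set us"]) auto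
  qed
qed

text \<open>The form in which linearity is refuted below: the regularity bounds the degrees of all
  generators of one resolution by stages, and everything else is linear algebra in squarefree
  degrees.\<close>

lemma linear_resolution_strands:
  fixes T :: "'v::finite set set"
  assumes card: "\<And>u. u \<in> T \<Longrightarrow> card u = d" and "T \<noteq> {}"
    and lin: "has_linear_resolution (ideal_gen (monomial ` expo ` T) :: ('v, 'k::field) mpoly set)"
  shows "\<exists>us (gs :: nat \<Rightarrow> ('v, 'k) gens). distinct us \<and> set us = T \<and> gs 0 = monomial_gens us \<and>
    (\<forall>i. syz_gens (gs i) (gs (Suc i))) \<and> (\<forall>i. \<forall>b<length (gs i). card (fst (gs i ! b)) \<le> d + i)"
proof -
  let ?J = "ideal_gen (monomial ` expo ` T) :: ('v, 'k) mpoly set"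
  obtain us where us: "distinct us" "set us = T" using finite_distinct_list[of T] by auto
  have irr0: "irredundant (monomial_gens us :: ('v, 'k) gens)"
    unfolding irredundant_def
  proof (intro allI ballI impI notI)
    fix s a and z :: "nat \<Rightarrow> 'k"
    assume z: "z \<in> syz (monomial_gens us) s" "z a \<noteq> 0" "fst (monomial_gens us ! a :: 'v set \<times> (nat \<Rightarrow> 'k)) = s"
    then have zs: "z \<in> strand (monomial_gens us) s" and z0: "(\<Sum>b<length us. z b) = 0"
      unfolding syz_monomial_gens by auto
    have a: "a < length us" using zs z(2) unfolding strand_def by auto
    then have s: "us ! a = s" using z(3) by simp
    \<comment> \<open>Distinct sets of equal size are incomparable, so in degree
      \<open>us ! a\<close> no other generator occurs.\<close>
    have "z b = 0" if b: "b < length us" "b \<noteq> a" for b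
    proof (rule ccontr)
      assume "z b \<noteq> 0"
      then have "fst (monomial_gens us ! b :: 'v set \<times> (nat \<Rightarrow> 'k)) \<subseteq> s" using zs unfolding strand_def by blast
      then have "us ! b \<subseteq> us ! a" using b s by simp
      moreover have "card (us ! b) = card (us ! a)" using card us a b nth_mem by metis
      ultimately have "us ! b = us ! a" by (simp add: card_subset_eq)
      then show False using us(1) a b by (simp add: nth_eq_iff_index_eq)
    qed
    then have "(\<Sum>b<length us. z b) = (\<Sum>b<length us. if b = a then z a else 0)" by (intro sum.cong) auto
    then show False using z0 z(2) a by simp
  qed
  have "\<exists>gs :: nat \<Rightarrow> ('v, 'k) gens. \<forall>i. (irredundant (gs i) \<and> (i = 0 \<longrightarrow> gs i = monomial_gens us))
      \<and> syz_gens (gs i) (gs (Suc i))"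
    by (rule dependent_nat_choice) (use irr0 ex_irredundant_syz_gens in fastforce)+
  then obtain gs :: "nat \<Rightarrow> ('v, 'k) gens" where gs: "gs 0 = monomial_gens us"
    "\<And>i. irredundant (gs i)" "\<And>i. syz_gens (gs i) (gs (Suc i))" by blast
  have min: "is_minimal_resolution ?J (strand_complex gs)"
    using strand_complex_minimal_resolution[OF gs(1,3,2)] us(2) by simp
  have mg: "mingens ?J = monomial ` expo ` T"
    by (rule mingens_equigenerated) (use card in auto)
  obtain u where u: "u \<in> T" using \<open>T \<noteq> {}\<close> by blast
  have "(monomial (expo u) :: ('v, 'k) mpoly) \<in> ?J" unfolding monomial_in_ideal_gen using u by auto
  moreover have "(monomial (expo u) :: ('v, 'k) mpoly) \<noteq> 0"
    using keys_monomial[where 'k='k, of "expo u"] by (metis empty_not_insert keys_zero)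
  ultimately have "?J \<noteq> {0}" by blast
  then obtain d' T' where d': "mingens ?J = monomial ` T'" "\<And>t. t \<in> T' \<Longrightarrow> tdeg t = d'" "regularity ?J = ereal (real d')"
    using lin unfolding has_linear_resolution_def by blast
  have "(monomial (expo u) :: ('v, 'k) mpoly) \<in> monomial ` T'" using mg d'(1) u by auto
  then have "expo u \<in> T'" by auto
  then have "d' = d" using d'(2)[of "expo u"] card[OF u] by simp
  have "card (fst (gs i ! b)) \<le> d + i" if b: "b < length (gs i)" for i b
  proof -
    have "card (fst (gs i ! b)) \<in> set (shifts (strand_complex gs) i)"
      unfolding strand_complex_def using b by auto
    then have "betti ?J i (card (fst (gs i ! b))) \<noteq> 0" using betti_nonzero_shifts[OF min] by blast
    then have "ereal (real (card (fst (gs i ! b))) - real i) \<le> regularity ?J"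
      unfolding regularity_def by (intro Sup_upper) blast
    then show ?thesis using d'(3) \<open>d' = d\<close> by simp
  qed
  then show ?thesis using us gs by blast
qed

text \<open>If no generator were adjacent to \<open>u\<close>, the linear syzygies would not involve \<open>u\<close>, and they
  could not generate the syzygy between \<open>u\<close> and \<open>v\<close>.\<close>

lemma linear_resolution_adjacent:
  fixes T :: "'v::finite set set"
  assumes card: "\<And>u. u \<in> T \<Longrightarrow> card u = d"
    and lin: "has_linear_resolution (ideal_gen (monomial ` expo ` T) :: ('v, 'k::field) mpoly set)"
    and uv: "u \<in> T" "v \<in> T" "u \<noteq> v"
  shows "\<exists>w\<in>T. w \<subseteq> u \<union> v \<and> card (w - u) = 1"
proof -
  obtain us and gs :: "nat \<Rightarrow> ('v, 'k) gens" where us: "distinct us" "set us = T" and gs0: "gs 0 = monomial_gens us"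
    and syz: "\<And>i. syz_gens (gs i) (gs (Suc i))" and deg: "\<And>i b. b < length (gs i) \<Longrightarrow> card (fst (gs i ! b)) \<le> d + i"
    using linear_resolution_strands[OF card _ lin] uv by blast
  let ?g = "monomial_gens us :: ('v, 'k) gens"
  obtain a0 where a0: "a0 < length us" "us ! a0 = u" using uv us by (metis in_set_conv_nth)
  obtain b0 where b0: "b0 < length us" "us ! b0 = v" using uv us by (metis in_set_conv_nth)
  have ab: "a0 \<noteq> b0" using a0 b0 uv by blast
  \<comment> \<open>The relation between u and v in the degree of their least common multiple; some
    generating syzygy has to involve u.\<close>
  define z where "z = (\<lambda>b. if b = a0 then 1 else if b = b0 then - 1 else (0::'k))"
  have "(\<Sum>b<length us. z b) = (\<Sum>b<length us. (if b = a0 then 1 else 0) + (if b = b0 then - 1 else 0))"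
    by (rule sum.cong) (use ab in \<open>auto simp: z_def\<close>)
  then have "(\<Sum>b<length us. z b) = 0" using a0 b0 by (simp add: sum.distrib)
  moreover have "z \<in> strand ?g (u \<union> v)" using a0 b0 unfolding strand_def z_def by auto
  ultimately have "z \<in> syz ?g (u \<union> v)" unfolding syz_monomial_gens by blast
  then obtain y where y: "y \<in> strand (gs 1) (u \<union> v)" "z = lincomb (gs 1) y"
    using syz[of 0] unfolding gs0 syz_gens_def gen_span_def by force
  have "z a0 \<noteq> 0" by (simp add: z_def)
  then obtain b where b: "b < length (gs 1)" "y b \<noteq> 0" "snd (gs 1 ! b) a0 \<noteq> 0"
    using lincomb_nonzero unfolding y(2) by blast
  let ?s = "fst (gs 1 ! b)" and ?c = "snd (gs 1 ! b)"
  have s: "?s \<subseteq> u \<union> v" using y(1) b unfolding strand_def by blast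
  have cs: "card ?s \<le> d + 1" using deg b by fastforce
  have c: "?c \<in> strand ?g ?s" "(\<Sum>b<length us. ?c b) = 0"
    using syz_gens_nth[OF syz[of 0]] b(1) unfolding gs0 syz_monomial_gens by auto
  have mem: "us ! a \<subseteq> ?s" if "?c a \<noteq> 0" for a
  proof -
    have "a < length ?g" "fst (?g ! a) \<subseteq> ?s" using c(1) that unfolding strand_def by blast+
    then show ?thesis by simp
  qed
  \<comment> \<open>The coefficients of a relation between monomials sum to zero, so u cannot occur
    alone. The second generator lies in the same degree of at most d + 1 variables.\<close>
  have "\<exists>a1<length us. a1 \<noteq> a0 \<and> ?c a1 \<noteq> 0"
  proof (rule ccontr)
    assume "\<not> ?thesis"
    then have "(\<Sum>b<length us. ?c b) = (\<Sum>b<length us. if b = a0 then ?c a0 else 0)" by (intro sum.cong) auto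
    then show False using c(2) a0(1) b(3) by simp
  qed
  then obtain a1 where a1: "a1 < length us" "a1 \<noteq> a0" "?c a1 \<noteq> 0" by blast
  let ?w = "us ! a1"
  have w: "?w \<in> T" "?w \<subseteq> ?s" "?w \<noteq> u" using a1 mem us a0 by (auto simp: nth_eq_iff_index_eq)
  have u: "u \<subseteq> ?s" using mem[OF b(3)] a0 by simp
  have "card (?s - u) \<le> 1" using cs u card[OF uv(1)] by (simp add: card_Diff_subset)
  moreover have "card (?w - u) \<le> card (?s - u)" using w by (intro card_mono) auto
  moreover have "?w - u \<noteq> {}"
    using w(1,3) card uv(1) by (metis Diff_eq_empty_iff card_subset_eq finite)
  ultimately have "card (?w - u) = 1" by (metis card_0_eq finite le_antisym le_trans less_one linorder_not_le)
  then show ?thesis using w s by blast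
qed

text \<open>Six generators whose linear syzygies form a hexagon: going once around the hexagon gives a
  relation between these syzygies which is not generated in linear degree.\<close>

lemma hexagon_not_linear:
  fixes T :: "'v::finite set set" and g :: "nat \<Rightarrow> 'v set"
  defines "nx \<equiv> \<lambda>i. Suc i mod 6"
  assumes card: "\<And>u. u \<in> T \<Longrightarrow> card u = d"
    and lin: "has_linear_resolution (ideal_gen (monomial ` expo ` T) :: ('v, 'k::field) mpoly set)"
    and gT: "\<And>i. i < 6 \<Longrightarrow> g i \<in> T" and inj: "inj_on g {..<6}"
    and edge: "\<And>i. i < 6 \<Longrightarrow> card (g i \<union> g (nx i)) = d + 1"
    and nonedge: "\<And>i j. i < 6 \<Longrightarrow> j < 6 \<Longrightarrow> i \<noteq> j \<Longrightarrow> card (g i \<union> g j) \<le> d + 1 \<Longrightarrow> j = nx i \<or> i = nx j"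
    and all: "\<And>w. w \<in> T \<Longrightarrow> w \<subseteq> (\<Union>i<6. g i) \<Longrightarrow> w \<in> g ` {..<6}"
    and big: "d + 2 < card (\<Union>i<6. g i)"
  shows False
proof -
  let ?W = "\<Union>i<6. g i"
  define E where "E i = g i \<union> g (nx i)" for i
  have nx_if: "nx i = (if i = 5 then 0 else Suc i)" if "i < 6" for i
    using that unfolding nx_def by (auto intro: mod_less)
  have nx6: "nx i < 6" for i unfolding nx_def by simp
  have nx_neq: "nx i \<noteq> i" and nx2: "nx (nx i) \<noteq> i" and nx3: "nx (nx (nx i)) \<noteq> i" if "i < 6" for i
    using that nx6[of i] nx6[of "nx i"] by (simp_all add: nx_if)
  have nx_inj: "i = j" if "i < 6" "j < 6" "nx i = nx j" for i j
    using that by (simp add: nx_if split: if_splits)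
  have nx_bij: "bij_betw nx {..<6} {..<6}"
    unfolding bij_betw_def
  proof
    show inj: "inj_on nx {..<6}" using nx_inj by (intro inj_onI) auto
    show "nx ` {..<6} = {..<6}" by (rule endo_inj_surj[OF _ _ inj]) (use nx6 in auto)
  qed
  have card_E: "card (E i) = d + 1" if "i < 6" for i using edge[OF that] unfolding E_def .
  \<comment> \<open>A further \<open>g j\<close> inside \<open>E i\<close> would be adjacent to both
    ends of the edge, but a hexagon contains no triangle.\<close>
  have sub_E: "j = i \<or> j = nx i" if i: "i < 6" and j: "j < 6" and sub: "g j \<subseteq> E i" for i j
  proof (rule ccontr)
    assume neq: "\<not> (j = i \<or> j = nx i)"
    have "card (g j \<union> g i) \<le> d + 1" "card (g j \<union> g (nx i)) \<le> d + 1"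
      using sub card_E[OF i] card_mono[of "E i" "g j \<union> g i"] card_mono[of "E i" "g j \<union> g (nx i)"]
      unfolding E_def by auto
    then have "(i = nx j \<or> j = nx i) \<and> (nx i = nx j \<or> j = nx (nx i))"
      using nonedge[of j i] nonedge[of j "nx i"] neq i j nx6 by auto
    then show False using neq nx_inj[OF i j] nx3[of i] i j by auto
  qed
  have E_inj: "i = j" if i: "i < 6" and j: "j < 6" and sub: "E i \<subseteq> E j" for i j
  proof -
    have "i = j \<or> i = nx j" "nx i = j \<or> nx i = nx j"
      using sub_E[OF j i] sub_E[OF j nx6] sub unfolding E_def by auto
    then show ?thesis using nx_inj[OF i j] nx2[OF j] by auto
  qed
  have "T \<noteq> {}" using gT[of 0] by auto
  obtain us and gs :: "nat \<Rightarrow> ('v, 'k) gens" where us: "distinct us" "set us = T" and gs0: "gs 0 = monomial_gens us"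
    and syz: "\<And>i. syz_gens (gs i) (gs (Suc i))" and deg: "\<And>i b. b < length (gs i) \<Longrightarrow> card (fst (gs i ! b)) \<le> d + i"
    using linear_resolution_strands[OF card \<open>T \<noteq> {}\<close> lin] by blast
  have "\<exists>a<length us. us ! a = g i" if "i < 6" for i using gT[OF that] us(2) by (metis in_set_conv_nth)
  then obtain ix where ix: "\<And>i. i < 6 \<Longrightarrow> ix i < length us" "\<And>i. i < 6 \<Longrightarrow> us ! ix i = g i" by metis
  have ix_inj: "i = j" if "i < 6" "j < 6" "ix i = ix j" for i j
    using inj ix(2)[of i] ix(2)[of j] that unfolding inj_on_def by simp
  let ?g1 = "gs 1"
  have c: "snd (?g1 ! b) \<in> strand (monomial_gens us) (fst (?g1 ! b))" "(\<Sum>a<length us. snd (?g1 ! b) a) = 0"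
    if "b < length ?g1" for b
    using syz_gens_nth[OF syz[of 0]] that unfolding gs0 syz_monomial_gens by auto
  have mem: "us ! a \<subseteq> fst (?g1 ! b) \<and> a < length us" if "b < length ?g1" "snd (?g1 ! b) a \<noteq> 0" for a b
  proof -
    have "a < length (monomial_gens us :: ('v, 'k) gens)"
      "fst (monomial_gens us ! a :: 'v set \<times> (nat \<Rightarrow> 'k)) \<subseteq> fst (?g1 ! b)"
      using c(1)[OF that(1)] that(2) unfolding strand_def by blast+
    then show ?thesis by simp
  qed
  have mem_ix: "\<exists>j<6. a = ix j \<and> g j \<subseteq> fst (?g1 ! b)"
    if b: "b < length ?g1" "fst (?g1 ! b) \<subseteq> ?W" "snd (?g1 ! b) a \<noteq> 0" for a b
  proof -
    have a: "a < length us" "us ! a \<subseteq> fst (?g1 ! b)" using mem b by auto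
    have "us ! a \<in> g ` {..<6}" using all[of "us ! a"] a b(2) us(2) nth_mem by blast
    then obtain j where j: "j < 6" "us ! a = g j" by auto
    then have "a = ix j" using nth_eq_iff_index_eq[OF us(1) a(1) ix(1)[OF j(1)]] j ix(2)[OF j(1)] by simp
    then show ?thesis using j a by auto
  qed
  have coeff: "fst (?g1 ! b) = E i \<or> (\<exists>j<6. nx j = i \<and> fst (?g1 ! b) = E j)"
    if b: "b < length ?g1" "fst (?g1 ! b) \<subseteq> ?W" and i: "i < 6" and nz: "snd (?g1 ! b) (ix i) \<noteq> 0" for b i
  proof -
    let ?s = "fst (?g1 ! b)"
    have cs: "card ?s \<le> d + 1" using deg[of b 1] b by simp
    have gi: "g i \<subseteq> ?s" using mem[OF b(1) nz] ix(2)[OF i] by simp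
    have "\<exists>a1<length us. a1 \<noteq> ix i \<and> snd (?g1 ! b) a1 \<noteq> 0"
    proof (rule ccontr)
      assume "\<not> ?thesis"
      then have "(\<Sum>a<length us. snd (?g1 ! b) a) = (\<Sum>a<length us. if a = ix i then snd (?g1 ! b) (ix i) else 0)"
        by (intro sum.cong) auto
      then show False using c(2)[OF b(1)] ix(1)[OF i] nz by simp
    qed
    then obtain j where j: "j < 6" "g j \<subseteq> ?s" "j \<noteq> i" using mem_ix[OF b] by blast
    have "card (g i \<union> g j) \<le> d + 1" using card_mono[of ?s "g i \<union> g j"] gi j(2) cs by auto
    then consider "j = nx i" | "i = nx j" using nonedge i j by metis
    then show ?thesis
    proof cases
      case 1
      then have "E i \<subseteq> ?s" using gi j(2) unfolding E_def by auto
      then have "E i = ?s" using card_seteq[of ?s "E i"] cs card_E[OF i] by auto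
      then show ?thesis by simp
    next
      case 2
      then have "E j \<subseteq> ?s" using gi j(2) unfolding E_def by auto
      then have "E j = ?s" using card_seteq[of ?s "E j"] cs card_E[OF j(1)] by auto
      then show ?thesis using 2 j(1) by auto
    qed
  qed
  have E_W: "E i \<subseteq> ?W" if "i < 6" for i using that nx6 unfolding E_def by blast
  \<comment> \<open>Every generating relation of degree \<open>E i\<close> is a multiple of the edge
    relation between i and \<open>nx i\<close>, so this sum is the total weight with which z uses
    edge i.\<close>
  define L where "L i z = (\<Sum>b | b < length ?g1 \<and> fst (?g1 ! b) = E i. z b * snd (?g1 ! b) (ix i))" for i and z :: "nat \<Rightarrow> 'k"
  have anti: "snd (?g1 ! b) (ix (nx i)) = - snd (?g1 ! b) (ix i)"
    if b: "b < length ?g1" "fst (?g1 ! b) = E i" and i: "i < 6" for b i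
  proof -
    have "snd (?g1 ! b) a = 0" if "a < length us" "a \<noteq> ix i" "a \<noteq> ix (nx i)" for a
    proof (rule ccontr)
      assume "snd (?g1 ! b) a \<noteq> 0"
      then obtain j where "j < 6" "a = ix j" "g j \<subseteq> E i" using mem_ix[OF b(1)] b(2) E_W[OF i] by metis
      then show False using sub_E[OF i] that by blast
    qed
    then have "(\<Sum>a<length us. snd (?g1 ! b) a) = (\<Sum>a<length us. (if a = ix i then snd (?g1 ! b) (ix i) else 0) +
        (if a = ix (nx i) then snd (?g1 ! b) (ix (nx i)) else 0))"
      using ix_inj[OF i nx6[of i]] nx_neq[OF i] by (intro sum.cong) auto
    then have "snd (?g1 ! b) (ix i) + snd (?g1 ! b) (ix (nx i)) = 0"
      using c(2)[OF b(1)] ix(1)[OF i] ix(1)[OF nx6] by (simp add: sum.distrib)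
    then show ?thesis by (metis add.commute eq_neg_iff_add_eq_0)
  qed
  have comb: "lincomb ?g1 z (ix (nx i)) = L (nx i) z - L i z" if z: "z \<in> strand ?g1 ?W" and i: "i < 6" for z i
  proof -
    let ?f = "\<lambda>b. z b * snd (?g1 ! b) (ix (nx i))"
    let ?A = "{b. b < length ?g1 \<and> fst (?g1 ! b) = E (nx i)}" and ?B = "{b. b < length ?g1 \<and> fst (?g1 ! b) = E i}"
    have "?f b = 0" if b: "b < length ?g1" "b \<notin> ?A \<union> ?B" for b
    proof (rule ccontr)
      assume nz: "?f b \<noteq> 0"
      then have "fst (?g1 ! b) \<subseteq> ?W" using z unfolding strand_def by auto
      then have "fst (?g1 ! b) = E (nx i) \<or> (\<exists>j<6. nx j = nx i \<and> fst (?g1 ! b) = E j)"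
        using coeff[OF b(1) _ nx6[of i]] nz by auto
      then show False using b nx_inj[OF _ i] by auto
    qed
    then have "lincomb ?g1 z (ix (nx i)) = sum ?f (?A \<union> ?B)"
      unfolding lincomb_def by (intro sum.mono_neutral_right) auto
    also have "\<dots> = sum ?f ?A + sum ?f ?B"
      using E_inj[OF nx6[of i] i] nx_neq[OF i] by (intro sum.union_disjoint) auto
    also have "sum ?f ?B = - L i z"
      unfolding L_def sum_negf[symmetric] using anti i by (intro sum.cong) auto
    finally show ?thesis unfolding L_def by simp
  qed
  \<comment> \<open>In a closed combination consecutive edges carry equal weights, because the
    difference is the coefficient at their common vertex. A degree short of the full union misses an
    edge, so the common weight is zero.\<close>
  have L_zero: "L 0 z = 0" if z: "z \<in> syz ?g1 s" and s: "s \<subseteq> ?W" "s \<noteq> ?W" for z s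
  proof -
    have zs: "z \<in> strand ?g1 s" "lincomb ?g1 z = (\<lambda>_. 0)" using z unfolding syz_def by auto
    have Lnx: "L (nx i) z = L i z" if "i < 6" for i
      using comb[OF _ that, of z] zs strand_mono[OF s(1), of ?g1] by (simp add: subset_iff)
    have "L (Suc i) z = L i z" if "i < 5" for i
      using Lnx[of i] nx_if[of i] that by simp
    then have const: "L i z = L 0 z" if "i < 6" for i using that
      by (induction i) auto
    have "\<exists>i<6. \<not> E i \<subseteq> s"
    proof (rule ccontr)
      assume "\<not> ?thesis"
      then have "?W \<subseteq> s" unfolding E_def by blast
      then show False using s by blast
    qed
    then obtain i where i: "i < 6" "\<not> E i \<subseteq> s" by blast
    have "L i z = 0" unfolding L_def
      by (rule sum.neutral) (use zs(1) i(2) in \<open>auto simp: strand_def\<close>)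
    then show ?thesis using const[OF i(1)] by simp
  qed
  \<comment> \<open>The second syzygies are generated in degrees of at most d + 2 variables, hence
    in proper subsets of the union, where the weight vanishes. As the weight is linear, it vanishes
    in the full degree too.\<close>
  have L_zero_W: "L 0 z = 0" if z: "z \<in> syz ?g1 ?W" for z
  proof -
    obtain y where y: "y \<in> strand (gs 2) ?W" "z = lincomb (gs 2) y"
      using z syz[of 1] unfolding syz_gens_def gen_span_def numeral_2_eq_2 by auto
    have "y b * L 0 (snd (gs 2 ! b)) = 0" if b: "b < length (gs 2)" for b
    proof (cases "y b = 0")
      case False
      then have sub: "fst (gs 2 ! b) \<subseteq> ?W" using y(1) unfolding strand_def by blast
      moreover have "fst (gs 2 ! b) \<noteq> ?W" using deg[OF b] big by auto
      moreover have "snd (gs 2 ! b) \<in> syz ?g1 (fst (gs 2 ! b))"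
        using syz_gens_nth[OF syz[of 1]] b by (simp add: numeral_2_eq_2)
      ultimately show ?thesis using L_zero by simp
    qed simp
    then have "(\<Sum>b<length (gs 2). y b * L 0 (snd (gs 2 ! b))) = 0" by (intro sum.neutral) auto
    moreover have "L 0 z = (\<Sum>b<length (gs 2). y b * L 0 (snd (gs 2 ! b)))"
      unfolding y(2) L_def lincomb_def sum_distrib_left sum_distrib_right
      by (subst sum.swap) (simp add: mult.assoc)
    ultimately show ?thesis by simp
  qed
  define r where "r i = (\<lambda>a. if a = ix i then 1 else if a = ix (nx i) then - 1 else (0::'k))" for i
  have "\<exists>y. y \<in> strand ?g1 (E i) \<and> r i = lincomb ?g1 y" if i: "i < 6" for i
  proof -
    have neq: "ix i \<noteq> ix (nx i)" using ix_inj[OF i nx6[of i]] nx_neq[OF i] by auto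
    have "(\<Sum>a<length us. r i a) = (\<Sum>a<length us. (if a = ix i then 1 else 0) + (if a = ix (nx i) then - 1 else 0))"
      by (rule sum.cong) (use neq in \<open>auto simp: r_def\<close>)
    then have "(\<Sum>a<length us. r i a) = 0" using ix(1)[OF i] ix(1)[OF nx6] by (simp add: sum.distrib)
    moreover have "r i \<in> strand (monomial_gens us) (E i)"
      using ix[OF i] ix[OF nx6[of i]] unfolding strand_def r_def E_def by auto
    ultimately have "r i \<in> syz (monomial_gens us) (E i)" unfolding syz_monomial_gens by blast
    then show ?thesis using syz[of 0] unfolding gs0 syz_gens_def gen_span_def by force
  qed
  then have "\<forall>i. \<exists>y. i < 6 \<longrightarrow> y \<in> strand ?g1 (E i) \<and> r i = lincomb ?g1 y" by simp
  from choice[OF this] obtain y where "\<forall>i. i < 6 \<longrightarrow> y i \<in> strand ?g1 (E i) \<and> r i = lincomb ?g1 (y i)" ..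
  then have y: "\<And>i. i < 6 \<Longrightarrow> y i \<in> strand ?g1 (E i)" "\<And>i. i < 6 \<Longrightarrow> r i = lincomb ?g1 (y i)" by simp_all
  \<comment> \<open>Once around the hexagon: the edge relations telescope to zero, although edge 0
    will turn out to carry weight 1.\<close>
  define z where "z = (\<lambda>b. \<Sum>i<6. y i b)"
  have "lincomb ?g1 z a = (\<Sum>i<6. lincomb ?g1 (y i) a)" for a
    unfolding lincomb_def z_def sum_distrib_right by (rule sum.swap)
  then have "lincomb ?g1 z a = (\<Sum>i<6. r i a)" for a using y(2) by simp
  moreover have "(\<Sum>i<6. r i a) = 0" for a
  proof -
    have "r i a = (if a = ix i then 1 else 0) - (if a = ix (nx i) then 1 else 0)" if "i < 6" for i
      using ix_inj[OF that nx6[of i]] nx_neq[OF that] unfolding r_def by auto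
    then have "(\<Sum>i<6. r i a) = (\<Sum>i<6. if a = ix i then 1 else 0) - (\<Sum>i<6. if a = ix (nx i) then 1 else (0::'k))"
      by (simp add: sum_subtractf)
    moreover have "(\<Sum>i<6. if a = ix (nx i) then 1 else (0::'k)) = (\<Sum>i<6. if a = ix i then 1 else 0)"
      using sum.reindex_bij_betw[OF nx_bij, of "\<lambda>i. if a = ix i then 1 else (0::'k)"] .
    ultimately show ?thesis by simp
  qed
  moreover have "z \<in> strand ?g1 ?W"
    unfolding strand_def
  proof (intro CollectI allI impI)
    fix b assume "z b \<noteq> 0"
    then obtain i where "i \<in> {..<6}" "y i b \<noteq> 0"
      unfolding z_def by (rule sum.not_neutral_contains_not_neutral)
    then show "b < length ?g1 \<and> fst (?g1 ! b) \<subseteq> ?W" using y(1)[of i] E_W[of i] unfolding strand_def by auto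
  qed
  ultimately have "z \<in> syz ?g1 ?W" unfolding syz_def by auto
  then have "L 0 z = 0" by (rule L_zero_W)
  moreover have "L 0 z = (\<Sum>i<6. L 0 (y i))"
    unfolding L_def z_def sum_distrib_right by (rule sum.swap)
  moreover have Ly: "L 0 (y i) = 0" if "i < 6" "i \<noteq> 0" for i
    unfolding L_def
  proof (rule sum.neutral, rule ballI)
    fix b assume b: "b \<in> {b. b < length ?g1 \<and> fst (?g1 ! b) = E 0}"
    have "\<not> E 0 \<subseteq> E i" using E_inj[of 0 i] that by auto
    then show "y i b * snd (?g1 ! b) (ix 0) = 0" using y(1)[OF that(1)] b unfolding strand_def by auto
  qed
  moreover have "(\<Sum>i<6. L 0 (y i)) = (\<Sum>i<(6::nat). if i = 0 then L 0 (y 0) else 0)"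
    by (rule sum.cong) (use Ly in auto)
  ultimately have L0: "L 0 (y 0) = 0" by simp
  \<comment> \<open>Within degree \<open>E 0\<close> only relations of that very degree can
    contribute at vertex 0, so the weight on edge 0 is the coefficient 1 of \<open>r 0\<close>
    there.\<close>
  have "lincomb ?g1 (y 0) (ix 0) = L 0 (y 0)"
    unfolding lincomb_def L_def
  proof (rule sum.mono_neutral_right)
    show "\<forall>b\<in>{..<length ?g1} - {b. b < length ?g1 \<and> fst (?g1 ! b) = E 0}. y 0 b * snd (?g1 ! b) (ix 0) = 0"
    proof (intro ballI, rule ccontr)
      fix b assume b: "b \<in> {..<length ?g1} - {b. b < length ?g1 \<and> fst (?g1 ! b) = E 0}"
        and nz: "y 0 b * snd (?g1 ! b) (ix 0) \<noteq> 0"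
      then have sub: "fst (?g1 ! b) \<subseteq> E 0" using y(1)[of 0] unfolding strand_def by auto
      then have "fst (?g1 ! b) = E 0 \<or> (\<exists>j<6. nx j = 0 \<and> fst (?g1 ! b) = E j)"
        using coeff[of b 0] b nz E_W[of 0] by auto
      then obtain j where "j < 6" "nx j = 0" "E j \<subseteq> E 0" using b sub by auto
      then show False using E_inj[of j 0] nx_neq[of 0] by auto
    qed
  qed auto
  moreover have "lincomb ?g1 (y 0) (ix 0) = 1" using y(2)[of 0, symmetric] by (simp add: r_def)
  ultimately show False using L0 by simp
qed

section \<open>Paths in forests\<close>

lemma adj_sym: "adj G u v \<longleftrightarrow> adj G v u"
  by (simp add: insert_commute)

lemma adj_neq: "simple_graph G \<Longrightarrow> adj G u v \<Longrightarrow> u \<noteq> v"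
  unfolding simple_graph_def by fastforce

lemma adj_verts: "simple_graph G \<Longrightarrow> adj G u v \<Longrightarrow> u \<in> verts G \<and> v \<in> verts G"
  unfolding simple_graph_def by fastforce

lemma is_path_rev [simp]: "is_path G (rev p) \<longleftrightarrow> is_path G p"
  unfolding is_path_def by (simp add: successively_rev adj_sym)

lemma is_path_append:
  "p \<noteq> [] \<Longrightarrow> q \<noteq> [] \<Longrightarrow> is_path G (p @ q) \<longleftrightarrow>
    is_path G p \<and> is_path G q \<and> set p \<inter> set q = {} \<and> adj G (last p) (hd q)"
  unfolding is_path_def by (auto simp: successively_append_iff)

lemma is_path_appendD1: "is_path G (p @ q) \<Longrightarrow> p \<noteq> [] \<Longrightarrow> is_path G p"
  using is_path_append[of p q G] by (cases "q = []") auto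

lemma is_path_appendD2: "is_path G (p @ q) \<Longrightarrow> q \<noteq> [] \<Longrightarrow> is_path G q"
  using is_path_append[of p q G] by (cases "p = []") auto

lemma is_path_singleton [simp]: "is_path G [x] \<longleftrightarrow> x \<in> verts G"
  unfolding is_path_def by auto

lemma is_path_Cons:
  "q \<noteq> [] \<Longrightarrow> is_path G (x # q) \<longleftrightarrow> x \<in> verts G \<and> is_path G q \<and> x \<notin> set q \<and> adj G x (hd q)"
  using is_path_append[of "[x]" q G] by auto

lemma is_path_nth_adj: "is_path G p \<Longrightarrow> Suc i < length p \<Longrightarrow> adj G (p ! i) (p ! Suc i)"
  unfolding is_path_def by (simp add: successively_conv_nth)

text \<open>Common first vertices are stripped by induction. Where the paths diverge, at x, the
  first later vertex of p that lies on q closes a cycle through x.\<close>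

lemma path_unique:
  assumes "\<nexists>c. is_cycle G c"
    and "is_path G p" "is_path G q" "hd p = hd q" "last p = last q"
  shows "p = q"
  using assms(2-)
proof (induction p arbitrary: q)
  case Nil
  then show ?case by (simp add: is_path_def)
next
  case (Cons x p')
  obtain q' where q: "q = x # q'" using Cons.prems by (cases q) (auto simp: is_path_def)
  have xp: "x \<notin> set p'" and xq: "x \<notin> set q'" using Cons.prems q unfolding is_path_def by auto
  show ?case
  proof (cases "p' = [] \<or> q' = []")
    case True
    then show ?thesis using Cons.prems(4) q xp xq by (metis last.simps last_in_set)
  next
    case False
    then have ne: "p' \<noteq> []" "q' \<noteq> []" by auto
    have P: "is_path G p'" "is_path G q'" "adj G x (hd p')" "adj G x (hd q')" "x \<in> verts G"
      using Cons.prems q ne by (auto simp: is_path_Cons)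
    have last: "last p' = last q'" using Cons.prems(4) q ne by simp
    show ?thesis
    proof (cases "hd p' = hd q'")
      case True
      then show ?thesis using Cons.IH[OF P(1,2) True last] q by simp
    next
      case hd: False
      have "\<exists>y\<in>set p'. y \<in> set q'" using last ne by (metis last_in_set)
      then obtain A y B where A: "p' = A @ y # B" "y \<in> set q'" "\<forall>z\<in>set A. z \<notin> set q'"
        using split_list_first_prop[of p' "\<lambda>y. y \<in> set q'"] by blast
      obtain C D where C: "q' = C @ y # D" "y \<notin> set C" using split_list_first[OF A(2)] by blast
      have "is_path G ((x # A @ [y]) @ B)" using Cons.prems(1) A(1) by simp
      then have xAy: "is_path G (x # A @ [y])" using is_path_appendD1 by blast
      have "is_path G ((C @ [y]) @ D)" using P(2) C(1) by simp
      then have Cy: "is_path G (C @ [y])" using is_path_appendD1 by blast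
      have "is_cycle G (x # A @ [y] @ rev C)"
      proof (cases "C = []")
        case True
        have "A \<noteq> []" using hd A(1) C(1) True by auto
        then have "3 \<le> length (x # A @ [y])" by (cases A) auto
        then show ?thesis using xAy P(4) C True unfolding is_cycle_def by (simp add: adj_sym)
      next
        case C0: False
        have "is_path G ((x # A @ [y]) @ rev C)"
        proof (subst is_path_append)
          show "is_path G (x # A @ [y]) \<and> is_path G (rev C) \<and> set (x # A @ [y]) \<inter> set (rev C) = {} \<and>
              adj G (last (x # A @ [y])) (hd (rev C))"
            using xAy Cy C0 C A xq is_path_append[of C "[y]" G] by (auto simp: adj_sym hd_rev)
        qed (use C0 in auto)
        moreover have "3 \<le> length (x # A @ [y] @ rev C)" using C0 by (cases C) auto
        moreover have "last (x # A @ [y] @ rev C) = hd q'" using C0 C(1) by (simp add: last_rev)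
        ultimately show ?thesis using P(4) unfolding is_cycle_def by (simp add: adj_sym)
      qed
      then show ?thesis using assms(1) by blast
    qed
  qed
qed

section \<open>Connectivity within a vertex set\<close>

definition joined :: "'a graph \<Rightarrow> 'a set \<Rightarrow> 'a \<Rightarrow> 'a \<Rightarrow> bool" where
  "joined G S u v \<longleftrightarrow> (\<exists>p. is_path G p \<and> hd p = u \<and> last p = v \<and> set p \<subseteq> S)"

lemma joined_refl: "u \<in> verts G \<Longrightarrow> u \<in> S \<Longrightarrow> joined G S u u"
  unfolding joined_def by (intro exI[of _ "[u]"]) auto

lemma joined_sym: "joined G S u v \<Longrightarrow> joined G S v u"
  unfolding joined_def
proof (elim exE conjE)
  fix p assume "is_path G p" "hd p = u" "last p = v" "set p \<subseteq> S"
  then show "\<exists>p. is_path G p \<and> hd p = v \<and> last p = u \<and> set p \<subseteq> S"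
    by (intro exI[of _ "rev p"]) (auto simp: hd_rev last_rev is_path_def[of G p])
qed

text \<open>If w already lies on the path, cutting the path at w avoids a repetition; so connections
  can be composed without a separate notion of walks.\<close>

lemma joined_step:
  assumes "joined G S u v" "adj G v w" "w \<in> S" "w \<in> verts G"
  shows "joined G S u w"
proof -
  obtain p where p: "is_path G p" "hd p = u" "last p = v" "set p \<subseteq> S" using assms(1) unfolding joined_def by blast
  then have ne: "p \<noteq> []" unfolding is_path_def by blast
  show ?thesis
  proof (cases "w \<in> set p")
    case True
    then obtain A B where AB: "p = A @ w # B" by (meson split_list)
    have "is_path G ((A @ [w]) @ B)" using p(1) AB by simp
    then have "is_path G (A @ [w])" using is_path_appendD1 by blast
    moreover have "hd (A @ [w]) = u" using p(2) AB by (cases A) auto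
    ultimately show ?thesis unfolding joined_def using p(4) AB by (intro exI[of _ "A @ [w]"]) auto
  next
    case False
    then have "is_path G (p @ [w])" using p assms ne by (subst is_path_append) auto
    then show ?thesis unfolding joined_def using p assms ne by (intro exI[of _ "p @ [w]"]) auto
  qed
qed

lemma joined_trans:
  assumes "joined G S u v" "joined G S v w"
  shows "joined G S u w"
proof -
  obtain q where q: "is_path G q" "hd q = v" "last q = w" "set q \<subseteq> S" using assms(2) unfolding joined_def by blast
  have "joined G S u (last q)" using q(1,2,4) assms(1)
  proof (induction q arbitrary: v)
    case Nil
    then show ?case by (simp add: is_path_def)
  next
    case (Cons x q)
    show ?case
    proof (cases "q = []")
      case True
      then show ?thesis using Cons.prems by simp
    next
      case False
      then have "is_path G q" "adj G x (hd q)" using Cons.prems(1) by (auto simp: is_path_Cons)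
      moreover from this have "hd q \<in> S" "hd q \<in> verts G" using False Cons.prems(3)
        by (auto simp: is_path_def subset_iff)
      ultimately have "joined G S u (hd q)" using Cons.prems joined_step[of G S u x "hd q"] by simp
      then show ?thesis using Cons.IH[OF \<open>is_path G q\<close> refl] Cons.prems(3) False by auto
    qed
  qed
  then show ?thesis using q by simp
qed

lemma joined_mono: "joined G S u v \<Longrightarrow> S \<subseteq> S' \<Longrightarrow> joined G S' u v"
  unfolding joined_def by blast

lemma joined_path_hd: 
  assumes "is_path G p" "v \<in> set p" shows "joined G (set p) (hd p) v"
proof -
  obtain A B where AB: "p = A @ v # B" using assms(2) by (meson split_list)
  have "is_path G ((A @ [v]) @ B)" using assms(1) AB by simp
  then have "is_path G (A @ [v])" using is_path_appendD1 by blast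
  moreover have "hd (A @ [v]) = hd p" using AB by (cases A) auto
  ultimately show ?thesis unfolding joined_def using AB by (intro exI[of _ "A @ [v]"]) auto
qed

lemma joined_path: "is_path G p \<Longrightarrow> u \<in> set p \<Longrightarrow> v \<in> set p \<Longrightarrow> joined G (set p) u v"
  using joined_path_hd joined_sym joined_trans by metis

text \<open>A connection inside S is itself a path with the same ends, hence it is p. This is how
  later a detour off p is shown to contain a stretch of p.\<close>

lemma joined_unique_path:
  assumes "\<nexists>c. is_cycle G c" "joined G S (hd p) (last p)" "is_path G p"
  shows "set p \<subseteq> S"
  using assms path_unique unfolding joined_def by metis

lemma path_adjacent_length:
  assumes "\<nexists>c. is_cycle G c" "is_path G p" "adj G (hd p) (last p)" "simple_graph G"
  shows "length p = 2"
proof -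
  have "is_path G [hd p, last p]"
    using assms(3,4) adj_neq[OF assms(4,3)] adj_verts[OF assms(4,3)] by (simp add: is_path_def)
  then have "p = [hd p, last p]" using path_unique[OF assms(1,2)] by simp
  then show ?thesis by (metis length_Cons list.size(3) numeral_2_eq_2)
qed

lemma path_segment:
  assumes "is_path G p" "i \<le> j" "j < length p"
  shows "is_path G (map ((!) p) [i..<Suc j])"
proof -
  have "map ((!) p) [i..<Suc j] = take (Suc j - i) (drop i p)"
    using assms by (intro nth_equalityI) (auto simp del: upt_Suc)
  moreover have "is_path G (drop i p)"
    using is_path_appendD2[of G "take i p" "drop i p"] assms by simp
  moreover have "is_path G (take (Suc j - i) (drop i p))"
  proof (rule is_path_appendD1)
    show "is_path G (take (Suc j - i) (drop i p) @ drop (Suc j - i) (drop i p))"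
      using calculation(2) by (simp only: append_take_drop_id)
  qed (use assms in simp)
  ultimately show ?thesis by simp
qed

lemma path_adj_iff:
  assumes "\<nexists>c. is_cycle G c" "simple_graph G" "is_path G p" "i < length p" "j < length p"
  shows "adj G (p ! i) (p ! j) \<longleftrightarrow> i = Suc j \<or> j = Suc i"
proof -
  have *: "j = Suc i" if "i < j" "j < length p" "adj G (p ! i) (p ! j)" for i j
  proof -
    let ?q = "map ((!) p) [i..<Suc j]"
    have "is_path G ?q" using path_segment[OF assms(3), of i j] that by simp
    moreover have "hd ?q = p ! i" "last ?q = p ! j" using that by (auto simp: hd_map last_map simp del: upt_Suc) 
    ultimately have "length ?q = 2" using path_adjacent_length[OF assms(1) _ _ assms(2), of ?q] that by simp
    then show ?thesis using that by simp
  qed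
  show ?thesis
  proof
    assume a: "adj G (p ! i) (p ! j)"
    then have "i \<noteq> j" using adj_neq[OF assms(2)] by blast
    then show "i = Suc j \<or> j = Suc i" using *[of i j] *[of j i] a assms by (metis adj_sym linorder_neqE_nat)
  next
    assume "i = Suc j \<or> j = Suc i"
    then show "adj G (p ! i) (p ! j)" using is_path_nth_adj[OF assms(3)] assms by (metis adj_sym)
  qed
qed

section \<open>Induced subgraphs of forests\<close>

lemma contains_inducedI:
  assumes "inj_on f (verts H)" "f ` verts H \<subseteq> verts G"
    and "\<And>u v. u \<in> verts H \<Longrightarrow> v \<in> verts H \<Longrightarrow> adj H u v \<longleftrightarrow> adj G (f u) (f v)"
  shows "contains_induced G H"
proof -
  let ?W = "f ` verts H" and ?g = "the_inv_into (verts H) f"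
  have "bij_betw ?g ?W (verts H)" using assms(1) by (simp add: bij_betw_the_inv_into inj_on_imp_bij_betw)
  moreover have "adj (induced_subgraph G ?W) u v \<longleftrightarrow> adj H (?g u) (?g v)" if "u \<in> ?W" "v \<in> ?W" for u v
    using that assms(3) by (auto simp: induced_subgraph_def the_inv_into_f_f[OF assms(1)])
  moreover have "verts (induced_subgraph G ?W) = ?W" by (simp add: induced_subgraph_def)
  ultimately have "graph_iso (induced_subgraph G ?W) H" unfolding graph_iso_def by (intro exI[of _ ?g]) simp
  then show ?thesis unfolding contains_induced_def using assms(2) by blast
qed

lemma contains_inducedD:
  assumes "contains_induced G H"
  shows "\<exists>f. inj_on f (verts H) \<and> f ` verts H \<subseteq> verts G \<and>
    (\<forall>u\<in>verts H. \<forall>v\<in>verts H. adj H u v \<longleftrightarrow> adj G (f u) (f v))"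
proof -
  obtain W g where W: "W \<subseteq> verts G" and g: "bij_betw g W (verts H)"
    and adj: "\<And>u v. u \<in> W \<Longrightarrow> v \<in> W \<Longrightarrow> adj (induced_subgraph G W) u v \<longleftrightarrow> adj H (g u) (g v)"
    using assms unfolding contains_induced_def graph_iso_def by (auto simp: induced_subgraph_def)
  let ?f = "the_inv_into W g"
  have f: "bij_betw ?f (verts H) W" using g by (rule bij_betw_the_inv_into)
  have gf: "g (?f u) = u" if "u \<in> verts H" for u
    using f_the_inv_into_f_bij_betw[OF g] that by auto
  have fW: "?f u \<in> W" if "u \<in> verts H" for u using f that unfolding bij_betw_def by auto
  have "adj H u v \<longleftrightarrow> adj G (?f u) (?f v)" if "u \<in> verts H" "v \<in> verts H" for u v
    using adj[OF fW[OF that(1)] fW[OF that(2)]] gf that fW by (simp add: induced_subgraph_def)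
  then show ?thesis using f W unfolding bij_betw_def by (intro exI[of _ ?f]) auto
qed

text \<open>In a forest an embedding of a connected graph is induced: an additional edge would close a cycle.\<close>

lemma contains_induced_connected:
  assumes "\<nexists>c. is_cycle G c" "simple_graph G" "simple_graph H"
    and inj: "inj_on f (verts H)" and sub: "f ` verts H \<subseteq> verts G"
    and hom: "\<And>u v. u \<in> verts H \<Longrightarrow> v \<in> verts H \<Longrightarrow> adj H u v \<Longrightarrow> adj G (f u) (f v)"
    and conn: "\<And>v. v \<in> verts H \<Longrightarrow> joined H (verts H) r v"
  shows "contains_induced G H"
proof (rule contains_inducedI[OF inj sub])
  fix u v assume uv: "u \<in> verts H" "v \<in> verts H"
  show "adj H u v \<longleftrightarrow> adj G (f u) (f v)"
  proof
    assume a: "adj G (f u) (f v)"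
    have "joined H (verts H) u v" using conn uv joined_sym joined_trans by metis
    then obtain p where p: "is_path H p" "hd p = u" "last p = v" unfolding joined_def by blast
    have ne: "p \<noteq> []" and ps: "set p \<subseteq> verts H" using p unfolding is_path_def by auto
    have "is_path G (map f p)"
      unfolding is_path_def
    proof (intro conjI)
      show "distinct (map f p)" using p(1) inj_on_subset[OF inj ps] unfolding is_path_def by (simp add: distinct_map)
      show "successively (adj G) (map f p)"
        unfolding successively_map
        by (rule successively_mono[of "adj H"]) (use p(1) ps hom in \<open>auto simp: is_path_def\<close>)
    qed (use ne ps sub in auto)
    then have "length (map f p) = 2"
      using path_adjacent_length[OF assms(1) _ _ assms(2), of "map f p"] a p ne by (simp add: hd_map last_map)
    then obtain x y where "p = [x, y]" by (auto simp: length_Suc_conv numeral_2_eq_2)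
    then show "adj H u v" using p unfolding is_path_def by simp
  qed (use hom uv in blast)
qed

text \<open>Here inducedness matters: all paths of G within the image come from H, so no generator
  dividing the relevant least common multiple is overlooked.\<close>

lemma path_pullback:
  assumes inj: "inj_on f (verts H)"
    and adj: "\<And>u v. u \<in> verts H \<Longrightarrow> v \<in> verts H \<Longrightarrow> adj H u v \<longleftrightarrow> adj G (f u) (f v)"
    and q: "is_path G q" "set q \<subseteq> f ` verts H"
  obtains h where "is_path H h" "q = map f h"
proof -
  have "\<exists>h. q = map f h \<and> set h \<subseteq> verts H" using q(2)
  proof (induction q)
    case (Cons x q)
    then obtain h z where "q = map f h" "set h \<subseteq> verts H" "z \<in> verts H" "x = f z" by auto
    then show ?case by (intro exI[of _ "z # h"]) auto
  qed auto
  then obtain h where h: "q = map f h" "set h \<subseteq> verts H" by blast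
  have "successively (\<lambda>u v. adj G (f u) (f v)) h"
    using q(1) h unfolding is_path_def by (simp add: successively_map)
  then have "successively (adj H) h"
    by (rule successively_mono) (use h(2) adj in auto)
  then have "is_path H h" using q(1) h unfolding is_path_def by (auto simp: distinct_map)
  then show ?thesis using that h by blast
qed

lemma path_image:
  assumes inj: "inj_on f (verts H)" and "f ` verts H \<subseteq> verts G"
    and adj: "\<And>u v. u \<in> verts H \<Longrightarrow> v \<in> verts H \<Longrightarrow> adj H u v \<longleftrightarrow> adj G (f u) (f v)"
    and h: "is_path H h"
  shows "is_path G (map f h)"
proof -
  have hs: "set h \<subseteq> verts H" using h unfolding is_path_def by blast
  have "successively (adj G) (map f h)" unfolding successively_map
    by (rule successively_mono[of "adj H"]) (use h hs adj in \<open>auto simp: is_path_def\<close>)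
  then show ?thesis using h hs assms(2) inj_on_subset[OF inj hs] unfolding is_path_def by (auto simp: distinct_map)
qed

text \<open>Applied with c naming the components of a graph: a path stays within one
  component.\<close>

lemma successively_const:
  assumes "successively R h" "\<And>x y. x \<in> set h \<Longrightarrow> y \<in> set h \<Longrightarrow> R x y \<Longrightarrow> c x = c y" "x \<in> set h" "y \<in> set h"
  shows "c x = c y"
proof -
  have "\<forall>x\<in>set h. c x = c (hd h)" using assms(1,2)
  proof (induction h)
    case (Cons a h)
    show ?case
    proof (cases "h = []")
      case False
      then have "R a (hd h)" "successively R h" using Cons.prems(1) by (auto simp: successively_Cons)
      have "c a = c (hd h)" by (rule Cons.prems(2)) (use \<open>R a (hd h)\<close> False in auto)
      moreover have "\<forall>x\<in>set h. c x = c (hd h)"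
      proof (rule Cons.IH[OF \<open>successively R h\<close>])
        fix x y assume "x \<in> set h" "y \<in> set h" "R x y"
        then show "c x = c y" by (intro Cons.prems(2)) auto
      qed
      ultimately show ?thesis by simp
    qed simp
  qed simp
  then show ?thesis using assms(3,4) by simp
qed

section \<open>Path graphs and disjoint unions\<close>

lemma adj_path_graph: "adj (path_graph n) i j \<longleftrightarrow> 1 \<le> i \<and> 1 \<le> j \<and> i \<le> n \<and> j \<le> n \<and> (i = Suc j \<or> j = Suc i)"
  unfolding path_graph_def by (auto simp: doubleton_eq_iff)

lemma doubleton_image_iff:
  assumes "inj f" shows "{f a, f b} \<in> (`) f ` E \<longleftrightarrow> {a, b} \<in> E"
proof
  assume "{f a, f b} \<in> (`) f ` E"
  then obtain e where e: "e \<in> E" "f ` {a, b} = f ` e" by auto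
  from e(2) have "{a, b} = e" by (rule iffD1[OF inj_image_eq_iff[OF assms]])
  then show "{a, b} \<in> E" using e by simp
next
  assume "{a, b} \<in> E"
  then have "f ` {a, b} \<in> (`) f ` E" by (rule imageI)
  then show "{f a, f b} \<in> (`) f ` E" by (simp only: image_insert image_empty)
qed

lemma adj_disjoint_union:
  "adj (disjoint_union G H) u v \<longleftrightarrow>
    (case (u, v) of (Inl a, Inl b) \<Rightarrow> adj G a b | (Inr a, Inr b) \<Rightarrow> adj H a b | _ \<Rightarrow> False)"
  unfolding disjoint_union_def by (cases u; cases v) (auto simp: doubleton_image_iff)

lemma verts_disjoint_union: "verts (disjoint_union G H) = Inl ` verts G \<union> Inr ` verts H"
  unfolding disjoint_union_def by auto

lemma verts_path_graph [simp]: "verts (path_graph n) = {1..n}"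
  unfolding path_graph_def by simp

lemma contains_two_paths:
  assumes "\<nexists>c. is_cycle G c" "simple_graph G" "is_path G p" "is_path G q" "length p = n" "length q = n"
    and "set p \<inter> set q = {}" "\<And>x y. x \<in> set p \<Longrightarrow> y \<in> set q \<Longrightarrow> \<not> adj G x y"
  shows "contains_induced G (disjoint_union (path_graph n) (path_graph n))"
proof (rule contains_inducedI)
  let ?f = "case_sum (\<lambda>i. p ! (i - 1)) (\<lambda>i. q ! (i - 1))"
  let ?H = "disjoint_union (path_graph n) (path_graph n)"
  have p: "p ! (i - 1) \<in> set p" and q: "q ! (i - 1) \<in> set q" if "i \<in> {1..n}" for i
    using that assms(5,6) by auto
  have dp: "distinct p" "distinct q" using assms(3,4) unfolding is_path_def by auto
  have inj: "i = j" if "i \<in> {1..n}" "j \<in> {1..n}" "xs ! (i - 1) = xs ! (j - 1)" "distinct xs" "length xs = n" for i j xs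
  proof -
    have "i - 1 < length xs" "j - 1 < length xs" using that by auto
    then have "i - 1 = j - 1" using that nth_eq_iff_index_eq by blast
    then show ?thesis using that by auto
  qed
  have pq: "p ! (i - 1) \<noteq> q ! (j - 1)" if "i \<in> {1..n}" "j \<in> {1..n}" for i j
    using p[OF that(1)] q[OF that(2)] assms(7) by auto
  show "inj_on ?f (verts ?H)"
  proof (rule inj_onI)
    fix u v assume uv: "u \<in> verts ?H" "v \<in> verts ?H" and eq: "?f u = ?f v"
    have V: "verts ?H = Inl ` {1..n} \<union> Inr ` {1..n}" unfolding verts_disjoint_union by simp
    consider i j where "u = Inl i" "v = Inl j" | i j where "u = Inr i" "v = Inr j"
      | i j where "u = Inl i" "v = Inr j" | i j where "u = Inr i" "v = Inl j"
      by (cases u; cases v) auto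
    then show "u = v"
    proof cases
      case (1 i j)
      have "i = j" by (rule inj[OF _ _ _ dp(1) assms(5)]) (use 1 uv eq V in auto)
      then show ?thesis using 1 by simp
    next
      case (2 i j)
      have "i = j" by (rule inj[OF _ _ _ dp(2) assms(6)]) (use 2 uv eq V in auto)
      then show ?thesis using 2 by simp
    next
      case (3 i j)
      then show ?thesis using pq[of i j] uv eq V by auto
    next
      case (4 i j)
      then show ?thesis using pq[of j i] uv eq V by auto
    qed
  qed
  show "?f ` verts ?H \<subseteq> verts G"
    using p q assms(3,4) unfolding verts_disjoint_union verts_path_graph is_path_def by auto
  have path: "adj (path_graph n) i j \<longleftrightarrow> adj G (xs ! (i - 1)) (xs ! (j - 1))"
    if "i \<in> {1..n}" "j \<in> {1..n}" "is_path G xs" "length xs = n" for i j xs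
  proof -
    have "i - 1 < length xs" "j - 1 < length xs" using that by auto
    from path_adj_iff[OF assms(1,2) that(3) this] show ?thesis using that(1,2) unfolding adj_path_graph by auto
  qed
  have no: "\<not> adj G (p ! (i - 1)) (q ! (j - 1))" "\<not> adj G (q ! (j - 1)) (p ! (i - 1))"
    if "i \<in> {1..n}" "j \<in> {1..n}" for i j
    using assms(8)[OF p q] that by (auto simp: adj_sym)
  fix u v assume "u \<in> verts ?H" "v \<in> verts ?H"
  then show "adj ?H u v \<longleftrightarrow> adj G (?f u) (?f v)"
    unfolding verts_disjoint_union verts_path_graph adj_disjoint_union
    using path[OF _ _ assms(3,5)] path[OF _ _ assms(4,6)] no by (auto split: sum.splits)
qed

section \<open>Obstructions to linearity\<close>

lemma adj_L_graph:
  assumes "2 \<le> k" "k \<le> n"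
  shows "adj (L_graph n k) (Inl i) (Inl j) \<longleftrightarrow> 1 \<le> i \<and> 1 \<le> j \<and> i \<le> n \<and> j \<le> n \<and> (i = Suc j \<or> j = Suc i)"
    and "adj (L_graph n k) (Inr i) (Inr j) \<longleftrightarrow> 1 \<le> i \<and> 1 \<le> j \<and> i < k \<and> j < k \<and> (i = Suc j \<or> j = Suc i)"
    and "adj (L_graph n k) (Inl i) (Inr j) \<longleftrightarrow> i = k \<and> j = k - 1"
    and "adj (L_graph n k) (Inr j) (Inl i) \<longleftrightarrow> i = k \<and> j = k - 1"
  using assms unfolding L_graph_def by (auto simp: doubleton_eq_iff)

lemma verts_L_graph: "verts (L_graph n k) = Inl ` {1..n} \<union> Inr ` {1..k - 1}"
  unfolding L_graph_def by simp

lemma simple_L_graph: "2 \<le> k \<Longrightarrow> k \<le> n \<Longrightarrow> simple_graph (L_graph n k)"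
  unfolding simple_graph_def L_graph_def by auto

lemma joined_L_graph:
  assumes k: "2 \<le> k" "k \<le> n" and v: "v \<in> verts (L_graph n k)"
  shows "joined (L_graph n k) (verts (L_graph n k)) (Inl 1) v"
proof -
  let ?H = "L_graph n k" and ?V = "verts (L_graph n k)"
  have l: "i \<le> n \<Longrightarrow> joined ?H ?V (Inl 1) (Inl i)" if "1 \<le> i" for i using that
  proof (induction i rule: dec_induct)
    case base
    then show ?case by (intro joined_refl) (auto simp: verts_L_graph)
  next
    case (step i)
    then have "joined ?H ?V (Inl 1) (Inl i)" by simp
    then show ?case by (rule joined_step) (use step in \<open>auto simp: verts_L_graph adj_L_graph[OF k]\<close>)
  qed
  have r: "1 \<le> i \<Longrightarrow> joined ?H ?V (Inl 1) (Inr i)" if "i \<le> k - 1" for i using that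
  proof (induction i rule: inc_induct)
    case base
    show ?case by (rule joined_step[OF l[of k]]) (use k in \<open>auto simp: verts_L_graph adj_L_graph[OF k]\<close>)
  next
    case (step i)
    then have "joined ?H ?V (Inl 1) (Inr (Suc i))" by simp
    then show ?case by (rule joined_step) (use step in \<open>auto simp: verts_L_graph adj_L_graph[OF k]\<close>)
  qed
  show ?thesis using v l r by (auto simp: verts_L_graph)
qed

text \<open>Since the graph is connected and G a forest, only edges have to be preserved. The leg is
  listed from its free end inwards, and \<open>xs ! (k - 1)\<close> is the branch vertex because
  lists start at 0.\<close>

lemma contains_L_graph:
  assumes ac: "\<nexists>c. is_cycle G c" and sg: "simple_graph G" and xs: "is_path G xs" "length xs = n"
    and ys: "is_path G ys" "length ys = k - 1" and disj: "set xs \<inter> set ys = {}"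
    and adj: "adj G (last ys) (xs ! (k - 1))" and k: "2 \<le> k" "k \<le> n"
  shows "contains_induced G (L_graph n k)"
proof (rule contains_induced_connected[OF ac sg simple_L_graph[OF k] _ _ _ joined_L_graph[OF k]])
  let ?f = "case_sum (\<lambda>i. xs ! (i - 1)) (\<lambda>i. ys ! (i - 1))"
  let ?H = "L_graph n k"
  have x: "xs ! (i - 1) \<in> set xs" if "1 \<le> i" "i \<le> n" for i using that xs(2) by auto
  have y: "ys ! (i - 1) \<in> set ys" if "1 \<le> i" "i \<le> k - 1" for i using that ys(2) by auto
  have nx: "i = j" if "1 \<le> i" "i \<le> n" "1 \<le> j" "j \<le> n" "xs ! (i - 1) = xs ! (j - 1)" for i j
  proof -
    have "i - 1 = j - 1" using that xs nth_eq_iff_index_eq[of xs "i - 1" "j - 1"] unfolding is_path_def by auto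
    then show ?thesis using that by auto
  qed
  have ny: "i = j" if "1 \<le> i" "i \<le> k - 1" "1 \<le> j" "j \<le> k - 1" "ys ! (i - 1) = ys ! (j - 1)" for i j
  proof -
    have "i - 1 = j - 1" using that ys nth_eq_iff_index_eq[of ys "i - 1" "j - 1"] unfolding is_path_def by auto
    then show ?thesis using that by auto
  qed
  show "inj_on ?f (verts ?H)"
  proof (rule inj_onI)
    fix u v assume uv: "u \<in> verts ?H" "v \<in> verts ?H" and eq: "?f u = ?f v"
    consider i j where "u = Inl i" "v = Inl j" | i j where "u = Inr i" "v = Inr j"
      | i j where "u = Inl i" "v = Inr j" | i j where "u = Inr i" "v = Inl j"
      by (cases u; cases v) auto
    then show "u = v"
    proof cases
      case (1 i j)
      have "i = j" by (rule nx) (use 1 uv eq in \<open>auto simp: verts_L_graph\<close>)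
      then show ?thesis using 1 by simp
    next
      case (2 i j)
      have "i = j" by (rule ny) (use 2 uv eq in \<open>auto simp: verts_L_graph\<close>)
      then show ?thesis using 2 by simp
    next
      case (3 i j)
      then show ?thesis using x[of i] y[of j] disj uv eq by (auto simp: verts_L_graph)
    next
      case (4 i j)
      then show ?thesis using x[of j] y[of i] disj uv eq by (auto simp: verts_L_graph)
    qed
  qed
  show "?f ` verts ?H \<subseteq> verts G"
    using x y xs(1) ys(1) unfolding is_path_def verts_L_graph by auto
  have step: "adj G (zs ! (i - 1)) (zs ! (j - 1))"
    if "is_path G zs" "1 \<le> i" "1 \<le> j" "i \<le> length zs" "j \<le> length zs" "i = Suc j \<or> j = Suc i" for zs i j
    using that(6)
  proof
    assume "i = Suc j"
    then show ?thesis using is_path_nth_adj[OF that(1), of "j - 1"] that by (simp add: adj_sym)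
  next
    assume "j = Suc i"
    then show ?thesis using is_path_nth_adj[OF that(1), of "i - 1"] that by simp
  qed
  have last: "last ys = ys ! (k - 1 - 1)" using ys k by (subst last_conv_nth) auto
  fix u v assume uv: "adj ?H u v"
  consider i j where "u = Inl i" "v = Inl j" | i j where "u = Inr i" "v = Inr j"
    | i j where "u = Inl i" "v = Inr j" | i j where "u = Inr i" "v = Inl j"
    by (cases u; cases v) auto
  then show "adj G (?f u) (?f v)"
  proof cases
    case (1 i j)
    then show ?thesis using uv step[OF xs(1), of i j] xs(2) adj_L_graph(1)[OF k, of i j] by simp
  next
    case (2 i j)
    then have ij: "1 \<le> i \<and> 1 \<le> j \<and> i < k \<and> j < k \<and> (i = Suc j \<or> j = Suc i)"
      using uv adj_L_graph(2)[OF k, of i j] by simp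
    then have "i \<le> length ys" "j \<le> length ys" using ys(2) by auto
    then show ?thesis using step[OF ys(1), of i j] ij 2 by simp
  next
    case (3 i j)
    then have "i = k" "j = k - 1" using uv adj_L_graph(3)[OF k, of i j] by auto
    then show ?thesis using 3 adj last by (simp add: adj_sym)
  next
    case (4 i j)
    then have "j = k" "i = k - 1" using uv adj_L_graph(4)[OF k, of i j] by auto
    then show ?thesis using 4 adj last by simp
  qed
qed

section \<open>Path ideals as squarefree monomial ideals\<close>

definition path_sets :: "nat \<Rightarrow> 'v graph \<Rightarrow> 'v set set" where
  "path_sets n G = {set q | q. is_path G q \<and> length q = n}"

lemma path_setsI: "is_path G q \<Longrightarrow> length q = n \<Longrightarrow> set q \<in> path_sets n G"
  unfolding path_sets_def by blast

lemma card_path_sets: "u \<in> path_sets n G \<Longrightarrow> card u = n"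
  unfolding path_sets_def is_path_def by (auto simp: distinct_card)

lemma prod_vars:
  fixes p :: "'v::finite list"
  assumes "distinct p"
  shows "(\<Prod>v\<leftarrow>p. var v) = (monomial (expo (set p)) :: ('v, 'k::field) mpoly)"
  using assms
proof (induction p)
  case Nil
  then show ?case by (simp add: monomial_def)
next
  case (Cons x p)
  have "Poly_Mapping.single x 1 + expo (set p) = expo (set (x # p))"
    using Cons.prems by (intro poly_mapping_eqI) (auto simp: lookup_add lookup_single when_def)
  then show ?case using Cons by (simp add: var_def monomial_def mult_single)
qed

lemma path_ideal_eq:
  fixes G :: "'v::finite graph"
  shows "(path_ideal n G :: ('v, 'k::field) mpoly set) = ideal_gen (monomial ` expo ` path_sets n G)"
proof -
  have "{(\<Prod>v\<leftarrow>p. var v) :: ('v, 'k) mpoly | p. is_path G p \<and> length p = n} =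
      {monomial (expo (set p)) | p. is_path G p \<and> length p = n}"
  proof (rule Collect_cong, rule ex_cong1)
    fix x :: "('v, 'k) mpoly" and p
    show "(x = (\<Prod>v\<leftarrow>p. var v) \<and> is_path G p \<and> length p = n) \<longleftrightarrow>
        (x = monomial (expo (set p)) \<and> is_path G p \<and> length p = n)"
      using prod_vars[where 'k='k, of p] unfolding is_path_def by auto
  qed
  also have "\<dots> = (monomial ` expo ` path_sets n G :: ('v, 'k) mpoly set)"
    unfolding path_sets_def by blast
  finally show ?thesis unfolding path_ideal_def by simp
qed

lemma path_sets_pullback:
  assumes f: "inj_on f (verts H)"
    "\<And>u v. u \<in> verts H \<Longrightarrow> v \<in> verts H \<Longrightarrow> adj H u v \<longleftrightarrow> adj G (f u) (f v)"
    and w: "w \<in> path_sets n G" "w \<subseteq> f ` verts H"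
  obtains h where "is_path H h" "length h = n" "w = f ` set h"
proof -
  obtain q where q: "is_path G q" "length q = n" "w = set q" using w(1) unfolding path_sets_def by blast
  obtain h where h: "is_path H h" "q = map f h"
    by (rule path_pullback[of f H G q]) (use f q w in auto)
  then show ?thesis using that[of h] q by simp
qed

lemma path_sets_image:
  assumes "inj_on f (verts H)" "f ` verts H \<subseteq> verts G"
    "\<And>u v. u \<in> verts H \<Longrightarrow> v \<in> verts H \<Longrightarrow> adj H u v \<longleftrightarrow> adj G (f u) (f v)"
    and "is_path H h" "length h = n"
  shows "f ` set h \<in> path_sets n G"
  using path_setsI[OF path_image[OF assms(1-4)]] assms(5) by simp

section \<open>Obstructions in the first syzygies\<close>

lemma successively_upt: "(\<And>i. m \<le> i \<Longrightarrow> Suc i < n \<Longrightarrow> R (f i) (f (Suc i))) \<Longrightarrow> successively R (map f [m..<n])"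
  by (simp add: successively_conv_nth)

text \<open>A generator adjacent to the first path would be a path within the union with one vertex
  in the second copy and, as n >= 2, another in the first; but a path stays in one
  component.\<close>

lemma two_paths_not_linear:
  fixes G :: "'v::finite graph"
  assumes "contains_induced G (disjoint_union (path_graph n) (path_graph n))" "2 \<le> n"
  shows "\<not> has_linear_resolution (path_ideal n G :: ('v, 'k::field) mpoly set)"
proof
  assume lin: "has_linear_resolution (path_ideal n G :: ('v, 'k) mpoly set)"
  let ?H = "disjoint_union (path_graph n) (path_graph n)"
  have V: "verts ?H = Inl ` {1..n} \<union> Inr ` {1..n}" unfolding verts_disjoint_union by simp
  obtain f where f: "inj_on f (verts ?H)" "f ` verts ?H \<subseteq> verts G"
    and adj: "\<And>u v. u \<in> verts ?H \<Longrightarrow> v \<in> verts ?H \<Longrightarrow> adj ?H u v \<longleftrightarrow> adj G (f u) (f v)"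
    using contains_inducedD[OF assms(1)] by blast
  have pl: "is_path ?H (map Inl [1..<Suc n])" and pr: "is_path ?H (map Inr [1..<Suc n])"
    unfolding is_path_def using assms(2)
    by (auto simp: V distinct_map adj_disjoint_union adj_path_graph simp del: upt_Suc intro!: successively_upt)
  let ?u = "f ` Inl ` {1..n}" and ?v = "f ` Inr ` {1..n}"
  have s: "set [1..<Suc n] = {1..n}" by auto
  have u: "?u \<in> path_sets n G" using path_sets_image[OF f adj pl, of n] s by (simp del: upt_Suc)
  have v: "?v \<in> path_sets n G" using path_sets_image[OF f adj pr, of n] s by (simp del: upt_Suc)
  have "f ` Inl ` {1..n} \<inter> f ` Inr ` {1..n} = f ` (Inl ` {1..n} \<inter> Inr ` {1..n})"
    by (rule inj_on_image_Int[OF f(1), symmetric]) (auto simp: V)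
  then have disj: "?u \<inter> ?v = {}" by auto
  have "?u \<noteq> {}" using assms(2) by auto
  then have neq: "?u \<noteq> ?v" using disj by blast
  have card: "card u = n" if "u \<in> path_sets n G" for u using card_path_sets[OF that] .
  obtain w where w: "w \<in> path_sets n G" "w \<subseteq> ?u \<union> ?v" "card (w - ?u) = 1"
    using linear_resolution_adjacent[OF card lin[unfolded path_ideal_eq] u v neq] by blast
  have "w \<subseteq> f ` verts ?H" using w(2) unfolding V image_Un .
  note pullback = path_sets_pullback[OF f(1) adj w(1) this]
  obtain h where h: "is_path ?H h" "length h = n" "w = f ` set h" by (rule pullback)
  have const: "isl x = isl y" if "x \<in> set h" "y \<in> set h" for x y
  proof (rule successively_const[OF _ _ that])
    show "successively (adj ?H) h" using h(1) unfolding is_path_def by blast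
    show "isl x = isl y" if "adj ?H x y" for x y using that unfolding adj_disjoint_union by (cases x; cases y) auto
  qed
  have hV: "set h \<subseteq> Inl ` {1..n} \<union> Inr ` {1..n}" using h(1) unfolding is_path_def V by blast
  consider "set h \<subseteq> Inl ` {1..n}" | "set h \<subseteq> Inr ` {1..n}"
  proof (cases "\<exists>x\<in>set h. isl x")
    case True
    then have l: "\<forall>x\<in>set h. isl x" using const by blast
    have "set h \<subseteq> Inl ` {1..n}"
    proof
      fix x assume "x \<in> set h"
      then have "isl x" "x \<in> Inl ` {1..n} \<union> Inr ` {1..n}" using l hV by blast+
      then show "x \<in> Inl ` {1..n}" by auto
    qed
    then show ?thesis using that by blast
  next
    case False
    have "set h \<subseteq> Inr ` {1..n}"
    proof
      fix x assume "x \<in> set h"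
      then have "\<not> isl x" "x \<in> Inl ` {1..n} \<union> Inr ` {1..n}" using False hV by blast+
      then show "x \<in> Inr ` {1..n}" by auto
    qed
    then show ?thesis using that by blast
  qed
  then show False
  proof cases
    case 1
    then have "w - ?u = {}" using h(3) by blast
    then show ?thesis using w(3) by (metis card.empty zero_neq_one)
  next
    case 2
    then have "w \<inter> ?u = {}" using h(3) disj by blast
    then have "w - ?u = w" by blast
    then show ?thesis using w(3) card_path_sets[OF w(1)] assms(2) by simp
  qed
qed

text \<open>Compare the path of all x with the one from the end of the leg into x_k, ..., x_n. A
  generator w adjacent to the former has one vertex on the leg and omits just one x. Both arms
  beside x_k have at least two vertices, so w meets all three branches at x_k, while a path meets at
  most two.\<close>

lemma L_graph_not_linear:
  fixes G :: "'v::finite graph"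
  assumes "contains_induced G (L_graph n k)" "3 \<le> k" "k + 2 \<le> n"
  shows "\<not> has_linear_resolution (path_ideal n G :: ('v, 'k::field) mpoly set)"
proof
  assume lin: "has_linear_resolution (path_ideal n G :: ('v, 'k) mpoly set)"
  let ?H = "L_graph n k"
  have k: "2 \<le> k" "k \<le> n" using assms by auto
  note V = verts_L_graph[of n k]
  obtain f where f: "inj_on f (verts ?H)" "f ` verts ?H \<subseteq> verts G"
    and adj: "\<And>u v. u \<in> verts ?H \<Longrightarrow> v \<in> verts ?H \<Longrightarrow> adj ?H u v \<longleftrightarrow> adj G (f u) (f v)"
    using contains_inducedD[OF assms(1)] by blast
  have pu: "is_path ?H (map Inl [1..<Suc n])" and p1: "is_path ?H (map Inr [1..<k])" and p2: "is_path ?H (map Inl [k..<Suc n])"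
    unfolding is_path_def using k
    by (auto simp: V distinct_map adj_L_graph[OF k] simp del: upt_Suc intro!: successively_upt)
  have "last (map Inr [1..<k]) = (Inr (k - 1) :: nat + nat)" "hd (map Inl [k..<Suc n]) = (Inl k :: nat + nat)"
    using k by (auto simp: last_map hd_map simp del: upt_Suc)
  then have "adj ?H (last (map Inr [1..<k])) (hd (map Inl [k..<Suc n]))"
    using adj_L_graph(4)[OF k] by metis
  then have pv: "is_path ?H (map Inr [1..<k] @ map Inl [k..<Suc n])"
    using p1 p2 k by (subst is_path_append) (auto simp: adj_L_graph[OF k] simp del: upt_Suc)
  let ?U = "Inl ` {1..n}"
  let ?u = "f ` ?U" and ?v = "f ` (Inr ` {1..k - 1} \<union> Inl ` {k..n})"
  have s: "set [1..<Suc n] = {1..n}" "set [1..<k] = {1..k - 1}" "set [k..<Suc n] = {k..n}" by auto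
  have u: "?u \<in> path_sets n G" using path_sets_image[OF f adj pu, of n] s by (simp del: upt_Suc)
  have v: "?v \<in> path_sets n G" using path_sets_image[OF f adj pv, of n] s k by (simp del: upt_Suc)
  have "Inr 1 \<in> verts ?H" "Inr 1 \<notin> ?U" using k unfolding V by auto
  then have "f (Inr 1) \<notin> ?u" using f(1) V by (auto dest: inj_onD)
  moreover have "f (Inr 1) \<in> ?v" using k by auto
  ultimately have neq: "?u \<noteq> ?v" by blast
  have card: "card u = n" if "u \<in> path_sets n G" for u using card_path_sets[OF that] .
  obtain w where w: "w \<in> path_sets n G" "w \<subseteq> ?u \<union> ?v" "card (w - ?u) = 1"
    using linear_resolution_adjacent[OF card lin[unfolded path_ideal_eq] u v neq] by blast
  have "?u \<union> ?v = f ` (?U \<union> (Inr ` {1..k - 1} \<union> Inl ` {k..n}))" by (simp only: image_Un)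
  also have "\<dots> \<subseteq> f ` verts ?H" by (rule image_mono) (use k in \<open>auto simp: V\<close>)
  finally have wV: "w \<subseteq> f ` verts ?H" by (rule subset_trans[OF w(2)])
  obtain h where h: "is_path ?H h" "length h = n" "w = f ` set h"
    by (rule path_sets_pullback[OF f(1) adj w(1) wV])
  have hV: "set h \<subseteq> verts ?H" and dh: "distinct h" using h(1) unfolding is_path_def by auto
  have "w - ?u = f ` (set h - ?U)" unfolding h(3)
    using inj_on_image_set_diff[OF f(1), of "set h" ?U] hV unfolding V by auto
  moreover have "inj_on f (set h - ?U)" using inj_on_subset[OF f(1)] hV by blast
  ultimately have one: "card (set h - ?U) = 1" using w(3) by (simp add: card_image)
  then have "set h - ?U \<noteq> {}" by (metis card.empty zero_neq_one)
  then obtain y where y: "y \<in> set h" "y \<notin> ?U" by blast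
  then have "y \<in> Inr ` {1..k - 1}" using hV unfolding V by blast
  then have yr: "\<not> isl y" by auto
  have "card (set h \<inter> ?U) + card (set h - ?U) = card (set h)"
    by (subst card_Un_disjoint[symmetric]) (auto intro: arg_cong[of _ _ card])
  then have big: "card (set h \<inter> ?U) = n - 1" using one h(2) distinct_card[OF dh] by simp
  \<comment> \<open>If all x_i with i < k were missing, at most n + 1 - k of the x would be left,
    too few as k >= 3. The same count on the other side, below, uses k + 2 <= n.\<close>
  have "\<exists>i\<in>{1..k - 1}. Inl i \<in> set h"
  proof (rule ccontr)
    assume "\<not> ?thesis"
    then have "set h \<inter> ?U \<subseteq> Inl ` {k..n}" by force
    then have "card (set h \<inter> ?U) \<le> card (Inl ` {k..n} :: (nat + nat) set)" by (intro card_mono) auto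
    also have "\<dots> = Suc n - k" by (simp add: card_image)
    finally show False using big assms by simp
  qed
  then obtain i where "i \<in> {1..k - 1}" and i2: "Inl i \<in> set h" ..
  then have i: "i < k" "Inl i \<in> set h" using k by auto
  have "\<exists>j\<in>{k + 1..n}. Inl j \<in> set h"
  proof (rule ccontr)
    assume "\<not> ?thesis"
    then have "set h \<inter> ?U \<subseteq> Inl ` {1..k}" by force
    then have "card (set h \<inter> ?U) \<le> card (Inl ` {1..k} :: (nat + nat) set)" by (intro card_mono) auto
    also have "\<dots> = k" by (simp add: card_image)
    finally show False using big assms by simp
  qed
  then obtain j where "j \<in> {k + 1..n}" and j2: "Inl j \<in> set h" ..
  then have j: "k < j" "Inl j \<in> set h" by auto
  \<comment> \<open>The label of the branch in which a vertex lies once x_k is removed. Cutting h at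
    x_k leaves two pieces with one label each, but three labels occur.\<close>
  define c :: "nat + nat \<Rightarrow> nat" where "c = case_sum (\<lambda>i. if i < k then 0 else 1) (\<lambda>_. 2)"
  have same: "c x = c x'" if "successively (adj ?H) h'" "Inl k \<notin> set h'" "x \<in> set h'" "x' \<in> set h'" for h' x x'
  proof (rule successively_const[OF that(1) _ that(3,4)])
    fix a b assume ab: "a \<in> set h'" "b \<in> set h'" "adj ?H a b"
    then have "a \<noteq> Inl k" "b \<noteq> Inl k" using that(2) by auto
    then show "c a = c b" using ab(3) by (cases a; cases b) (auto simp: adj_L_graph[OF k] c_def)
  qed
  have cs: "c (Inl i) = 0" "c (Inl j) = 1" "c y = 2" using i j yr by (auto simp: c_def split: sum.splits)
  have sh: "successively (adj ?H) h" using h(1) unfolding is_path_def by blast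
  show False
  proof (cases "Inl k \<in> set h")
    case False
    then show ?thesis using same[OF sh False i(2) j(2)] cs by simp
  next
    case True
    then obtain A B where AB: "h = A @ Inl k # B" by (meson split_list)
    then have "successively (adj ?H) A" "successively (adj ?H) B" "Inl k \<notin> set A" "Inl k \<notin> set B"
      using sh dh by (auto simp: successively_append_iff successively_Cons)
    note A = same[OF this(1,3)] and B = same[OF this(2,4)]
    have "Inl i \<in> set A \<union> set B" "Inl j \<in> set A \<union> set B" "y \<in> set A \<union> set B"
      using i j y(1) yr AB by auto
    then show ?thesis
      using A[of "Inl i" "Inl j"] A[of "Inl i" y] A[of "Inl j" y] B[of "Inl i" "Inl j"] B[of "Inl i" y] B[of "Inl j" y] cs
      by auto
  qed
qed

section \<open>The hexagon of paths in \<open>L_graph 5 3\<close>\<close>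

lemma L53_neighbours:
  "adj (L_graph 5 3) (Inl (Suc 0)) v \<longleftrightarrow> v = Inl 2"
  "adj (L_graph 5 3) (Inl 2) v \<longleftrightarrow> v = Inl (Suc 0) \<or> v = Inl 3"
  "adj (L_graph 5 3) (Inl 3) v \<longleftrightarrow> v = Inl 2 \<or> v = Inl 4 \<or> v = Inr 2"
  "adj (L_graph 5 3) (Inl 4) v \<longleftrightarrow> v = Inl 3 \<or> v = Inl 5"
  "adj (L_graph 5 3) (Inl 5) v \<longleftrightarrow> v = Inl 4"
  "adj (L_graph 5 3) (Inr (Suc 0)) v \<longleftrightarrow> v = Inr 2"
  "adj (L_graph 5 3) (Inr 2) v \<longleftrightarrow> v = Inr (Suc 0) \<or> v = Inl 3"
  by (cases v; auto simp: adj_L_graph)+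

text \<open>The graph has three legs of two vertices at x_3, and a path on four vertices fills one
  leg and enters another, which makes six. In this cyclic order neighbours share three
  vertices.\<close>

definition hexagon :: "nat \<Rightarrow> (nat + nat) list" where
  "hexagon i = [[Inl (Suc 0), Inl 2, Inl 3, Inl 4], [Inl 2, Inl 3, Inl 4, Inl 5], [Inl 5, Inl 4, Inl 3, Inr 2],
    [Inl 4, Inl 3, Inr 2, Inr (Suc 0)], [Inl 2, Inl 3, Inr 2, Inr (Suc 0)], [Inl (Suc 0), Inl 2, Inl 3, Inr 2]] ! i"

lemma less_6_cases: "(i::nat) < 6 \<Longrightarrow> i = 0 \<or> i = Suc 0 \<or> i = 2 \<or> i = 3 \<or> i = 4 \<or> i = 5"
  by auto

lemma hexagon_simps:
  "hexagon 0 = [Inl (Suc 0), Inl 2, Inl 3, Inl 4]" "hexagon (Suc 0) = [Inl 2, Inl 3, Inl 4, Inl 5]"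
  "hexagon 2 = [Inl 5, Inl 4, Inl 3, Inr 2]" "hexagon 3 = [Inl 4, Inl 3, Inr 2, Inr (Suc 0)]"
  "hexagon (Suc (Suc 0)) = [Inl 5, Inl 4, Inl 3, Inr 2]" "hexagon 4 = [Inl 2, Inl 3, Inr 2, Inr (Suc 0)]" "hexagon 5 = [Inl (Suc 0), Inl 2, Inl 3, Inr 2]"
  unfolding hexagon_def by simp_all

lemma verts_L53: "verts (L_graph 5 3) = {Inl (Suc 0), Inl 2, Inl 3, Inl 4, Inl 5, Inr (Suc 0), Inr 2}"
proof -
  have "{1..5::nat} = {Suc 0, 2, 3, 4, 5}" "{1..3 - 1::nat} = {Suc 0, 2}" by auto
  then show ?thesis unfolding verts_L_graph by auto
qed

lemma L53_paths:
  assumes "is_path (L_graph 5 3) h" "length h = 4"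
  shows "\<exists>i<6. set h = set (hexagon i)"
proof -
  obtain a b c d where h: "h = [a, b, c, d]"
    using assms(2) by (auto simp: length_Suc_conv eval_nat_numeral)
  have a: "a \<in> {Inl (Suc 0), Inl 2, Inl 3, Inl 4, Inl 5, Inr (Suc 0), Inr 2}"
    using assms(1) h unfolding is_path_def verts_L53 by simp
  have adj: "adj (L_graph 5 3) a b" "adj (L_graph 5 3) b c" "adj (L_graph 5 3) c d" and dist: "distinct [a, b, c, d]"
    using assms(1) h unfolding is_path_def by auto
  have "h \<in> hexagon ` {0, Suc 0, 2, 3, 4, 5} \<or> rev h \<in> hexagon ` {0, Suc 0, 2, 3, 4, 5}"
    unfolding h image_insert hexagon_simps using a adj dist
    by (elim insertE emptyE) (auto simp: L53_neighbours)
  then obtain i where i: "i \<in> {0, Suc 0, 2, 3, 4, 5}" "h = hexagon i \<or> rev h = hexagon i" by blast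
  from i(2) have "set h = set (hexagon i)"
  proof
    assume "rev h = hexagon i"
    from arg_cong[OF this, of set] show ?thesis by (simp only: set_rev)
  qed simp
  moreover have "i < 6" using i(1) by auto
  ultimately show ?thesis by blast
qed

lemma L53_not_linear:
  fixes G :: "'v::finite graph"
  assumes "contains_induced G (L_graph 5 3)"
  shows "\<not> has_linear_resolution (path_ideal 4 G :: ('v, 'k::field) mpoly set)"
proof
  assume lin: "has_linear_resolution (path_ideal 4 G :: ('v, 'k) mpoly set)"
  let ?H = "L_graph 5 3"
  obtain f where f: "inj_on f (verts ?H)" "f ` verts ?H \<subseteq> verts G"
    and adj: "\<And>u v. u \<in> verts ?H \<Longrightarrow> v \<in> verts ?H \<Longrightarrow> adj ?H u v \<longleftrightarrow> adj G (f u) (f v)"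
    using contains_inducedD[OF assms(1)] by blast
  let ?g = "\<lambda>i. f ` set (hexagon i)"
  have sub: "set (hexagon i) \<subseteq> verts ?H" if "i < 6" for i
    using less_6_cases[OF that] unfolding verts_L53 by (elim disjE) (simp_all add: hexagon_simps)
  have card: "card (?g i \<union> ?g j) = card (set (hexagon i) \<union> set (hexagon j))" if "i < 6" "j < 6" for i j
    unfolding image_Un[symmetric] using sub[OF that(1)] sub[OF that(2)]
    by (intro card_image inj_on_subset[OF f(1)]) auto
  have W: "(\<Union>i<6. ?g i) = f ` verts ?H"
  proof -
    have "(\<Union>i<6. set (hexagon i)) = verts ?H"
    proof (rule subset_antisym)
      show "verts ?H \<subseteq> (\<Union>i<6. set (hexagon i))"
      proof
        fix v assume "v \<in> verts ?H"
        then have "v \<in> set (hexagon 0) \<or> v \<in> set (hexagon (Suc 0)) \<or> v \<in> set (hexagon 3)"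
          unfolding verts_L53 hexagon_simps by auto
        then show "v \<in> (\<Union>i<6. set (hexagon i))" by force
      qed
    qed (use sub in blast)
    then show ?thesis by blast
  qed
  show False
  proof (rule hexagon_not_linear[where g = ?g and d = 4, OF _ lin[unfolded path_ideal_eq]])
    show "card u = 4" if "u \<in> path_sets 4 G" for u using card_path_sets[OF that] .
    show "?g i \<in> path_sets 4 G" if i: "i < 6" for i
    proof (rule path_sets_image[OF f adj])
      show "is_path ?H (hexagon i)" "length (hexagon i) = 4"
        using less_6_cases[OF i] unfolding is_path_def verts_L53
        by (elim disjE; simp add: hexagon_simps L53_neighbours)+
    qed
    show "inj_on ?g {..<6}"
    proof (rule inj_onI)
      fix i j :: nat assume ij: "i \<in> {..<6}" "j \<in> {..<6}" "?g i = ?g j"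
      then have "set (hexagon i) = set (hexagon j)"
        using inj_on_image_eq_iff[OF f(1) sub sub, of i j] by auto
      then show "i = j" using less_6_cases[of i] less_6_cases[of j] ij(1,2)
        by (auto simp: hexagon_simps insert_eq_iff)
    qed
    show "card (?g i \<union> ?g (Suc i mod 6)) = 4 + 1" if i: "i < 6" for i
      using less_6_cases[OF i] card[OF i, of "Suc i mod 6"] by (elim disjE) (simp_all add: hexagon_simps insert_commute)
    show "j = Suc i mod 6 \<or> i = Suc j mod 6"
      if "i < 6" "j < 6" "i \<noteq> j" "card (?g i \<union> ?g j) \<le> 4 + 1" for i j
      using less_6_cases[OF that(1)] less_6_cases[OF that(2)] that(3,4) unfolding card[OF that(1,2)]
      by (elim disjE) (simp_all add: hexagon_simps card_insert_if)
    show "w \<in> ?g ` {..<6}" if w: "w \<in> path_sets 4 G" "w \<subseteq> (\<Union>i<6. ?g i)" for w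
    proof -
      obtain h where h: "is_path ?H h" "length h = 4" "w = f ` set h"
        by (rule path_sets_pullback[OF f(1) adj w(1) w(2)[unfolded W]])
      then obtain i where "i < 6" "set h = set (hexagon i)" using L53_paths by blast
      then show ?thesis using h(3) by auto
    qed
    \<comment> \<open>Seven variables, one more than the 4 + 2 that a linear second syzygy may
      involve.\<close>
    have "card (verts ?H) = 7" unfolding verts_L53 by simp
    then show "4 + 2 < card (\<Union>i<6. ?g i)" unfolding W card_image[OF f(1)] by simp
  qed
qed

section \<open>Paths along a longest path\<close>

lemma path_segment_less:
  assumes "is_path G p" "i < j" "j \<le> length p"
  shows "is_path G (map ((!) p) [i..<j])"
proof -
  have "is_path G (map ((!) p) [i..<Suc (j - 1)])" by (rule path_segment) (use assms in auto)
  then show ?thesis using assms(2) by (simp del: upt_Suc)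
qed

locale longest_path =
  fixes G :: "'v graph" and p :: "'v list" and n :: nat
  assumes simple: "simple_graph G" and forest: "\<nexists>c. is_cycle G c"
    and conn: "\<And>u v. u \<in> verts G \<Longrightarrow> v \<in> verts G \<Longrightarrow> joined G (verts G) u v"
    and path: "is_path G p" and longest: "\<And>q. is_path G q \<Longrightarrow> length q \<le> length p"
    and n4: "4 \<le> n"
begin

text \<open>Reversal exchanges left and right, so a statement about one side of p yields the other
  one.\<close>

lemma rev_longest: "longest_path G (rev p) n"
  using simple forest conn path longest n4 by unfold_locales auto

lemma path_neq_Nil: "p \<noteq> []"
  using path unfolding is_path_def by blast

lemma distinct_p: "distinct p"
  using path unfolding is_path_def by blast

lemma p_eq_iff: "i < length p \<Longrightarrow> j < length p \<Longrightarrow> p ! i = p ! j \<longleftrightarrow> i = j"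
  using distinct_p by (rule nth_eq_iff_index_eq)

lemma p_adj_iff: "i < length p \<Longrightarrow> j < length p \<Longrightarrow> adj G (p ! i) (p ! j) \<longleftrightarrow> i = Suc j \<or> j = Suc i"
  by (rule path_adj_iff[OF forest simple path])

text \<open>Replacing the first i vertices of p by the reversed leg gives a path, which cannot be
  longer than p. Only the retained part of p has to be avoided, so in \<open>first_hit\<close> the
  bound also applies to a leg that might run along the other part.\<close>

lemma leg_bound_right:
  assumes "i < length p" "is_path G (p ! i # ws)" "set ws \<inter> (!) p ` {i..<length p} = {}"
  shows "length ws \<le> i"
proof (cases "ws = []")
  case False
  let ?s = "map ((!) p) [i..<length p]"
  have "is_path G ?s" by (rule path_segment_less[OF path]) (use assms(1) in auto)
  moreover have "hd ?s = p ! i" using assms(1) by (simp add: upt_conv_Cons)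
  ultimately have "is_path G (rev ws @ ?s)"
    using assms False by (subst is_path_append) (auto simp: is_path_Cons adj_sym last_rev)
  from longest[OF this] show ?thesis using assms(1) by simp
qed simp

lemma leg_bound_left:
  assumes "i < length p" "is_path G (p ! i # ws)" "set ws \<inter> (!) p ` {..i} = {}"
  shows "length ws + i < length p"
proof (cases "ws = []")
  case False
  let ?s = "map ((!) p) [0..<Suc i]"
  have "is_path G ?s" by (rule path_segment_less[OF path]) (use assms(1) in auto)
  moreover have "set ?s = (!) p ` {..i}" unfolding set_map set_upt by (simp only: atLeast0LessThan lessThan_Suc_atMost)
  moreover have "last ?s = p ! i" by simp
  ultimately have "is_path G (?s @ ws)"
    using assms False by (subst is_path_append) (simp_all add: is_path_Cons Int_commute del: upt_Suc)
  from longest[OF this] show ?thesis by simp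
qed (use assms in simp)

text \<open>The long path is the segment of p with m vertices that starts a places before
  \<open>p ! i\<close>, and the leg is cut down to a vertices; \<open>p ! i\<close> is then vertex a
  + 1, whence k = a + 1.\<close>

lemma contains_spider:
  assumes i: "i < length p" and ws: "is_path G (p ! i # ws)" "set ws \<inter> set p = {}"
    and a: "1 \<le> a" "a \<le> length ws" "a \<le> i" "i - a + m \<le> length p" "a < m"
  shows "contains_induced G (L_graph m (Suc a))"
proof (rule contains_L_graph[OF forest simple])
  let ?xs = "map ((!) p) [i - a..<i - a + m]" and ?ys = "rev (take a ws)"
  have wsne: "ws \<noteq> []" using a by auto
  show "is_path G ?xs" by (rule path_segment_less[OF path]) (use a in auto)
  show "length ?xs = m" by simp
  have "is_path G ws" using ws(1) wsne by (simp add: is_path_Cons)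
  then show "is_path G ?ys" using is_path_appendD1[of G "take a ws" "drop a ws"] a wsne by simp
  show "length ?ys = Suc a - 1" using a by simp
  have "set ?xs \<subseteq> set p" using a(4) by auto
  moreover have "set ?ys \<subseteq> set ws" by (simp add: set_take_subset)
  ultimately show "set ?xs \<inter> set ?ys = {}" using ws(2) by blast
  have "last ?ys = hd ws" using a wsne by (simp add: last_rev)
  moreover have "?xs ! (Suc a - 1) = p ! i" using a by simp
  ultimately show "adj G (last ?ys) (?xs ! (Suc a - 1))" using ws(1) wsne by (simp add: is_path_Cons adj_sym)
qed (use a in auto)

definition L_free :: bool where
  "L_free \<longleftrightarrow> (n = 4 \<longrightarrow> \<not> contains_induced G (L_graph 5 3)) \<and>
    (5 \<le> n \<longrightarrow> (\<forall>k. 3 \<le> k \<and> 2 * k \<le> n + 1 \<longrightarrow> \<not> contains_induced G (L_graph n k)))"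

text \<open>The bound says that the leg together with the part of p from \<open>p ! i\<close> to the
  right end has fewer than n vertices, so a path on n vertices cannot come down the leg and continue
  to the right along p.\<close>

lemma no_long_leg_right:
  assumes L_free: L_free and i: "i < length p" and ws: "is_path G (p ! i # ws)" "set ws \<inter> set p = {}"
    and r: "2 \<le> length ws"
  shows "length ws + length p < n + i"
proof (rule ccontr)
  assume "\<not> ?thesis"
  then have long: "n + i \<le> length ws + length p" by simp
  have sub: "(!) p ` {i..<length p} \<subseteq> set p" "(!) p ` {..i} \<subseteq> set p" using i by auto
  have ri: "length ws \<le> i" by (rule leg_bound_right[OF i ws(1)]) (use ws(2) sub in blast)
  have rl: "length ws + i < length p" by (rule leg_bound_left[OF i ws(1)]) (use ws(2) sub in blast)
  show False
  proof (cases "n = 4")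
    case True
    \<comment> \<open>As p is longest, both arms of p beside \<open>p ! i\<close> are at least as
      long as the leg, which has two vertices or more.\<close>
    have "contains_induced G (L_graph 5 (Suc 2))" by (rule contains_spider[OF i ws]) (use r ri rl in auto)
    then show ?thesis using L_free True unfolding L_free_def by simp
  next
    case False
    \<comment> \<open>With r the length of the leg, a = r fits into p by \<open>long\<close> and a =
      n - 1 - r fits by \<open>rl\<close>; the smaller one satisfies 2 (a + 1) <= n + 1, which is
      the origin of (n + 1)/2. If n - 1 - r < 2, then r >= n - 2 and a = 2 fits by
      \<open>rl\<close>; here n >= 5 is needed for k = 3.\<close>
    define a where "a = (if length ws + 3 \<le> n then min (length ws) (n - 1 - length ws) else 2)"
    have a: "2 \<le> a" "a \<le> length ws" "2 * Suc a \<le> n + 1" "i - a + n \<le> length p"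
      using r ri rl long False n4 unfolding a_def by (auto simp: min_def split: if_splits)
    have "contains_induced G (L_graph n (Suc a))" by (rule contains_spider[OF i ws]) (use a ri n4 in auto)
    then show ?thesis using L_free False n4 a unfolding L_free_def by auto
  qed
qed

lemma no_long_leg_left:
  assumes L_free: L_free and i: "i < length p" and ws: "is_path G (p ! i # ws)" "set ws \<inter> set p = {}"
    and r: "2 \<le> length ws"
  shows "length ws + i + 1 < n"
proof -
  interpret R: longest_path G "rev p" n by (rule rev_longest)
  have "length ws + length (rev p) < n + (length p - 1 - i)"
    by (rule R.no_long_leg_right) (use L_free i ws r in \<open>auto simp: R.L_free_def L_free_def rev_nth\<close>)
  then show ?thesis using i by simp
qed

text \<open>A longer part of \<open>q\<close> before its first vertex on \<open>p\<close> would be a long leg; if \<open>q\<close> misses \<open>p\<close>, then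
  the longer half of \<open>q\<close> together with the path connecting it to \<open>p\<close> is one.\<close>

lemma first_hit:
  assumes L_free and q: "is_path G q" "length q = n"
  shows "\<exists>s i. s \<le> 1 \<and> i < length p \<and> q ! s = p ! i"
proof (cases "set q \<inter> set p = {}")
  case True
  have qne: "q \<noteq> []" and pne: "p \<noteq> []" using q path unfolding is_path_def by auto
  have "hd q \<in> verts G" "hd p \<in> verts G" using q path qne pne unfolding is_path_def by auto
  then obtain R where R: "is_path G R" "hd R = hd q" "last R = hd p" using conn unfolding joined_def by blast
  have "R \<noteq> []" using R(1) unfolding is_path_def by blast
  then have "\<exists>y\<in>set R. y \<in> set p" using R(3) pne by (metis last_in_set list.set_sel(1))
  then obtain A y B where A: "R = A @ y # B" "y \<in> set p" "\<forall>z\<in>set A. z \<notin> set p"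
    using split_list_first_prop[of R "\<lambda>y. y \<in> set p"] by blast
  have "A \<noteq> []" using A R(2) True qne by (metis append_Nil disjoint_iff list.sel(1) list.set_sel(1))
  then have "\<exists>z\<in>set A. z \<in> set q" using A(1) R(2) qne by (metis hd_append2 list.set_sel(1))
  then obtain C z E where C: "A = C @ z # E" "z \<in> set q" "\<forall>v\<in>set E. v \<notin> set q"
    using split_list_last_prop[of A "\<lambda>z. z \<in> set q"] by blast
  have "is_path G (C @ (z # E @ [y]) @ B)" using R(1) A(1) C(1) by simp
  then have "is_path G ((z # E @ [y]) @ B)" using is_path_appendD2 by blast
  then have "is_path G (z # E @ [y])" using is_path_appendD1 by blast
  then have zEy: "is_path G (rev (z # E @ [y]))" by (simp only: is_path_rev)
  obtain i where i: "i < length p" "y = p ! i" using A(2) by (metis in_set_conv_nth)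
  obtain q1 q2 where q12: "q = q1 @ z # q2" using C(2) by (meson split_list)
  \<comment> \<open>The leg runs from \<open>p ! i\<close> back along E to z and on along one part Q
    of q, so it has at least (n + 1)/2 vertices. The two bounds, length <= i and length + i + 1 < n,
    force it below (n - 1)/2.\<close>
  have leg: False if Q: "is_path G (z # Q)" "set Q \<subseteq> set q" "n \<le> 2 * length Q + 1" for Q
  proof -
    let ?ws = "rev E @ z # Q"
    have "is_path G (p ! i # ?ws)"
    proof (cases "Q = []")
      case True
      then show ?thesis using zEy i by simp
    next
      case False
      have "is_path G ((y # rev E @ [z]) @ Q)"
      proof (subst is_path_append)
        have "y \<notin> set q" using A(2) True by (meson disjoint_iff \<open>set q \<inter> set p = {}\<close>)
        moreover have "z \<notin> set Q" "is_path G Q" "adj G z (hd Q)" using Q(1) False by (auto simp: is_path_Cons)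
        ultimately show "is_path G (y # rev E @ [z]) \<and> is_path G Q \<and> set (y # rev E @ [z]) \<inter> set Q = {} \<and>
            adj G (last (y # rev E @ [z])) (hd Q)"
          using zEy C(3) Q(2) by auto
      qed (use False in auto)
      then show ?thesis using i by simp
    qed
    moreover have "set ?ws \<inter> set p = {}" using A(3) C(1) Q(2) \<open>set q \<inter> set p = {}\<close> by auto
    moreover have len: "2 \<le> length ?ws" "n + 1 \<le> 2 * length ?ws" using Q(3) n4 by auto
    ultimately have *: "length ?ws + i + 1 < n" and "length ?ws \<le> i"
      using no_long_leg_left[OF assms(1) i(1)] leg_bound_right[OF i(1), of ?ws] i(1) by (blast, fastforce)
    then show False using len by linarith
  qed
  have "n \<le> 2 * length q2 + 1 \<or> n \<le> 2 * length q1 + 1" using q(2) q12 by auto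
  moreover have "is_path G (z # q2)" using is_path_appendD2[of G q1 "z # q2"] q(1) q12 by simp
  moreover have "is_path G (z # rev q1)"
  proof -
    have "is_path G ((q1 @ [z]) @ q2)" using q(1) q12 by simp
    then have "is_path G (rev (q1 @ [z]))" using is_path_appendD1 is_path_rev by blast
    then show ?thesis by simp
  qed
  ultimately show ?thesis using leg[of q2] leg[of "rev q1"] q12 by auto
next
  case False
  then have "\<exists>y\<in>set q. y \<in> set p" by blast
  then obtain A y R where A: "q = A @ y # R" "y \<in> set p" "\<forall>z\<in>set A. z \<notin> set p"
    using split_list_first_prop[of q "\<lambda>y. y \<in> set p"] by blast
  obtain i where i: "i < length p" "y = p ! i" using A(2) by (metis in_set_conv_nth)
  have dq: "distinct q" using q(1) unfolding is_path_def by blast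
  have "is_path G ((A @ [y]) @ R)" using q(1) A(1) by simp
  then have "is_path G (rev (A @ [y]))" using is_path_appendD1 is_path_rev by blast
  then have Ay: "is_path G (p ! i # rev A)" using i by simp
  have yR: "is_path G (p ! i # R)" using is_path_appendD2[of G A "y # R"] q(1) A(1) i by simp
  have "length A \<le> 1"
  proof (rule ccontr)
    assume "\<not> ?thesis"
    then have 2: "2 \<le> length (rev A)" by simp
    have dis: "set (rev A) \<inter> set p = {}" using A(3) by auto
    have "length R + 1 + length A = n" using q(2) A(1) by simp
    moreover have "length (rev A) + length p < n + i" by (rule no_long_leg_right[OF assms(1) i(1) Ay dis 2])
    moreover have "length (rev A) + i + 1 < n" by (rule no_long_leg_left[OF assms(1) i(1) Ay dis 2])
    ultimately have R: "length p < length R + 1 + i" "i < length R" by auto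
    have yR': "p ! i \<notin> set R" using dq A(1) i by auto
    \<comment> \<open>The rest R of q is too long to avoid p on either side of \<open>p ! i\<close>.
      Meeting p on both sides it contains the stretch in between, hence \<open>p ! i\<close> itself,
      which q would then visit twice.\<close>
    have "set R \<inter> (!) p ` {i..<length p} \<noteq> {}" using leg_bound_right[OF i(1) yR] R(2) by auto
    then obtain k where k: "i < k" "k < length p" "p ! k \<in> set R"
      using yR' by (auto simp: le_less)
    have "set R \<inter> (!) p ` {..i} \<noteq> {}" using leg_bound_left[OF i(1) yR] R(1) by auto
    then obtain j where j: "j < i" "p ! j \<in> set R"
      using yR' by (auto simp: le_less)
    let ?s = "map ((!) p) [j..<Suc k]"
    have s: "is_path G ?s" using path_segment[OF path, of j k] j k by simp
    have Rp: "is_path G R" using yR j by (cases "R = []") (auto simp: is_path_Cons)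
    have "hd ?s = p ! j" "last ?s = p ! k" using j k by (auto simp: hd_map last_map simp del: upt_Suc)
    then have "joined G (set R) (hd ?s) (last ?s)" using joined_path[OF Rp j(2) k(3)] by simp
    then have "set ?s \<subseteq> set R" using joined_unique_path[OF forest _ s] by blast
    moreover have "p ! i \<in> set ?s" using j k by auto
    ultimately show False using yR' by blast
  qed
  then show ?thesis using A i by (intro exI[of _ "length A"] exI[of _ i]) simp
qed

section \<open>Windows along the longest path\<close>

definition window :: "nat \<Rightarrow> 'v \<Rightarrow> 'v \<Rightarrow> 'v list" where
  "window x a b = a # map ((!) p) [x..<x + (n - 2)] @ [b]"

text \<open>By \<open>first_hit\<close> at most one vertex at each end of a path on n vertices
  leaves p, so n - 2 interior vertices are fixed by the position x. The ends a and b may lie on p or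
  off it.\<close>

definition valid :: "nat \<Rightarrow> 'v \<Rightarrow> 'v \<Rightarrow> bool" where
  "valid x a b \<longleftrightarrow> x + (n - 2) \<le> length p \<and> is_path G (window x a b)"

lemma set_window: "set (window x a b) = {a, b} \<union> (!) p ` {x..<x + (n - 2)}"
  unfolding window_def by auto

lemma length_window: "length (window x a b) = n"
  unfolding window_def using n4 by simp

text \<open>Between its first and its last vertex on \<open>p\<close>, the path \<open>q\<close> runs along \<open>p\<close>.\<close>

lemma path_is_window:
  assumes L_free and q: "is_path G q" "length q = n"
  shows "\<exists>x a b. valid x a b \<and> set q = set (window x a b)"
proof -
  have main: "\<exists>x a b. valid x a b \<and> set q = set (window x a b)"
    if q: "is_path G q" "length q = n" and s: "s \<le> 1" "i < length p" "q ! s = p ! i"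
      and e: "n \<le> e + 2" "e < n" "j < length p" "q ! e = p ! j" and ij: "i \<le> j" for q s i e j
  proof -
    have se: "s < e" using s e n4 by auto
    let ?q = "map ((!) q) [s..<Suc e]" and ?p = "map ((!) p) [i..<Suc j]"
    have "?q = ?p"
    proof (rule path_unique[OF forest])
      show "is_path G ?q" using path_segment[OF q(1), of s e] se e q(2) by simp
      show "is_path G ?p" using path_segment[OF path, of i j] e ij by simp
      show "hd ?q = hd ?p" "last ?q = last ?p"
        using se ij s e by (auto simp: hd_map last_map simp del: upt_Suc)
    qed
    note eq = this
    have len: "e - s = j - i" using arg_cong[OF eq, of length] se ij by (simp del: upt_Suc)
    have nth: "q ! (s + t) = p ! (i + t)" if "t \<le> j - i" for t
      using arg_cong[OF eq, of "\<lambda>xs. xs ! t"] that len se ij by (simp del: upt_Suc)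
    \<comment> \<open>The interior of q starts at index 1, which is \<open>1 - s\<close> places
      after the hit \<open>q ! s = p ! i\<close>.\<close>
    define x where "x = i + 1 - s"
    have int: "q ! t = p ! (x + (t - 1))" if "1 \<le> t" "t \<le> n - 2" for t
      using nth[of "t - s"] that s e len ij se unfolding x_def by (cases s) auto
    have xl: "x + (n - 2) \<le> length p" using len se s e ij n4 unfolding x_def by auto
    have "q = window x (q ! 0) (q ! (n - 1))"
    proof (rule nth_equalityI)
      show "length q = length (window x (q ! 0) (q ! (n - 1)))" using q(2) length_window by simp
      fix t assume "t < length q"
      then consider "t = 0" | "1 \<le> t" "t \<le> n - 2" | "t = n - 1" using q(2) by linarith
      then show "q ! t = window x (q ! 0) (q ! (n - 1)) ! t"
      proof cases
        case 2
        then show ?thesis using int[OF 2] n4 unfolding window_def by (cases t) (auto simp: nth_append)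
      next
        case 3
        then have "t = Suc (n - 2)" using n4 by simp
        then show ?thesis using 3 unfolding window_def by (simp add: nth_append)
      qed (simp add: window_def)
    qed
    then show ?thesis using q(1) xl unfolding valid_def by metis
  qed
  obtain s i where s: "s \<le> 1" "i < length p" "q ! s = p ! i" using first_hit[OF assms] by blast
  obtain s' j where s': "s' \<le> 1" "j < length p" "rev q ! s' = p ! j"
    using first_hit[OF assms(1), of "rev q"] q by auto
  show ?thesis
  proof (cases "i \<le> j")
    case True
    show ?thesis
    proof (rule main[OF q s _ _ s'(2) _ True])
      show "n \<le> (n - 1 - s') + 2" "n - 1 - s' < n" using s'(1) n4 by auto
      show "q ! (n - 1 - s') = p ! j" using s' q(2) n4 by (simp add: rev_nth)
    qed
  next
    case False
    have "\<exists>x a b. valid x a b \<and> set (rev q) = set (window x a b)"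
    proof (rule main[OF _ _ s' _ _ s(2)])
      show "is_path G (rev q)" "length (rev q) = n" using q by simp_all
      show "n \<le> (n - 1 - s) + 2" "n - 1 - s < n" using s(1) n4 by auto
      show "rev q ! (n - 1 - s) = p ! i" using s q(2) n4 by (simp add: rev_nth)
      show "j \<le> i" using False by simp
    qed
    then show ?thesis by simp
  qed
qed

end

text \<open>One set may have several representatives, so sets are sorted by the least key among
  theirs. The set of t then comes early enough, since its least key is at most
  \<open>key t\<close>.\<close>

lemma ex_lq_list:
  fixes key :: "'r \<Rightarrow> 'o::linorder" and S :: "'r \<Rightarrow> 'v set"
  assumes fin: "finite R"
    and inj: "\<And>r r'. r \<in> R \<Longrightarrow> r' \<in> R \<Longrightarrow> key r = key r' \<Longrightarrow> S r = S r'"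
    and step: "\<And>r r'. r \<in> R \<Longrightarrow> r' \<in> R \<Longrightarrow> key r < key r' \<Longrightarrow> S r \<noteq> S r' \<Longrightarrow>
      \<exists>t\<in>R. key t < key r' \<and> (\<exists>x\<in>S r. S t - S r' = {x})"
  shows "\<exists>us. distinct us \<and> set us = S ` R \<and> lq_list us"
proof -
  define K where "K u = Min (key ` {r \<in> R. S r = u})" for u
  have K: "\<exists>r\<in>R. S r = u \<and> key r = K u" if "u \<in> S ` R" for u
  proof -
    have "K u \<in> key ` {r \<in> R. S r = u}" unfolding K_def by (rule Min_in) (use fin that in auto)
    then show ?thesis by auto
  qed
  have K_le: "K (S r) \<le> key r" if "r \<in> R" for r
    unfolding K_def by (rule Min_le) (use fin that in auto)
  obtain us0 where us0: "set us0 = S ` R" "distinct us0" using finite_distinct_list[of "S ` R"] fin by auto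
  define us where "us = sort_key K us0"
  have us: "set us = S ` R" "distinct us" "sorted (map K us)" using us0 by (simp_all add: us_def)
  have "lq_list us"
    unfolding lq_list_def
  proof (intro allI impI)
    fix k l assume k: "k < length us" and l: "l < k"
    have in_R: "us ! k \<in> S ` R" "us ! l \<in> S ` R" using k l us(1) nth_mem by (metis, metis less_trans)
    obtain r where r: "r \<in> R" "S r = us ! l" "key r = K (us ! l)" using K[OF in_R(2)] by blast
    obtain r' where r': "r' \<in> R" "S r' = us ! k" "key r' = K (us ! k)" using K[OF in_R(1)] by blast
    have neq: "S r \<noteq> S r'" using us(2) k l r(2) r'(2) by (simp add: nth_eq_iff_index_eq)
    have "K (us ! l) \<le> K (us ! k)" using sorted_nth_mono[OF us(3), of l k] k l by simp
    moreover have "key r \<noteq> key r'" using inj[OF r(1) r'(1)] neq by blast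
    ultimately have "key r < key r'" using r(3) r'(3) by simp
    then obtain t x where t: "t \<in> R" "key t < key r'" "x \<in> S r" "S t - S r' = {x}"
      using step[OF r(1) r'(1) _ neq] by blast
    obtain m where m: "m < length us" "us ! m = S t" using t(1) us(1) by (metis imageI in_set_conv_nth)
    have "K (us ! m) < K (us ! k)" using K_le[OF t(1)] t(2) r'(3) m(2) by simp
    have "m < k"
    proof (rule ccontr)
      assume "\<not> m < k"
      then have "K (us ! k) \<le> K (us ! m)" using sorted_nth_mono[OF us(3), of k m] m(1) k by simp
      then show False using \<open>K (us ! m) < K (us ! k)\<close> by simp
    qed
    then show "\<exists>m<k. \<exists>x\<in>us ! l. us ! m - us ! k = {x}" using t(3,4) m(2) r(2) r'(2) by auto
  qed
  then show ?thesis using us by blast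
qed

context longest_path
begin

section \<open>Exchange of vertices between windows\<close>

lemma two_neighbours:
  assumes c: "adj G c (p ! s)" "adj G c (p ! t)" and st: "s < t" "t < length p"
  shows "t = s + 2 \<and> c = p ! Suc s"
proof -
  have cv: "c \<in> verts G" and cs: "c \<noteq> p ! s" and ct: "c \<noteq> p ! t"
    using c adj_neq[OF simple] adj_verts[OF simple] by blast+
  have "p ! s \<in> verts G" "p ! t \<in> verts G" using c adj_verts[OF simple] by blast+
  then have "is_path G [p ! s, c, p ! t]"
    using cv cs ct c st p_eq_iff[of s t] unfolding is_path_def by (auto simp: adj_sym)
  moreover have "is_path G (map ((!) p) [s..<Suc t])" using path_segment[OF path, of s t] st by simp
  ultimately have eq: "map ((!) p) [s..<Suc t] = [p ! s, c, p ! t]"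
    by (intro path_unique[OF forest]) (use st in \<open>auto simp: hd_map last_map simp del: upt_Suc\<close>)
  have "t = s + 2" using arg_cong[OF eq, of length] st by (simp del: upt_Suc)
  moreover have "c = p ! Suc s" using arg_cong[OF eq, of "\<lambda>xs. xs ! 1"] st by (simp del: upt_Suc)
  ultimately show ?thesis by blast
qed

text \<open>Acyclicity makes validity local: the only neighbour of \<open>p ! x\<close> on the
  segment is \<open>p ! Suc x\<close>, likewise at the other end, and a common neighbour of both
  segment ends would be \<open>p ! Suc x\<close>. So the two ends of a window can be exchanged
  independently.\<close>

lemma valid_iff:
  "valid x a b \<longleftrightarrow> x + (n - 2) \<le> length p \<and> adj G a (p ! x) \<and> a \<noteq> p ! Suc x \<and>
    adj G b (p ! (x + (n - 3))) \<and> b \<noteq> p ! (x + (n - 4))" (is "?L \<longleftrightarrow> ?R")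
proof -
  let ?s = "map ((!) p) [x..<x + (n - 2)]"
  have sne: "?s \<noteq> []" using n4 by simp
  have hs: "hd ?s = p ! x" "last ?s = p ! (x + (n - 3))" using n4 by (auto simp: hd_map last_map)
  have W: "is_path G (window x a b) \<longleftrightarrow> is_path G ?s \<and> a \<in> verts G \<and> b \<in> verts G \<and> a \<notin> set ?s \<and> b \<notin> set ?s \<and> a \<noteq> b \<and>
      adj G a (p ! x) \<and> adj G b (p ! (x + (n - 3)))"
  proof -
    have "is_path G (?s @ [b]) \<longleftrightarrow> is_path G ?s \<and> b \<in> verts G \<and> b \<notin> set ?s \<and> adj G (p ! (x + (n - 3))) b"
      using sne hs by (subst is_path_append) auto
    moreover have "is_path G (a # ?s @ [b]) \<longleftrightarrow> a \<in> verts G \<and> is_path G (?s @ [b]) \<and> a \<notin> set (?s @ [b]) \<and> adj G a (p ! x)"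
      using sne hs by (subst is_path_Cons) (auto simp: hd_append)
    ultimately show ?thesis unfolding window_def by (auto simp: adj_sym)
  qed
  show ?thesis
  proof
    assume L: ?L
    have "Suc x \<in> {x..<x + (n - 2)}" "x + (n - 4) \<in> {x..<x + (n - 2)}" using n4 by auto
    then have "p ! Suc x \<in> set ?s" "p ! (x + (n - 4)) \<in> set ?s" unfolding set_map set_upt by blast+
    then show ?R using L unfolding valid_def W by blast
  next
    assume R: ?R
    have xl: "x + (n - 2) \<le> length p" and a: "adj G a (p ! x)" "a \<noteq> p ! Suc x"
      and b: "adj G b (p ! (x + (n - 3)))" "b \<noteq> p ! (x + (n - 4))" using R by auto
    have "a \<notin> set ?s"
    proof
      assume "a \<in> set ?s"
      then obtain t where t: "x \<le> t" "t < x + (n - 2)" "a = p ! t" by auto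
      then have "x = Suc t \<or> t = Suc x" using a(1) p_adj_iff[of t x] xl by auto
      then show False using t a(2) by auto
    qed
    moreover have "b \<notin> set ?s"
    proof
      assume "b \<in> set ?s"
      then obtain t where t: "x \<le> t" "t < x + (n - 2)" "b = p ! t" by auto
      then have "x + (n - 3) = Suc t \<or> t = Suc (x + (n - 3))" using b(1) p_adj_iff[of t "x + (n - 3)"] xl n4 by auto
      then have "t = x + (n - 4)" using t n4 by auto
      then show False using t b(2) by simp
    qed
    moreover have "a \<noteq> b"
    proof
      assume "a = b"
      moreover have "x < x + (n - 3)" "x + (n - 3) < length p" using xl n4 by linarith+
      ultimately have "a = p ! Suc x" using two_neighbours[of a x "x + (n - 3)"] a b by blast
      then show False using a(2) by simp
    qed
    moreover have "is_path G ?s" by (rule path_segment_less[OF path]) (use xl n4 in auto)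
    ultimately show ?L unfolding valid_def W using a b xl adj_verts[OF simple] by blast
  qed
qed

text \<open>This supplies the vertex of the earlier window by which the later one can be modified.
  If both alternatives fail, the two windows are disjoint without edges between them and form an
  induced pair of paths.\<close>

lemma windows_meet:
  assumes two: "\<not> contains_induced G (disjoint_union (path_graph n) (path_graph n))"
    and v: "valid x a b" and v': "valid x' a' b'" and lt: "x < x'"
  defines "z \<equiv> p ! (x' - 1)" and "W \<equiv> set (window x a b)"
  shows "(a' \<noteq> z \<and> z \<in> W) \<or> (a' = z \<and> (\<exists>c\<in>W. adj G c z \<and> c \<noteq> p ! x'))"
proof (rule ccontr)
  assume neg: "\<not> ?thesis"
  let ?W' = "set (window x' a' b')"
  note va = v[unfolded valid_iff] and va' = v'[unfolded valid_iff]
  have x': "0 < x'" "x' < length p" using lt va' n4 by auto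
  have Wseg: "p ! t \<in> W" if "x \<le> t" "t < x + (n - 2)" for t
    using that unfolding W_def set_window by auto
  have abW: "a \<in> W" "b \<in> W" unfolding W_def set_window by auto
  \<comment> \<open>A window through z also contains a neighbour of z other than
    \<open>p ! x'\<close>, whether z is in its segment or one of its ends. So z in W would satisfy
    one of the alternatives.\<close>
  have zW: "z \<notin> W"
  proof
    assume zW: "z \<in> W"
    have "\<exists>c\<in>W. adj G c z \<and> c \<noteq> p ! x'"
    proof (cases "x' - 1 < x + (n - 2)")
      case True
      show ?thesis
      proof (cases "x' - 1 = x")
        case True
        then have "Suc x = x'" using lt by simp
        then show ?thesis using va abW(1) True unfolding z_def by auto
      next
        case False
        then have "p ! (x' - 2) \<in> W" using True lt by (intro Wseg) auto
        moreover have "adj G (p ! (x' - 2)) z" unfolding z_def using False lt x' by (subst p_adj_iff) auto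
        moreover have "p ! (x' - 2) \<noteq> p ! x'" using x' False lt by (subst p_eq_iff) auto
        ultimately show ?thesis by blast
      qed
    next
      case False
      have "z \<notin> (!) p ` {x..<x + (n - 2)}"
      proof
        assume "z \<in> (!) p ` {x..<x + (n - 2)}"
        then obtain t where t: "x \<le> t" "t < x + (n - 2)" "p ! (x' - 1) = p ! t" unfolding z_def by auto
        then have "x' - 1 = t" using p_eq_iff[of "x' - 1" t] x' va by auto
        then show False using t False by simp
      qed
      then have "z = a \<or> z = b" using zW unfolding W_def set_window by blast
      then show ?thesis
      proof
        assume "z = a"
        then have "adj G (p ! (x' - 1)) (p ! x)" using va unfolding z_def by auto
        then have "x' - 1 = Suc x \<or> x = Suc (x' - 1)" using p_adj_iff[of "x' - 1" x] x' lt by auto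
        then show ?thesis using False lt n4 by auto
      next
        assume "z = b"
        then have "adj G (p ! (x + (n - 3))) z" using va by (auto simp: adj_sym)
        moreover have "p ! (x + (n - 3)) \<in> W" using n4 by (intro Wseg) auto
        moreover have "p ! (x + (n - 3)) \<noteq> p ! x'" using x' False n4 lt by (subst p_eq_iff) auto
        ultimately show ?thesis by blast
      qed
    qed
    then show False using neg zW by blast
  qed
  have far: "x + (n - 2) \<le> x' - 1"
  proof (rule ccontr)
    assume "\<not> ?thesis"
    then have "z \<in> W" unfolding z_def using lt by (intro Wseg) auto
    then show False using zW by blast
  qed
  \<comment> \<open>The negated goal still allows c = \<open>p ! x'\<close>, but that vertex is out
    of reach of W, whose segment ends before z.\<close>
  have no_adj: "\<not> adj G c z" if "a' = z" "c \<in> W" for c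
  proof
    assume c: "adj G c z"
    then have cx: "c = p ! x'" using neg that by blast
    have "c \<notin> (!) p ` {x..<x + (n - 2)}"
    proof
      assume "c \<in> (!) p ` {x..<x + (n - 2)}"
      then obtain t where t: "x \<le> t" "t < x + (n - 2)" "p ! x' = p ! t" using cx by auto
      then have "x' = t" using p_eq_iff[of x' t] x' va by auto
      then show False using t far by simp
    qed
    then have "c = a \<or> c = b" using that(2) unfolding W_def set_window by blast
    then have "adj G (p ! x') (p ! x) \<or> adj G (p ! x') (p ! (x + (n - 3)))" using va cx by auto
    then show False using p_adj_iff[of x' x] p_adj_iff[of x' "x + (n - 3)"] x' far va n4 by auto
  qed
  have seg_W': "p ! t \<in> ?W' \<Longrightarrow> p ! t = a'" if "t < x'" for t
  proof -
    assume "p ! t \<in> ?W'"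
    moreover have "p ! t \<notin> (!) p ` {x'..<x' + (n - 2)}"
    proof
      assume "p ! t \<in> (!) p ` {x'..<x' + (n - 2)}"
      then obtain u where u: "x' \<le> u" "u < x' + (n - 2)" "p ! t = p ! u" by auto
      then have "t = u" using p_eq_iff[of t u] that x' va' by auto
      then show False using u that by simp
    qed
    moreover have "p ! t \<noteq> b'"
    proof
      assume "p ! t = b'"
      then have "adj G (p ! t) (p ! (x' + (n - 3)))" using va' by auto
      moreover have "x' + (n - 3) < length p" "t < length p" using va' n4 that x' by linarith+
      ultimately have "t = Suc (x' + (n - 3)) \<or> x' + (n - 3) = Suc t" using p_adj_iff by blast
      then show False using that n4 by linarith
    qed
    ultimately show "p ! t = a'" unfolding set_window by blast
  qed
  \<comment> \<open>If the windows touched, the stretch of p between their segments would lie in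
    their union. It contains z, which must then be a', and the vertex before z, which is not a' and
    hence is in W, adjacent to z.\<close>
  have apart: False if c: "c \<in> W" and y: "y \<in> ?W'" and cy: "c = y \<or> adj G c y" for c y
  proof -
    let ?U = "W \<union> ?W'" and ?s = "map ((!) p) [x + (n - 3)..<Suc x']"
    have pW: "is_path G (window x a b)" and pW': "is_path G (window x' a' b')" using v v' unfolding valid_def by auto
    have "p ! (x + (n - 3)) \<in> W" using n4 by (intro Wseg) auto
    then have 1: "joined G ?U (p ! (x + (n - 3))) c"
      using joined_path[OF pW] c joined_mono unfolding W_def by (metis sup_ge1)
    have "p ! x' \<in> ?W'" using n4 unfolding set_window by auto
    then have 2: "joined G ?U y (p ! x')" using joined_path[OF pW' y] joined_mono by (metis sup_ge2)
    have "joined G ?U (p ! (x + (n - 3))) y"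
      using cy
    proof
      assume "adj G c y"
      then show ?thesis using joined_step[OF 1] y adj_verts[OF simple] by blast
    qed (use 1 in simp)
    then have J: "joined G ?U (p ! (x + (n - 3))) (p ! x')" using 2 by (rule joined_trans)
    have s: "is_path G ?s" by (rule path_segment_less[OF path]) (use far x' n4 in auto)
    have hl: "hd ?s = p ! (x + (n - 3))" "last ?s = p ! x'"
    proof -
      have "x + (n - 3) < Suc x'" using far n4 by linarith
      then show "hd ?s = p ! (x + (n - 3))" "last ?s = p ! x'" by (simp_all add: hd_map last_map del: upt_Suc)
    qed
    have sub: "set ?s \<subseteq> ?U" by (rule joined_unique_path[OF forest _ s]) (unfold hl, rule J)
    have in_s: "p ! t \<in> set ?s" if "x + (n - 3) \<le> t" "t \<le> x'" for t
    proof -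
      have "t \<in> {x + (n - 3)..<Suc x'}" unfolding atLeastLessThan_iff using that by linarith
      then show ?thesis unfolding set_map set_upt by (rule imageI)
    qed
    have "z \<in> set ?s" unfolding z_def using far n4 by (intro in_s) linarith+
    then have "z \<in> ?W'" using sub zW by blast
    then have za: "z = a'" using seg_W'[of "x' - 1"] x' unfolding z_def by simp
    have "p ! (x' - 2) \<in> set ?s" using far n4 by (intro in_s) linarith+
    then have "p ! (x' - 2) \<in> ?U" using sub by blast
    moreover have "adj G (p ! (x' - 2)) z" unfolding z_def using far n4 x' by (subst p_adj_iff) auto
    ultimately have "p ! (x' - 2) = a'" using no_adj[of "p ! (x' - 2)"] za seg_W'[of "x' - 2"] x' by auto
    then have "p ! (x' - 2) = p ! (x' - 1)" using za unfolding z_def by simp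
    moreover have "x' - 2 < length p" "x' - 1 < length p" "x' - 2 \<noteq> x' - 1" using far n4 x' by linarith+
    ultimately show False using p_eq_iff by blast
  qed
  have "contains_induced G (disjoint_union (path_graph n) (path_graph n))"
  proof (rule contains_two_paths[OF forest simple])
    show "is_path G (window x a b)" "is_path G (window x' a' b')" using v v' unfolding valid_def by auto
    show "set (window x a b) \<inter> ?W' = {}" using apart unfolding W_def by blast
    show "\<not> adj G c y" if "c \<in> set (window x a b)" "y \<in> ?W'" for c y using apart that unfolding W_def by blast
  qed (simp_all add: length_window)
  then show False using two by blast
qed

lemma ex_lq_list_paths:
  assumes two: "\<not> contains_induced G (disjoint_union (path_graph n) (path_graph n))" and L_free
    and fin: "finite (UNIV :: 'v set)"
  shows "\<exists>us. distinct us \<and> set us = path_sets n G \<and> lq_list us"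
proof -
  \<comment> \<open>An arbitrary numbering of the vertices, to break ties between windows at the
    same position.\<close>
  obtain h :: "'v \<Rightarrow> nat" where h: "inj h" using finite_imp_inj_to_nat_seg[OF fin] by (metis)
  \<comment> \<open>The windows are ordered by their position along \<open>p\<close>; at a given position, those continuing \<open>p\<close> to
    the left come first.\<close>
  define R where "R = {(x, a, b). valid x a b}"
  define ra where "ra x a = (if 0 < x \<and> a = p ! (x - 1) then 0 else Suc (h a))" for x a
  define key where "key = (\<lambda>(x, a, b). (x, ra x a, h b))"
  define S where "S = (\<lambda>(x, a, b). set (window x a b))"
  have ra_inj: "a = a'" if "ra x a = ra x a'" for x a a'
    using that injD[OF h] unfolding ra_def by (auto split: if_splits)
  have "R \<subseteq> {..length p} \<times> UNIV \<times> UNIV" unfolding R_def valid_def by auto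
  then have finR: "finite R" using fin finite_subset by (metis finite_SigmaI finite_atMost)
  have SR: "S ` R = path_sets n G"
  proof
    show "S ` R \<subseteq> path_sets n G"
      unfolding S_def R_def valid_def using length_window by (auto intro!: path_setsI)
    show "path_sets n G \<subseteq> S ` R"
    proof
      fix u assume "u \<in> path_sets n G"
      then obtain q where q: "is_path G q" "length q = n" "u = set q" unfolding path_sets_def by blast
      then obtain x a b where "valid x a b" "u = set (window x a b)" using path_is_window[OF \<open>L_free\<close> q(1,2)] by blast
      then show "u \<in> S ` R" unfolding S_def R_def by force
    qed
  qed
  have "\<exists>us. distinct us \<and> set us = S ` R \<and> lq_list us"
  proof (rule ex_lq_list[OF finR, of key])
    show "S r = S r'" if "r \<in> R" "r' \<in> R" "key r = key r'" for r r'
    proof -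
      obtain x a b where rx: "r = (x, a, b)" by (cases r)
      obtain x' a' b' where rx': "r' = (x', a', b')" by (cases r')
      have "x = x'" "ra x a = ra x a'" "h b = h b'" using that(3) unfolding rx rx' key_def by auto
      then show ?thesis using ra_inj[of x a a'] injD[OF h, of b b'] rx rx' by simp
    qed
    fix r r' assume r: "r \<in> R" and r': "r' \<in> R" and key: "key r < key r'" and neq: "S r \<noteq> S r'"
    obtain x a b where rx: "r = (x, a, b)" by (cases r)
    obtain x' a' b' where rx': "r' = (x', a', b')" by (cases r')
    have v: "valid x a b" and v': "valid x' a' b'" using r r' rx rx' unfolding R_def by auto
    note va = v[unfolded valid_iff] and va' = v'[unfolded valid_iff]
    let ?seg = "\<lambda>x. (!) p ` {x..<x + (n - 2)}"
    have ends: "a \<notin> ?seg x \<and> b \<notin> ?seg x \<and> a \<noteq> b" if "valid x a b" for x a b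
      using that unfolding valid_def is_path_def window_def by auto
    have goal: "\<exists>t\<in>R. key t < key r' \<and> (\<exists>z\<in>S r. S t - S r' = {z})" if "valid y c d" "key (y, c, d) < key (x', a', b')" "z \<in> set (window x a b)"
      "set (window y c d) - set (window x' a' b') = {z}" for y c d z
      using that rx rx' unfolding R_def S_def by (intro bexI[of _ "(y, c, d)"]) auto
    have "x < x' \<or> (x = x' \<and> ra x a < ra x' a') \<or> (x = x' \<and> ra x a = ra x' a' \<and> h b < h b')"
      using key unfolding rx rx' key_def by auto
    then consider "x < x'" | "x = x'" "ra x a < ra x a'" | "x = x'" "a = a'" "h b < h b'" using ra_inj by blast
    then show "\<exists>t\<in>R. key t < key r' \<and> (\<exists>z\<in>S r. S t - S r' = {z})"
    proof cases
      case 3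
      then show ?thesis using ends[OF v] ends[OF v'] v rx rx'
        by (intro goal[of x a b b]) (auto simp: key_def set_window)
    next
      case 2
      \<comment> \<open>By \<open>valid_iff\<close> the left end a combines with the right end b';
        the result differs from the later window only in a.\<close>
      have m: "valid x a b'" using va va' 2 unfolding valid_iff by simp
      have "a \<noteq> a'" using 2 by auto
      then show ?thesis using ends[OF m] ends[OF v'] m 2
        by (intro goal[of x a b' a]) (auto simp: key_def set_window)
    next
      case 1
      \<comment> \<open>If a' is not z, exchange a' for z without moving the window: z belongs to
        the earlier window, and the new window precedes the later one because its \<open>ra\<close>
        is 0.\<close>
      define z where "z = p ! (x' - 1)"
      show ?thesis
      proof (cases "a' = z")
        case False
        have "z \<in> set (window x a b)"
          using windows_meet[OF two v v' 1] False unfolding z_def by blast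
        moreover have m: "valid x' z b'"
        proof -
          have "x' - 1 < length p" "x' < length p" "Suc x' < length p" using va' 1 n4 by linarith+
          then have "adj G z (p ! x')" "z \<noteq> p ! Suc x'"
            using 1 p_adj_iff[of "x' - 1" x'] p_eq_iff[of "x' - 1" "Suc x'"] unfolding z_def by auto
          then show ?thesis unfolding valid_iff using va' by blast
        qed
        ultimately show ?thesis using ends[OF m] ends[OF v'] m 1 False
          by (intro goal[of x' z b' z]) (auto simp: key_def set_window ra_def z_def)
      next
        case True
        then obtain c where c: "c \<in> set (window x a b)" "adj G c z" "c \<noteq> p ! x'"
          using windows_meet[OF two v v' 1] unfolding z_def by blast
        \<comment> \<open>The later window already continues p to the left, so it is shifted by one
          place: z becomes interior, c the left end, and the last vertex of the old segment the
          right end. Only b' is lost and only c is gained.\<close>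
        let ?y = "x' - 1" and ?d = "p ! (x' + (n - 3))"
        have m: "valid ?y c ?d"
          unfolding valid_iff
        proof (intro conjI)
          show "?y + (n - 2) \<le> length p" using va' by linarith
          show "adj G c (p ! ?y)" "c \<noteq> p ! Suc ?y" using c 1 unfolding z_def by auto
          show "adj G ?d (p ! (?y + (n - 3)))" using va' 1 n4 by (subst p_adj_iff) auto
          show "?d \<noteq> p ! (?y + (n - 4))" using va' 1 n4 by (subst p_eq_iff) auto
        qed
        have "(!) p ` {x'..<x' + (n - 2)} = insert ?d ((!) p ` {x'..<x' + (n - 3)})"
        proof -
          have "{x'..<x' + (n - 2)} = insert (x' + (n - 3)) {x'..<x' + (n - 3)}" using n4 by auto
          then show ?thesis by simp
        qed
        moreover have "(!) p ` {?y..<?y + (n - 2)} = insert z ((!) p ` {x'..<x' + (n - 3)})"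
        proof -
          have "{?y..<?y + (n - 2)} = insert ?y {x'..<x' + (n - 3)}" using n4 1 by auto
          then show ?thesis by (simp add: z_def)
        qed
        ultimately have sets: "set (window ?y c ?d) = insert c (insert z (?seg x'))"
          "set (window x' a' b') = insert z (insert b' (?seg x'))"
          using True unfolding set_window by auto
        have "c \<noteq> z" using adj_neq[OF simple c(2)] .
        moreover have "c \<notin> ?seg x'"
        proof
          assume "c \<in> ?seg x'"
          then obtain t where t: "x' \<le> t" "t < x' + (n - 2)" "c = p ! t" by auto
          then have "t = Suc (x' - 1) \<or> x' - 1 = Suc t"
            using c(2) p_adj_iff[of t "x' - 1"] va' 1 unfolding z_def by auto
          then show False using t c(3) 1 by auto
        qed
        moreover have "c \<noteq> b'"
        proof
          assume "c = b'"
          then have "c = p ! Suc (x' - 1)"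
            using two_neighbours[of c "x' - 1" "x' + (n - 3)"] c(2) va' 1 n4 unfolding z_def by auto
          then show False using c(3) 1 by simp
        qed
        ultimately have "set (window ?y c ?d) - set (window x' a' b') = {c}" unfolding sets by auto
        then show ?thesis using m c(1) 1 by (intro goal[of ?y c ?d c]) (auto simp: key_def)
      qed
    qed
  qed
  then show ?thesis unfolding SR .
qed

end

section \<open>Trees with linear path ideals\<close>

lemma tree_ex_longest_path:
  fixes G :: "'v::finite graph"
  assumes "is_tree G" "4 \<le> n"
  shows "\<exists>p. longest_path G p n"
proof -
  have sg: "simple_graph G" and ac: "\<nexists>c. is_cycle G c" and cg: "connected_graph G"
    using assms(1) unfolding is_tree_def by auto
  obtain v where "v \<in> verts G" using cg unfolding connected_graph_def by blast
  then have v: "is_path G [v]" by simp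
  have bound: "length q < Suc (card (UNIV :: 'v set))" if "is_path G q" for q
    using that distinct_card[of q] card_mono[of UNIV "set q"] unfolding is_path_def by (simp add: less_Suc_eq_le)
  have "\<exists>p. is_path G p \<and> (\<forall>q. is_path G q \<longrightarrow> length q \<le> length p)"
    using v bound by (intro ex_has_greatest_nat[of "is_path G" "[v]" length "Suc (card (UNIV :: 'v set))"]) auto
  then obtain p where p: "is_path G p" "\<forall>q. is_path G q \<longrightarrow> length q \<le> length p" by (elim exE conjE)
  have "joined G (verts G) x y" if "x \<in> verts G" "y \<in> verts G" for x y
    using cg that unfolding connected_graph_def joined_def is_path_def by metis
  then have "longest_path G p n" using sg ac p assms(2) by unfold_locales auto
  then show ?thesis by blast
qed

context longest_path
begin

section \<open>Diameter conditions\<close>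

lemma diam_eq: "diam G = length p - 1"
  unfolding diam_def
proof (rule Max_eqI)
  show "finite {length q - 1 |q. is_path G q}"
    by (rule finite_subset[of _ "{..length p}"]) (use longest in \<open>force\<close>)+
  show "y \<le> length p - 1" if "y \<in> {length q - 1 |q. is_path G q}" for y
    using that longest by (auto intro: diff_le_mono)
  show "length p - 1 \<in> {length q - 1 |q. is_path G q}" using path by blast
qed

lemma no_long_paths:
  assumes "diam G < n - 1" "is_path G q" shows "length q < n"
proof -
  have "length q \<le> length p" by (rule longest[OF assms(2)])
  then show ?thesis using assms(1) diam_eq by linarith
qed

text \<open>A path on at least 2n + 1 vertices leaves room for two segments of n vertices with the
  vertex \<open>p ! n\<close> skipped between them.\<close>

lemma two_paths_of_long_path:
  assumes "2 * n \<le> diam G"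
  shows "contains_induced G (disjoint_union (path_graph n) (path_graph n))"
proof (rule contains_two_paths[OF forest simple])
  have len: "2 * n < length p" using assms diam_eq n4 by linarith
  let ?a = "map ((!) p) [0..<n]" and ?b = "map ((!) p) [Suc n..<Suc n + n]"
  show "is_path G ?a" by (rule path_segment_less[OF path]) (use n4 len in linarith)+
  show "is_path G ?b" by (rule path_segment_less[OF path]) (use n4 len in linarith)+
  show "length ?a = n" "length ?b = n" by simp_all
  have ab: "\<exists>i j. i < n \<and> n < j \<and> j < length p \<and> x = p ! i \<and> y = p ! j" if x: "x \<in> set ?a" and y: "y \<in> set ?b" for x y
  proof -
    obtain i where "i < n" "x = p ! i" using x by auto
    moreover obtain j where "j \<in> {Suc n..<Suc n + n}" "y = p ! j" using y unfolding set_map set_upt by blast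
    ultimately show ?thesis using len by (intro exI[of _ i] exI[of _ j]) auto
  qed
  have "x \<noteq> y" if xy: "x \<in> set ?a" "y \<in> set ?b" for x y
  proof -
    obtain i j where "i < n" "n < j" "j < length p" "x = p ! i" "y = p ! j" using ab[OF xy] by blast
    then show ?thesis using p_eq_iff[of i j] by simp
  qed
  then show "set ?a \<inter> set ?b = {}" by blast
  show "\<not> adj G x y" if xy: "x \<in> set ?a" "y \<in> set ?b" for x y
  proof -
    obtain i j where "i < n" "n < j" "j < length p" "x = p ! i" "y = p ! j" using ab[OF xy] by blast
    then show ?thesis using p_adj_iff[of i j] by simp
  qed
qed

end

lemma contained_path_diam:
  assumes "longest_path G p n" "contains_induced G H" "is_path H h"
  shows "length h \<le> length p"
proof -
  obtain f where "inj_on f (verts H)" "f ` verts H \<subseteq> verts G"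
    "\<forall>u\<in>verts H. \<forall>v\<in>verts H. adj H u v \<longleftrightarrow> adj G (f u) (f v)"
    using contains_inducedD[OF assms(2)] by blast
  then have "is_path G (map f h)" using path_image[of f H G h] assms(3) by blast
  then show ?thesis using longest_path.longest[OF assms(1)] by fastforce
qed

lemma path_in_L_graph:
  assumes "2 \<le> k" "k \<le> m" shows "is_path (L_graph m k) (map Inl [1..<Suc m])"
  unfolding is_path_def using assms
  by (auto simp: verts_L_graph distinct_map adj_L_graph[OF assms] simp del: upt_Suc intro!: successively_upt)

lemma path_in_two_paths:
  "1 \<le> n \<Longrightarrow> is_path (disjoint_union (path_graph n) (path_graph n)) (map Inl [1..<Suc n])"
  unfolding is_path_def
  by (auto simp: verts_disjoint_union distinct_map adj_disjoint_union adj_path_graph simp del: upt_Suc intro!: successively_upt)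

theorem theorem5p1:
  fixes G :: "'v::finite graph" and n :: nat and J :: "('v, 'k::field) mpoly set"
  assumes "is_tree G" and "verts G = UNIV" and "4 \<le> n"
    and "J = path_ideal n G"
  shows "(has_linear_quotients J \<longleftrightarrow> has_linear_resolution J) \<and>
    (has_linear_quotients J \<longleftrightarrow>
       (n = 4 \<and>
          \<not> (contains_induced G (disjoint_union (path_graph 4) (path_graph 4)) \<or>
             contains_induced G (L_graph 5 3))) \<or>
       (5 \<le> n \<and>
          \<not> contains_induced G (disjoint_union (path_graph n) (path_graph n)) \<and>
          (\<forall>k::nat. 3 \<le> k \<and> real k \<le> (real n + 1) / 2 \<longrightarrow> \<not> contains_induced G (L_graph n k)))) \<and>
    (has_linear_quotients J \<longleftrightarrow> diam G < n - 1 \<or> F_condition n G)"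
proof -
  let ?two = "contains_induced G (disjoint_union (path_graph n) (path_graph n))"
  let ?c3 = "(n = 4 \<and>
          \<not> (contains_induced G (disjoint_union (path_graph 4) (path_graph 4)) \<or>
             contains_induced G (L_graph 5 3))) \<or>
       (5 \<le> n \<and>
          \<not> contains_induced G (disjoint_union (path_graph n) (path_graph n)) \<and>
          (\<forall>k::nat. 3 \<le> k \<and> real k \<le> (real n + 1) / 2 \<longrightarrow> \<not> contains_induced G (L_graph n k)))"
  let ?c4 = "diam G < n - 1 \<or> F_condition n G"
  obtain p where p: "longest_path G p n" using tree_ex_longest_path[OF assms(1,3)] by blast
  interpret longest_path G p n by (rule p)
  have J: "J = ideal_gen (monomial ` expo ` path_sets n G)" unfolding assms(4) by (rule path_ideal_eq)
  have lq: "has_linear_quotients J \<longleftrightarrow> (\<exists>us. distinct us \<and> set us = path_sets n G \<and> lq_list us)"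
    unfolding J by (rule has_linear_quotients_squarefree) (rule card_path_sets)
  have half: "real k \<le> (real n + 1) / 2 \<longleftrightarrow> 2 * k \<le> n + 1" for k
  proof -
    have "real k \<le> (real n + 1) / 2 \<longleftrightarrow> real (2 * k) \<le> real (n + 1)" by (simp add: field_simps)
    then show ?thesis by (simp only: of_nat_le_iff)
  qed
  have 12: "has_linear_resolution J" if hlq: "has_linear_quotients J"
  proof -
    obtain us where us: "set us = path_sets n G" "lq_list us" using hlq unfolding lq by blast
    show ?thesis unfolding J us(1)[symmetric]
      by (rule lq_list_linear_resolution[OF us(2)]) (use us(1) card_path_sets in blast)
  qed
  \<comment> \<open>The upper bound 2n - 1 on the diameter is no separate obstruction: a longer path
    already contains the induced pair of paths.\<close>
  have 24: ?c4 if lin: "has_linear_resolution J"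
  proof (cases "diam G < n - 1")
    case False
    have lin': "has_linear_resolution (path_ideal n G :: ('v, 'k) mpoly set)" using lin assms(4) by simp
    have two: "\<not> ?two" using two_paths_not_linear[of G n, where 'k='k] lin' assms(3) by auto
    have "\<not> 2 * n \<le> diam G" using two_paths_of_long_path two by blast
    then have "diam G \<in> {n - 1..2 * n - 1}" using False by auto
    moreover have "\<not> contains_induced G (L_graph 5 3)" if "n = 4"
      using L53_not_linear[of G, where 'k='k] lin' that by auto
    moreover have "\<not> contains_induced G (L_graph n k)" if "k \<in> {3..n - 2}" for k
    proof -
      have "3 \<le> k" "k + 2 \<le> n" using that assms(3) by auto
      then show ?thesis using L_graph_not_linear[of G n k, where 'k='k] lin' by blast
    qed
    ultimately have "F_condition n G" using two assms(3) unfolding F_condition_def by (cases "n = 4") auto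
    then show ?thesis by blast
  qed simp
  \<comment> \<open>For a small diameter the forbidden graphs are absent because each contains a
    path on at least n vertices. Otherwise the range of k in \<open>F_condition\<close> covers that
    of (3), since (n + 1)/2 <= n - 2 for n >= 5.\<close>
  have 43: ?c3 if c4: ?c4
  proof (cases "diam G < n - 1")
    case True
    then have len: "length p < n" using no_long_paths path by blast
    have "\<not> ?two" using contained_path_diam[OF p _ path_in_two_paths[of n]] len assms(3) by auto
    moreover have "\<not> contains_induced G (L_graph 5 3)" if "n = 4"
      using contained_path_diam[OF p _ path_in_L_graph[of 3 5]] len that by (auto simp del: upt_Suc)
    moreover have "\<not> contains_induced G (L_graph n k)" if "5 \<le> n" "3 \<le> k" "2 * k \<le> n + 1" for k
      using contained_path_diam[OF p _ path_in_L_graph[of k n]] len that by (auto simp del: upt_Suc)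
    ultimately show ?thesis using assms(3) unfolding half by (cases "n = 4") auto
  next
    case False
    then have "F_condition n G" using c4 by blast
    then show ?thesis unfolding F_condition_def half by auto
  qed
  have 31: "has_linear_quotients J" if c3: ?c3
  proof -
    have "\<not> ?two" using c3 by auto
    moreover have L_free using c3 unfolding L_free_def half by auto
    ultimately show ?thesis unfolding lq by (intro ex_lq_list_paths) auto
  qed
  show ?thesis using 12 24 43 31 by blast
qed

end
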